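(* Let $X$ and $Y$ be sheaves in $\mathcal F_T(\mathcal S)$ with $Y$ hyperbolic, and let $f:X\to Y$ be a morphism of sheaves. Let $\tilde f:\mathfrak{Ip}(X)\to Y$ be the unique morphism in $\mathcal H_s$ with $\tilde f\circ\mathfrak r=f$, where $\mathfrak r:X\to\mathfrak{Ip}(X)$ is the canonical morphism. Then the composition $\tilde f\circ\mathfrak r$ is a morphism of sheaves, and the commutativity $\tilde f\circ\mathfrak r=f$ of the triangle formed by $\mathfrak r:X\to\mathfrak{Ip}(X)$, $\tilde f:\mathfrak{Ip}(X)\to Y$ and $f:X\to Y$ holds in the category of sheaves, i.e. it is strictly commutative and not only "up to homotopy" in $\mathcal H_s$.
   Context: $\mathcal S_T$ is one of the following sites. Complex case: the category of complex spaces and holomorphic maps with the strong topology (coverings are open coverings in the classical topology). Algebraic case: the category of schemes of finite type over a noetherian scheme $B$ of finite dimension, with a Grothendieck topology $T$ weaker than or as fine as the quasi-compact flat topology. $\mathbb A^1$ denotes the affine line $\mathbb A^1_B$ in the algebraic case and $\mathbb C$ in the complex case. $\mathcal F_T(\mathcal S)$ is the category of sheaves of sets on $\mathcal S_T$, and $\Delta^{op}\mathcal F_T(\mathcal S)$ the category of simplicial sheaves. Sheaves are identified with constant simplicial sheaves. A morphism of simplicial sheaves is a simplicial weak equivalence if it induces weak equivalences of simplicial sets on all stalks; a simplicial fibration is a morphism with the right lifting property with respect to monomorphisms that are simplicial weak equivalences; $\mathcal X$ is simplicially fibrant if $\mathcal X\to\mathrm{pt}$ is a simplicial fibration. $\mathcal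 H_s$ is the localization of $\Delta^{op}\mathcal F_T(\mathcal S)$ at the simplicial weak equivalences; a morphism in $\mathcal H_s$ between sheaves "is a morphism of sheaves" if it is the image of one under the localization functor. A simplicial sheaf $\mathcal X$ is hyperbolic (equivalently, $\mathbb A^1$-local) if for every simplicial sheaf $\mathcal Y$ the projection $\mathcal Y\times\mathbb A^1\to\mathcal Y$ induces a bijection $\mathrm{Hom}_{\mathcal H_s}(\mathcal Y,\mathcal X)\to\mathrm{Hom}_{\mathcal H_s}(\mathcal Y\times\mathbb A^1,\mathcal X)$. A morphism $f:\mathcal X\to\mathcal Y$ is an affine weak equivalence if for every $\mathbb A^1$-local $\mathcal Z$ composition with $f$ is a bijection between $\mathrm{Hom}_{\mathcal H_s}(\mathcal Y,\mathcal Z)$ and $\mathrm{Hom}_{\mathcal H_s}(\mathcal X,\mathcal Z)$. $(\mathfrak{Ip},\mathfrak r)$ is a fixed hyperbolic resolution functor: a functor $\mathfrak{Ip}:\Delta^{op}\mathcal F_T(\mathcal S)\to\Delta^{op}\mathcal F_T(\mathcal S)$ with a natural transformation $\mathfrak r:\mathrm{Id}\to\mathfrak{Ip}$ such that, for all $\mathcal X$, $\mathfrak{Ip}(\mathcal X)$ is hyperbolic and simplicially fibrant, and $\mathfrak r_{\mathcal X}$ is a monomorphism and an affine weak equivalence (such a functor exists). Since $Y$ is hyperbolic, every morphism $X\to Y$ in $\mathcal H_s$ factors uniquely through $\mathfrak r:X\to\mathfrak{Ip}(X)$ in $\mathcal H_s$.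
   Formalization: In the algebraic case the site is additionally assumed to have enough points (stalk functors jointly conservative on sheaves); without this, distinct morphisms of sheaves to a hyperbolic sheaf can become equal in H_s. No such assumption is made in the complex case. *)

theory Defs
  imports
    "HOL-Algebra.UnivPoly"
    "HOL-Algebra.Ring_Divisibility"
    "HOL-Algebra.Generated_Rings"
    "HOL-Analysis.Analysis"
    "HOL-Homology.Homology"
begin

text \<open>
  "Set" means: sets of elements of a type. Sections of sheaves live in the sets over a type
  \<open>'v\<close>, and complex spaces and schemes have their points in a type \<open>'x\<close> and their sections in
  a type \<open>'r\<close>; these types play the role of Grothendieck universes.
\<close>


section \<open>Categories\<close>

record ('o, 'a) cat =
  ob :: "'o set"
  ar :: "'a set"
  src :: "'a \<Rightarrow> 'o"
  tgt :: "'a \<Rightarrow> 'o"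
  ide :: "'o \<Rightarrow> 'a"
  cmp :: "'a \<Rightarrow> 'a \<Rightarrow> 'a"

text \<open>\<open>cmp C g f\<close> is \<open>g\<close> after \<open>f\<close>; it is only meaningful if \<open>src C g = tgt C f\<close>.\<close>

definition Hom :: "('o, 'a) cat \<Rightarrow> 'o \<Rightarrow> 'o \<Rightarrow> 'a set" where
  "Hom C X Y = {f \<in> ar C. src C f = X \<and> tgt C f = Y}"

definition category :: "('o, 'a) cat \<Rightarrow> bool" where
  "category C \<longleftrightarrow>
     (\<forall>f\<in>ar C. src C f \<in> ob C \<and> tgt C f \<in> ob C) \<and>
     (\<forall>X\<in>ob C. ide C X \<in> Hom C X X) \<and>
     (\<forall>f\<in>ar C. \<forall>g\<in>ar C. src C g = tgt C f \<longrightarrow> cmp C g f \<in> Hom C (src C f) (tgt C g)) \<and>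
     (\<forall>f\<in>ar C. cmp C f (ide C (src C f)) = f \<and> cmp C (ide C (tgt C f)) f = f) \<and>
     (\<forall>f\<in>ar C. \<forall>g\<in>ar C. \<forall>h\<in>ar C. src C g = tgt C f \<and> src C h = tgt C g \<longrightarrow>
        cmp C h (cmp C g f) = cmp C (cmp C h g) f)"

definition opposite :: "('o, 'a) cat \<Rightarrow> ('o, 'a) cat" where
  "opposite C = C\<lparr>src := tgt C, tgt := src C, cmp := (\<lambda>g f. cmp C f g)\<rparr>"

definition full_subcat :: "('o, 'a) cat \<Rightarrow> ('o \<Rightarrow> bool) \<Rightarrow> ('o, 'a) cat" where
  "full_subcat C P =
     C\<lparr>ob := {X \<in> ob C. P X}, ar := {f \<in> ar C. P (src C f) \<and> P (tgt C f)}\<rparr>"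

record ('o, 'a, 'p, 'b) fctr =
  on_ob :: "'o \<Rightarrow> 'p"
  on_ar :: "'a \<Rightarrow> 'b"

definition is_functor :: "('o, 'a) cat \<Rightarrow> ('p, 'b) cat \<Rightarrow> ('o, 'a, 'p, 'b) fctr \<Rightarrow> bool" where
  "is_functor C D F \<longleftrightarrow> category C \<and> category D \<and>
     (\<forall>X\<in>ob C. on_ob F X \<in> ob D) \<and>
     (\<forall>f\<in>ar C. on_ar F f \<in> Hom D (on_ob F (src C f)) (on_ob F (tgt C f))) \<and>
     (\<forall>X\<in>ob C. on_ar F (ide C X) = ide D (on_ob F X)) \<and>
     (\<forall>f\<in>ar C. \<forall>g\<in>ar C. src C g = tgt C f \<longrightarrow>
        on_ar F (cmp C g f) = cmp D (on_ar F g) (on_ar F f))"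

definition id_functor :: "('o, 'a, 'o, 'a) fctr" where
  "id_functor = \<lparr>on_ob = (\<lambda>X. X), on_ar = (\<lambda>f. f)\<rparr>"

type_synonym ('o, 'a, 'p, 'b) ntrans =
  "('o, 'a, 'p, 'b) fctr \<times> ('o \<Rightarrow> 'b) \<times> ('o, 'a, 'p, 'b) fctr"

text \<open>Families of components are extensional, so that equal natural transformations are equal.\<close>

definition functor_cat ::
    "('o, 'a) cat \<Rightarrow> ('p, 'b) cat \<Rightarrow> (('o, 'a, 'p, 'b) fctr, ('o, 'a, 'p, 'b) ntrans) cat" where
  "functor_cat C D =
     \<lparr>ob = {F. is_functor C D F},
      ar = {(F, \<eta>, G). is_functor C D F \<and> is_functor C D G \<and> \<eta> \<in> extensional (ob C) \<and>
             (\<forall>X\<in>ob C. \<eta> X \<in> Hom D (on_ob F X) (on_ob G X)) \<and>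
             (\<forall>f\<in>ar C. cmp D (\<eta> (tgt C f)) (on_ar F f) = cmp D (on_ar G f) (\<eta> (src C f)))},
      src = (\<lambda>(F, \<eta>, G). F),
      tgt = (\<lambda>(F, \<eta>, G). G),
      ide = (\<lambda>F. (F, \<lambda>X\<in>ob C. ide D (on_ob F X), F)),
      cmp = (\<lambda>(G', \<theta>, K) (F, \<eta>, G). (F, \<lambda>X\<in>ob C. cmp D (\<theta> X) (\<eta> X), K))\<rparr>"

definition is_iso :: "('o, 'a) cat \<Rightarrow> 'a \<Rightarrow> bool" where
  "is_iso C f \<longleftrightarrow> f \<in> ar C \<and>
     (\<exists>g\<in>Hom C (tgt C f) (src C f).
        cmp C g f = ide C (src C f) \<and> cmp C f g = ide C (tgt C f))"

definition monic :: "('o, 'a) cat \<Rightarrow> 'a \<Rightarrow> bool" where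
  "monic C f \<longleftrightarrow> f \<in> ar C \<and>
     (\<forall>Z\<in>ob C. \<forall>g\<in>Hom C Z (src C f). \<forall>h\<in>Hom C Z (src C f). cmp C f g = cmp C f h \<longrightarrow> g = h)"

definition terminal_object :: "('o, 'a) cat \<Rightarrow> 'o \<Rightarrow> bool" where
  "terminal_object C T \<longleftrightarrow> T \<in> ob C \<and> (\<forall>X\<in>ob C. \<exists>!f. f \<in> Hom C X T)"

definition is_product :: "('o, 'a) cat \<Rightarrow> 'o \<Rightarrow> 'o \<Rightarrow> 'o \<Rightarrow> 'a \<Rightarrow> 'a \<Rightarrow> bool" where
  "is_product C X Y P p q \<longleftrightarrow> P \<in> ob C \<and> p \<in> Hom C P X \<and> q \<in> Hom C P Y \<and>
     (\<forall>Z\<in>ob C. \<forall>f\<in>Hom C Z X. \<forall>g\<in>Hom C Z Y. \<exists>!h. h \<in> Hom C Z P \<and> cmp C p h = f \<and> cmp C q h = g)"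

definition has_lifts :: "('o, 'a) cat \<Rightarrow> 'a \<Rightarrow> 'a \<Rightarrow> bool" where
  "has_lifts C i p \<longleftrightarrow>
     (\<forall>u\<in>Hom C (src C i) (src C p). \<forall>v\<in>Hom C (tgt C i) (tgt C p).
        cmp C p u = cmp C v i \<longrightarrow>
        (\<exists>h\<in>Hom C (tgt C i) (src C p). cmp C h i = u \<and> cmp C p h = v))"

definition set_cat :: "('v set, 'v set \<times> ('v \<Rightarrow> 'v) \<times> 'v set) cat" where
  "set_cat =
     \<lparr>ob = UNIV,
      ar = {(A, f, B). f \<in> A \<rightarrow>\<^sub>E B},
      src = (\<lambda>(A, f, B). A),
      tgt = (\<lambda>(A, f, B). B),
      ide = (\<lambda>A. (A, \<lambda>x\<in>A. x, A)),
      cmp = (\<lambda>(B', g, D) (A, f, B). (A, compose A g f, D))\<rparr>"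

definition app :: "'v set \<times> ('v \<Rightarrow> 'v) \<times> 'v set \<Rightarrow> 'v \<Rightarrow> 'v" where
  "app = (\<lambda>(A, f, B). f)"


section \<open>Localization of a category\<close>

text \<open>
  The construction of Gabriel and Zisman: morphisms of \<open>C[W\<^sup>-\<^sup>1]\<close> are classes of zigzags.
  The head of a list is the arrow that is applied first.
\<close>

datatype 'a zig = Fwd 'a | Bwd 'a

inductive zigzag :: "('o, 'a) cat \<Rightarrow> 'a set \<Rightarrow> 'o \<Rightarrow> 'a zig list \<Rightarrow> 'o \<Rightarrow> bool"
  for C :: "('o, 'a) cat" and W :: "'a set" where
  empty: "X \<in> ob C \<Longrightarrow> zigzag C W X [] X"
| forward: "f \<in> ar C \<Longrightarrow> zigzag C W (tgt C f) ps Y \<Longrightarrow> zigzag C W (src C f) (Fwd f # ps) Y"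
| backward: "w \<in> W \<Longrightarrow> w \<in> ar C \<Longrightarrow> zigzag C W (src C w) ps Y \<Longrightarrow> zigzag C W (tgt C w) (Bwd w # ps) Y"

inductive zig_reduces :: "('o, 'a) cat \<Rightarrow> 'a set \<Rightarrow> 'a zig list \<Rightarrow> 'a zig list \<Rightarrow> bool"
  for C :: "('o, 'a) cat" and W :: "'a set" where
  identity: "X \<in> ob C \<Longrightarrow> zig_reduces C W (ps @ [Fwd (ide C X)] @ qs) (ps @ qs)"
| composite: "f \<in> ar C \<Longrightarrow> g \<in> ar C \<Longrightarrow> src C g = tgt C f \<Longrightarrow>
    zig_reduces C W (ps @ [Fwd f, Fwd g] @ qs) (ps @ [Fwd (cmp C g f)] @ qs)"
| left_inverse: "w \<in> W \<Longrightarrow> zig_reduces C W (ps @ [Fwd w, Bwd w] @ qs) (ps @ qs)"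
| right_inverse: "w \<in> W \<Longrightarrow> zig_reduces C W (ps @ [Bwd w, Fwd w] @ qs) (ps @ qs)"

definition zig_class :: "('o, 'a) cat \<Rightarrow> 'a set \<Rightarrow> 'o \<Rightarrow> 'o \<Rightarrow> 'a zig list \<Rightarrow> 'a zig list set" where
  "zig_class C W X Y ps =
     {qs. equivclp (\<lambda>as bs. zigzag C W X as Y \<and> zigzag C W X bs Y \<and> zig_reduces C W as bs) ps qs}"

definition localization ::
    "('o, 'a) cat \<Rightarrow> 'a set \<Rightarrow> ('o, 'o \<times> 'a zig list set \<times> 'o) cat" where
  "localization C W =
     \<lparr>ob = ob C,
      ar = {(X, zig_class C W X Y ps, Y) | X ps Y. zigzag C W X ps Y},
      src = (\<lambda>(X, c, Y). X),
      tgt = (\<lambda>(X, c, Y). Y),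
      ide = (\<lambda>X. (X, zig_class C W X X [], X)),
      cmp = (\<lambda>(Y', d, Z) (X, c, Y). (X, \<Union>ps\<in>c. \<Union>qs\<in>d. zig_class C W X Z (ps @ qs), Z))\<rparr>"

definition loc_ar :: "('o, 'a) cat \<Rightarrow> 'a set \<Rightarrow> 'a \<Rightarrow> 'o \<times> 'a zig list set \<times> 'o" where
  "loc_ar C W f = (src C f, zig_class C W (src C f) (tgt C f) [Fwd f], tgt C f)"


section \<open>Simplicial sets\<close>

definition simplex_cat :: "(nat, nat \<times> (nat \<Rightarrow> nat) \<times> nat) cat" where
  "simplex_cat =
     \<lparr>ob = UNIV,
      ar = {(m, \<theta>, n). \<theta> \<in> {..m} \<rightarrow>\<^sub>E {..n} \<and> mono_on {..m} \<theta>},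
      src = (\<lambda>(m, \<theta>, n). m),
      tgt = (\<lambda>(m, \<theta>, n). n),
      ide = (\<lambda>n. (n, \<lambda>i\<in>{..n}. i, n)),
      cmp = (\<lambda>(n', \<eta>, k) (m, \<theta>, n). (m, compose {..m} \<eta> \<theta>, k))\<rparr>"

type_synonym ('o, 'a) simplicial = "(nat, nat \<times> (nat \<Rightarrow> nat) \<times> nat, 'o, 'a) fctr"
type_synonym ('o, 'a) simplicial_map = "(nat, nat \<times> (nat \<Rightarrow> nat) \<times> nat, 'o, 'a) ntrans"
type_synonym 'v sset = "('v set, 'v set \<times> ('v \<Rightarrow> 'v) \<times> 'v set) simplicial"
type_synonym 'v sset_map = "('v set, 'v set \<times> ('v \<Rightarrow> 'v) \<times> 'v set) simplicial_map"

definition cells :: "'v sset \<Rightarrow> (nat \<times> 'v \<times> (nat \<Rightarrow> real)) set" where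
  "cells S = {(n, x, t). x \<in> on_ob S n \<and> t \<in> standard_simplex n}"

definition push_simplex :: "nat \<times> (nat \<Rightarrow> nat) \<times> nat \<Rightarrow> (nat \<Rightarrow> real) \<Rightarrow> nat \<Rightarrow> real" where
  "push_simplex = (\<lambda>(m, \<theta>, n) t j. \<Sum>i | i \<le> m \<and> \<theta> i = j. t i)"

definition glue :: "'v sset \<Rightarrow> nat \<times> 'v \<times> (nat \<Rightarrow> real) \<Rightarrow> nat \<times> 'v \<times> (nat \<Rightarrow> real) \<Rightarrow> bool" where
  "glue S c d \<longleftrightarrow>
     (\<exists>m \<theta> n x t. (m, \<theta>, n) \<in> ar simplex_cat \<and> x \<in> on_ob S n \<and> t \<in> standard_simplex m \<and>
        c = (m, app (on_ar S (m, \<theta>, n)) x, t) \<and> d = (n, x, push_simplex (m, \<theta>, n) t))"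

definition cell_class ::
    "'v sset \<Rightarrow> nat \<times> 'v \<times> (nat \<Rightarrow> real) \<Rightarrow> (nat \<times> 'v \<times> (nat \<Rightarrow> real)) set" where
  "cell_class S c = {d. equivclp (glue S) c d}"

definition realization :: "'v sset \<Rightarrow> (nat \<times> 'v \<times> (nat \<Rightarrow> real)) set topology" where
  "realization S = topology (\<lambda>U. U \<subseteq> cell_class S ` cells S \<and>
     (\<forall>n. \<forall>x\<in>on_ob S n. openin (subtopology (powertop_real UNIV) (standard_simplex n))
        {t \<in> standard_simplex n. cell_class S (n, x, t) \<in> U}))"

definition realization_map ::
    "'v sset_map \<Rightarrow> (nat \<times> 'v \<times> (nat \<Rightarrow> real)) set \<Rightarrow> (nat \<times> 'v \<times> (nat \<Rightarrow> real)) set" where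
  "realization_map = (\<lambda>(S, \<eta>, S') c. \<Union>(n, x, t)\<in>c. cell_class S' (n, app (\<eta> n) x, t))"

definition homotopy_equivalence :: "'a topology \<Rightarrow> 'b topology \<Rightarrow> ('a \<Rightarrow> 'b) \<Rightarrow> bool" where
  "homotopy_equivalence X Y f \<longleftrightarrow> continuous_map X Y f \<and>
     (\<exists>g. continuous_map Y X g \<and>
        homotopic_with (\<lambda>_. True) X X (g \<circ> f) id \<and> homotopic_with (\<lambda>_. True) Y Y (f \<circ> g) id)"

text \<open>
  Quillen's definition. As realizations are CW complexes, it does not matter whether homotopy
  equivalences or weak homotopy equivalences are used here.
\<close>

definition sset_weq :: "'v sset_map \<Rightarrow> bool" where
  "sset_weq \<phi> \<longleftrightarrow> \<phi> \<in> ar (functor_cat (opposite simplex_cat) set_cat) \<and>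
     homotopy_equivalence (realization (fst \<phi>)) (realization (snd (snd \<phi>))) (realization_map \<phi>)"


section \<open>Sites, sheaves and points\<close>

type_synonym ('o, 'a, 'v) psh = "('o, 'a, 'v set, 'v set \<times> ('v \<Rightarrow> 'v) \<times> 'v set) fctr"
type_synonym ('o, 'a, 'v) psh_map = "('o, 'a, 'v set, 'v set \<times> ('v \<Rightarrow> 'v) \<times> 'v set) ntrans"

definition sieve :: "('o, 'a) cat \<Rightarrow> 'o \<Rightarrow> 'a set \<Rightarrow> bool" where
  "sieve C U S \<longleftrightarrow> S \<subseteq> {f \<in> ar C. tgt C f = U} \<and>
     (\<forall>f\<in>S. \<forall>g\<in>ar C. tgt C g = src C f \<longrightarrow> cmp C f g \<in> S)"

definition pullback_sieve :: "('o, 'a) cat \<Rightarrow> 'a \<Rightarrow> 'a set \<Rightarrow> 'a set" where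
  "pullback_sieve C f S = {g \<in> ar C. tgt C g = src C f \<and> cmp C f g \<in> S}"

definition grothendieck_topology :: "('o, 'a) cat \<Rightarrow> ('o \<Rightarrow> 'a set set) \<Rightarrow> bool" where
  "grothendieck_topology C J \<longleftrightarrow>
     (\<forall>U\<in>ob C. \<forall>S\<in>J U. sieve C U S) \<and>
     (\<forall>U\<in>ob C. {f \<in> ar C. tgt C f = U} \<in> J U) \<and>
     (\<forall>U\<in>ob C. \<forall>S\<in>J U. \<forall>f\<in>ar C. tgt C f = U \<longrightarrow> pullback_sieve C f S \<in> J (src C f)) \<and>
     (\<forall>U\<in>ob C. \<forall>S\<in>J U. \<forall>R. sieve C U R \<and> (\<forall>f\<in>S. pullback_sieve C f R \<in> J (src C f)) \<longrightarrow> R \<in> J U)"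

definition is_sheaf :: "('o, 'a) cat \<Rightarrow> ('o \<Rightarrow> 'a set set) \<Rightarrow> ('o, 'a, 'v) psh \<Rightarrow> bool" where
  "is_sheaf C J F \<longleftrightarrow>
     (\<forall>U\<in>ob C. \<forall>S\<in>J U. \<forall>s.
        (\<forall>f\<in>S. s f \<in> on_ob F (src C f)) \<and>
        (\<forall>f\<in>S. \<forall>g\<in>ar C. tgt C g = src C f \<longrightarrow> app (on_ar F g) (s f) = s (cmp C f g)) \<longrightarrow>
        (\<exists>!t. t \<in> on_ob F U \<and> (\<forall>f\<in>S. app (on_ar F f) t = s f)))"

definition Sh :: "('o, 'a) cat \<Rightarrow> ('o \<Rightarrow> 'a set set) \<Rightarrow> (('o, 'a, 'v) psh, ('o, 'a, 'v) psh_map) cat" where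
  "Sh C J = full_subcat (functor_cat (opposite C) set_cat) (is_sheaf C J)"

type_synonym ('o, 'a, 'v) spsh = "(('o, 'a, 'v) psh, ('o, 'a, 'v) psh_map) simplicial"
type_synonym ('o, 'a, 'v) spsh_map = "(('o, 'a, 'v) psh, ('o, 'a, 'v) psh_map) simplicial_map"

definition sSh :: "('o, 'a) cat \<Rightarrow> ('o \<Rightarrow> 'a set set) \<Rightarrow> (('o, 'a, 'v) spsh, ('o, 'a, 'v) spsh_map) cat" where
  "sSh C J = functor_cat (opposite simplex_cat) (Sh C J)"

definition const_ob :: "('o, 'a) cat \<Rightarrow> ('o \<Rightarrow> 'a set set) \<Rightarrow> ('o, 'a, 'v) psh \<Rightarrow> ('o, 'a, 'v) spsh" where
  "const_ob C J F = \<lparr>on_ob = (\<lambda>_. F), on_ar = (\<lambda>_. ide (Sh C J) F)\<rparr>"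

definition const_ar ::
    "('o, 'a) cat \<Rightarrow> ('o \<Rightarrow> 'a set set) \<Rightarrow> ('o, 'a, 'v) psh_map \<Rightarrow> ('o, 'a, 'v) spsh_map" where
  "const_ar C J f = (const_ob C J (src (Sh C J) f), \<lambda>_. f, const_ob C J (tgt (Sh C J) f))"

text \<open>
  A point of the topos of sheaves is given by a flat functor \<open>u\<close> from \<open>C\<close> to sets that turns
  covering sieves into jointly surjective families; the stalk is the colimit of the sections over
  the (cofiltered) category of elements of \<open>u\<close>. The values of \<open>u\<close> are sets of sets of arrows:
  this is large enough for, e.g., the functor of germs of morphisms at a point of a fixed space.
\<close>

type_synonym ('o, 'a) site_point = "('o, 'a, 'a set set, 'a set set \<times> ('a set \<Rightarrow> 'a set) \<times> 'a set set) fctr"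

definition is_point :: "('o, 'a) cat \<Rightarrow> ('o \<Rightarrow> 'a set set) \<Rightarrow> ('o, 'a) site_point \<Rightarrow> bool" where
  "is_point C J u \<longleftrightarrow> is_functor C set_cat u \<and>
     (\<exists>U\<in>ob C. on_ob u U \<noteq> {}) \<and>
     (\<forall>U\<in>ob C. \<forall>V\<in>ob C. \<forall>x\<in>on_ob u U. \<forall>y\<in>on_ob u V.
        \<exists>W\<in>ob C. \<exists>w\<in>on_ob u W. \<exists>f\<in>Hom C W U. \<exists>g\<in>Hom C W V.
          app (on_ar u f) w = x \<and> app (on_ar u g) w = y) \<and>
     (\<forall>U\<in>ob C. \<forall>V\<in>ob C. \<forall>f\<in>Hom C U V. \<forall>g\<in>Hom C U V. \<forall>x\<in>on_ob u U.
        app (on_ar u f) x = app (on_ar u g) x \<longrightarrow>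
        (\<exists>W\<in>ob C. \<exists>w\<in>on_ob u W. \<exists>h\<in>Hom C W U. app (on_ar u h) w = x \<and> cmp C f h = cmp C g h)) \<and>
     (\<forall>U\<in>ob C. \<forall>S\<in>J U. \<forall>x\<in>on_ob u U. \<exists>f\<in>S. \<exists>y\<in>on_ob u (src C f). app (on_ar u f) y = x)"

definition point_germ ::
    "('o, 'a) cat \<Rightarrow> ('o, 'a) site_point \<Rightarrow> ('o, 'a, 'v) psh \<Rightarrow> 'o \<times> 'a set \<times> 'v \<Rightarrow> ('o \<times> 'a set \<times> 'v) set" where
  "point_germ C u F = (\<lambda>(U, x, s). {(V, y, t). V \<in> ob C \<and> y \<in> on_ob u V \<and> t \<in> on_ob F V \<and>
     (\<exists>W\<in>ob C. \<exists>w\<in>on_ob u W. \<exists>f\<in>Hom C W U. \<exists>g\<in>Hom C W V.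
        app (on_ar u f) w = x \<and> app (on_ar u g) w = y \<and>
        app (on_ar F f) s = app (on_ar F g) t)})"

definition stalk_set ::
    "('o, 'a) cat \<Rightarrow> ('o, 'a) site_point \<Rightarrow> ('o, 'a, 'v) psh \<Rightarrow> ('o \<times> 'a set \<times> 'v) set set" where
  "stalk_set C u F =
     {point_germ C u F (U, x, s) | U x s. U \<in> ob C \<and> x \<in> on_ob u U \<and> s \<in> on_ob F U}"

definition stalk_functor ::
    "('o, 'a) cat \<Rightarrow> ('o, 'a) site_point \<Rightarrow>
     (('o, 'a, 'v) psh, ('o, 'a, 'v) psh_map, ('o \<times> 'a set \<times> 'v) set set,
      ('o \<times> 'a set \<times> 'v) set set \<times> (('o \<times> 'a set \<times> 'v) set \<Rightarrow> ('o \<times> 'a set \<times> 'v) set) \<times>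
        ('o \<times> 'a set \<times> 'v) set set) fctr" where
  "stalk_functor C u =
     \<lparr>on_ob = stalk_set C u,
      on_ar = (\<lambda>(F, \<eta>, G). (stalk_set C u F,
        \<lambda>c\<in>stalk_set C u F. \<Union>(U, x, s)\<in>c. point_germ C u G (U, x, app (\<eta> U) s),
        stalk_set C u G))\<rparr>"

definition levelwise_ob :: "('o, 'a, 'p, 'b) fctr \<Rightarrow> ('o, 'a) simplicial \<Rightarrow> ('p, 'b) simplicial" where
  "levelwise_ob F X = \<lparr>on_ob = (\<lambda>n. on_ob F (on_ob X n)), on_ar = (\<lambda>\<theta>. on_ar F (on_ar X \<theta>))\<rparr>"

definition levelwise_ar :: "('o, 'a, 'p, 'b) fctr \<Rightarrow> ('o, 'a) simplicial_map \<Rightarrow> ('p, 'b) simplicial_map" where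
  "levelwise_ar F = (\<lambda>(X, \<eta>, Y). (levelwise_ob F X, \<lambda>n. on_ar F (\<eta> n), levelwise_ob F Y))"

text \<open>The stalk functors are jointly conservative on the sheaves with sections in \<open>'v\<close>.\<close>

definition enough_points :: "'v itself \<Rightarrow> ('o, 'a) cat \<Rightarrow> ('o \<Rightarrow> 'a set set) \<Rightarrow> bool" where
  "enough_points _ C J \<longleftrightarrow>
     (\<forall>f :: ('o, 'a, 'v) psh_map. f \<in> ar (Sh C J) \<and>
        (\<forall>u. is_point C J u \<longrightarrow> is_iso set_cat (on_ar (stalk_functor C u) f)) \<longrightarrow>
        is_iso (Sh C J) f)"


section \<open>The simplicial homotopy category and hyperbolicity\<close>

definition simplicial_weq :: "('o, 'a) cat \<Rightarrow> ('o \<Rightarrow> 'a set set) \<Rightarrow> ('o, 'a, 'v) spsh_map set" where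
  "simplicial_weq C J = {f \<in> ar (sSh C J).
     \<forall>u. is_point C J u \<longrightarrow> sset_weq (levelwise_ar (stalk_functor C u) f)}"

definition simplicial_fibration :: "('o, 'a) cat \<Rightarrow> ('o \<Rightarrow> 'a set set) \<Rightarrow> ('o, 'a, 'v) spsh_map \<Rightarrow> bool" where
  "simplicial_fibration C J p \<longleftrightarrow> p \<in> ar (sSh C J) \<and>
     (\<forall>i\<in>simplicial_weq C J. monic (sSh C J) i \<longrightarrow> has_lifts (sSh C J) i p)"

definition simplicially_fibrant :: "('o, 'a) cat \<Rightarrow> ('o \<Rightarrow> 'a set set) \<Rightarrow> ('o, 'a, 'v) spsh \<Rightarrow> bool" where
  "simplicially_fibrant C J X \<longleftrightarrow>
     (\<exists>pt. terminal_object (sSh C J) pt \<and> (\<exists>p\<in>Hom (sSh C J) X pt. simplicial_fibration C J p))"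

type_synonym ('o, 'a, 'v) hs_map =
  "('o, 'a, 'v) spsh \<times> ('o, 'a, 'v) spsh_map zig list set \<times> ('o, 'a, 'v) spsh"

definition Hs :: "('o, 'a) cat \<Rightarrow> ('o \<Rightarrow> 'a set set) \<Rightarrow> (('o, 'a, 'v) spsh, ('o, 'a, 'v) hs_map) cat" where
  "Hs C J = localization (sSh C J) (simplicial_weq C J)"

definition to_Hs :: "('o, 'a) cat \<Rightarrow> ('o \<Rightarrow> 'a set set) \<Rightarrow> ('o, 'a, 'v) spsh_map \<Rightarrow> ('o, 'a, 'v) hs_map" where
  "to_Hs C J = loc_ar (sSh C J) (simplicial_weq C J)"

text \<open>
  The object \<open>A\<close> of the site is turned into a sheaf by the Yoneda embedding. As \<open>Hom C U A\<close> need
  not be a set over the type \<open>'v\<close>, the sheaf is only determined up to isomorphism; the same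
  holds for products of simplicial sheaves. If \<open>'v\<close> is infinite and at least as large as the
  type of arrows, then the representing sheaf and all binary products exist.
\<close>

definition represented_by :: "('o, 'a) cat \<Rightarrow> ('o, 'a, 'v) psh \<Rightarrow> 'o \<Rightarrow> bool" where
  "represented_by C F A \<longleftrightarrow>
     (\<exists>\<eta>. (\<forall>U\<in>ob C. bij_betw (\<eta> U) (Hom C U A) (on_ob F U)) \<and>
        (\<forall>f\<in>ar C. \<forall>a\<in>Hom C (tgt C f) A. \<eta> (src C f) (cmp C a f) = app (on_ar F f) (\<eta> (tgt C f) a)))"

definition hyperbolic :: "('o, 'a) cat \<Rightarrow> ('o \<Rightarrow> 'a set set) \<Rightarrow> 'o \<Rightarrow> ('o, 'a, 'v) spsh \<Rightarrow> bool" where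
  "hyperbolic C J A X \<longleftrightarrow> X \<in> ob (sSh C J) \<and>
     (\<forall>Y\<in>ob (sSh C J). \<forall>A1\<in>ob (Sh C J). \<forall>P p q.
        represented_by C A1 A \<and> is_product (sSh C J) Y (const_ob C J A1) P p q \<longrightarrow>
        bij_betw (\<lambda>g. cmp (Hs C J) g (to_Hs C J p)) (Hom (Hs C J) Y X) (Hom (Hs C J) P X))"

definition affine_weq :: "('o, 'a) cat \<Rightarrow> ('o \<Rightarrow> 'a set set) \<Rightarrow> 'o \<Rightarrow> ('o, 'a, 'v) spsh_map \<Rightarrow> bool" where
  "affine_weq C J A f \<longleftrightarrow> f \<in> ar (sSh C J) \<and>
     (\<forall>Z. hyperbolic C J A Z \<longrightarrow>
        bij_betw (\<lambda>g. cmp (Hs C J) g (to_Hs C J f))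
          (Hom (Hs C J) (tgt (sSh C J) f) Z) (Hom (Hs C J) (src (sSh C J) f) Z))"

definition hyperbolic_resolution ::
    "('o, 'a) cat \<Rightarrow> ('o \<Rightarrow> 'a set set) \<Rightarrow> 'o \<Rightarrow>
     (('o, 'a, 'v) spsh, ('o, 'a, 'v) spsh_map, ('o, 'a, 'v) spsh, ('o, 'a, 'v) spsh_map) fctr \<Rightarrow>
     (('o, 'a, 'v) spsh \<Rightarrow> ('o, 'a, 'v) spsh_map) \<Rightarrow> bool" where
  "hyperbolic_resolution C J A Ip r \<longleftrightarrow>
     is_functor (sSh C J) (sSh C J) Ip \<and>
     (id_functor, r, Ip) \<in> ar (functor_cat (sSh C J) (sSh C J)) \<and>
     (\<forall>X\<in>ob (sSh C J).
        hyperbolic C J A (on_ob Ip X) \<and> simplicially_fibrant C J (on_ob Ip X) \<and>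
        monic (sSh C J) (r X) \<and> affine_weq C J A (r X))"


section \<open>Locally ringed spaces\<close>

record ('x, 'r) rspace =
  top_of :: "'x topology"
  sect :: "'x set \<Rightarrow> 'r ring"
  rst :: "'x set \<Rightarrow> 'x set \<Rightarrow> 'r \<Rightarrow> 'r"

text \<open>\<open>rst X U V\<close> is the restriction from \<open>U\<close> to \<open>V\<close>.\<close>

definition ringed_space :: "('x, 'r) rspace \<Rightarrow> bool" where
  "ringed_space X \<longleftrightarrow>
     (\<forall>U. openin (top_of X) U \<longrightarrow> cring (sect X U) \<and> (\<forall>s\<in>carrier (sect X U). rst X U U s = s)) \<and>
     (\<forall>U V. openin (top_of X) U \<and> openin (top_of X) V \<and> V \<subseteq> U \<longrightarrow>
        rst X U V \<in> ring_hom (sect X U) (sect X V)) \<and>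
     (\<forall>U V W. openin (top_of X) U \<and> openin (top_of X) V \<and> openin (top_of X) W \<and> W \<subseteq> V \<and> V \<subseteq> U \<longrightarrow>
        (\<forall>s\<in>carrier (sect X U). rst X V W (rst X U V s) = rst X U W s)) \<and>
     (\<forall>\<U> s. (\<forall>U\<in>\<U>. openin (top_of X) U \<and> s U \<in> carrier (sect X U)) \<and>
        (\<forall>U\<in>\<U>. \<forall>V\<in>\<U>. rst X U (U \<inter> V) (s U) = rst X V (U \<inter> V) (s V)) \<longrightarrow>
        (\<exists>!t. t \<in> carrier (sect X (\<Union>\<U>)) \<and> (\<forall>U\<in>\<U>. rst X (\<Union>\<U>) U t = s U)))"

definition germ :: "('x, 'r) rspace \<Rightarrow> 'x \<Rightarrow> 'x set \<Rightarrow> 'r \<Rightarrow> ('x set \<times> 'r) set" where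
  "germ X x U s = {(V, t). openin (top_of X) V \<and> x \<in> V \<and> t \<in> carrier (sect X V) \<and>
     (\<exists>W. openin (top_of X) W \<and> x \<in> W \<and> W \<subseteq> U \<inter> V \<and> rst X U W s = rst X V W t)}"

definition stalk :: "('x, 'r) rspace \<Rightarrow> 'x \<Rightarrow> ('x set \<times> 'r) set ring" where
  "stalk X x =
     \<lparr>carrier = {germ X x U s | U s. openin (top_of X) U \<and> x \<in> U \<and> s \<in> carrier (sect X U)},
      mult = (\<lambda>a b. \<Union>(U, s)\<in>a. \<Union>(V, t)\<in>b.
        germ X x (U \<inter> V) (rst X U (U \<inter> V) s \<otimes>\<^bsub>sect X (U \<inter> V)\<^esub> rst X V (U \<inter> V) t)),
      one = germ X x (topspace (top_of X)) \<one>\<^bsub>sect X (topspace (top_of X))\<^esub>,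
      ring.zero = germ X x (topspace (top_of X)) \<zero>\<^bsub>sect X (topspace (top_of X))\<^esub>,
      add = (\<lambda>a b. \<Union>(U, s)\<in>a. \<Union>(V, t)\<in>b.
        germ X x (U \<inter> V) (rst X U (U \<inter> V) s \<oplus>\<^bsub>sect X (U \<inter> V)\<^esub> rst X V (U \<inter> V) t))\<rparr>"

definition local_ring :: "'r ring \<Rightarrow> bool" where
  "local_ring R \<longleftrightarrow> cring R \<and> (\<exists>!I. maximalideal I R)"

definition lrs :: "('x, 'r) rspace \<Rightarrow> bool" where
  "lrs X \<longleftrightarrow> ringed_space X \<and> (\<forall>x\<in>topspace (top_of X). local_ring (stalk X x))"

text \<open>
  A morphism from \<open>X\<close> to \<open>Y\<close> is a pair of a map \<open>f\<close> of points and a family \<open>h\<close> of ring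
  homomorphisms from the sections over \<open>V\<close> to the sections over the preimage of \<open>V\<close>. Both are
  extensional, so that equal morphisms are equal as pairs.
\<close>

type_synonym ('x, 'r, 'y, 's) rmap = "('x \<Rightarrow> 'y) \<times> ('y set \<Rightarrow> 's \<Rightarrow> 'r)"

definition preim :: "('x, 'r) rspace \<Rightarrow> ('x \<Rightarrow> 'y) \<Rightarrow> 'y set \<Rightarrow> 'x set" where
  "preim X f V = {x \<in> topspace (top_of X). f x \<in> V}"

definition stalk_map ::
    "('x, 'r) rspace \<Rightarrow> ('x, 'r, 'y, 's) rmap \<Rightarrow> 'x \<Rightarrow> ('y set \<times> 's) set \<Rightarrow> ('x set \<times> 'r) set" where
  "stalk_map X = (\<lambda>(f, h) x c. \<Union>(V, s)\<in>c. germ X x (preim X f V) (h V s))"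

definition lrs_map :: "('x, 'r) rspace \<Rightarrow> ('y, 's) rspace \<Rightarrow> ('x, 'r, 'y, 's) rmap \<Rightarrow> bool" where
  "lrs_map X Y = (\<lambda>(f, h). lrs X \<and> lrs Y \<and>
     f \<in> extensional (topspace (top_of X)) \<and> continuous_map (top_of X) (top_of Y) f \<and>
     (\<forall>V. if openin (top_of Y) V
        then h V \<in> extensional (carrier (sect Y V)) \<and> h V \<in> ring_hom (sect Y V) (sect X (preim X f V))
        else h V = undefined) \<and>
     (\<forall>V W. openin (top_of Y) V \<and> openin (top_of Y) W \<and> W \<subseteq> V \<longrightarrow>
        (\<forall>s\<in>carrier (sect Y V). h W (rst Y V W s) = rst X (preim X f V) (preim X f W) (h V s))) \<and>
     (\<forall>x\<in>topspace (top_of X). \<forall>c\<in>carrier (stalk Y (f x)).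
        stalk_map X (f, h) x c \<in> Units (stalk X x) \<longrightarrow> c \<in> Units (stalk Y (f x))))"

definition rmap_id :: "('x, 'r) rspace \<Rightarrow> ('x, 'r, 'x, 'r) rmap" where
  "rmap_id X = (\<lambda>x\<in>topspace (top_of X). x,
     \<lambda>V. if openin (top_of X) V then \<lambda>s\<in>carrier (sect X V). s else undefined)"

definition rmap_comp ::
    "('x, 'r) rspace \<Rightarrow> ('y, 's) rspace \<Rightarrow> ('z, 't) rspace \<Rightarrow>
     ('y, 's, 'z, 't) rmap \<Rightarrow> ('x, 'r, 'y, 's) rmap \<Rightarrow> ('x, 'r, 'z, 't) rmap" where
  "rmap_comp X Y Z = (\<lambda>(g, k) (f, h).
     (\<lambda>x\<in>topspace (top_of X). g (f x),
      \<lambda>W. if openin (top_of Z) W then \<lambda>s\<in>carrier (sect Z W). h (preim Y g W) (k W s) else undefined))"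

definition lrs_inverse ::
    "('x, 'r) rspace \<Rightarrow> ('y, 's) rspace \<Rightarrow> ('x, 'r, 'y, 's) rmap \<Rightarrow> ('y, 's, 'x, 'r) rmap \<Rightarrow> bool" where
  "lrs_inverse X Y \<phi> \<psi> \<longleftrightarrow> lrs_map X Y \<phi> \<and> lrs_map Y X \<psi> \<and>
     rmap_comp X Y X \<psi> \<phi> = rmap_id X \<and> rmap_comp Y X Y \<phi> \<psi> = rmap_id Y"

definition open_sub :: "('x, 'r) rspace \<Rightarrow> 'x set \<Rightarrow> ('x, 'r) rspace" where
  "open_sub X U = X\<lparr>top_of := subtopology (top_of X) U\<rparr>"

definition open_incl :: "('x, 'r) rspace \<Rightarrow> 'x set \<Rightarrow> ('x, 'r, 'x, 'r) rmap" where
  "open_incl X U = (\<lambda>x\<in>U. x,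
     \<lambda>V. if openin (top_of X) V then \<lambda>s\<in>carrier (sect X V). rst X V (V \<inter> U) s else undefined)"

text \<open>
  Complex spaces are spaces of complex algebras, and schemes come with a morphism to the base.
  The complex algebra structure is determined by its value on global sections.
\<close>

datatype ('x, 'r, 'y, 's) struc =
    CAlg "complex \<Rightarrow> 'r"
  | Over "('y, 's) rspace" "('x, 'r, 'y, 's) rmap"

type_synonym ('x, 'r, 'y, 's) space = "('x, 'r) rspace \<times> ('x, 'r, 'y, 's) struc"
type_synonym ('x, 'r, 'y, 's) space_map =
  "('x, 'r, 'y, 's) space \<times> ('x, 'r, 'x, 'r) rmap \<times> ('x, 'r, 'y, 's) space"

definition calg_compatible ::
    "('y, 's) rspace \<Rightarrow> (complex \<Rightarrow> 'r) \<Rightarrow> (complex \<Rightarrow> 's) \<Rightarrow> ('x, 'r, 'y, 's) rmap \<Rightarrow> bool" where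
  "calg_compatible Y c d \<phi> \<longleftrightarrow> (\<forall>z. snd \<phi> (topspace (top_of Y)) (d z) = c z)"

definition struc_compatible ::
    "('x, 'r, 'y, 's) space \<Rightarrow> ('x, 'r, 'y, 's) space \<Rightarrow> ('x, 'r, 'x, 'r) rmap \<Rightarrow> bool" where
  "struc_compatible X Y \<phi> \<longleftrightarrow>
     (case (snd X, snd Y) of
        (CAlg c, CAlg d) \<Rightarrow> calg_compatible (fst Y) c d \<phi>
      | (Over B \<alpha>, Over B' \<beta>) \<Rightarrow> B = B' \<and> rmap_comp (fst X) (fst Y) B \<beta> \<phi> = \<alpha>
      | _ \<Rightarrow> False)"

definition space_cat ::
    "(('x, 'r, 'y, 's) space \<Rightarrow> bool) \<Rightarrow> (('x, 'r, 'y, 's) space, ('x, 'r, 'y, 's) space_map) cat" where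
  "space_cat P =
     \<lparr>ob = {X. P X},
      ar = {(X, \<phi>, Y). P X \<and> P Y \<and> lrs_map (fst X) (fst Y) \<phi> \<and> struc_compatible X Y \<phi>},
      src = (\<lambda>(X, \<phi>, Y). X),
      tgt = (\<lambda>(X, \<phi>, Y). Y),
      ide = (\<lambda>X. (X, rmap_id (fst X), X)),
      cmp = (\<lambda>(Y', \<psi>, Z) (X, \<phi>, Y). (X, rmap_comp (fst X) (fst Y) (fst Z) \<psi> \<phi>, Z))\<rparr>"


section \<open>Complex spaces\<close>

definition complex_ring :: "complex ring" where
  "complex_ring = \<lparr>carrier = UNIV, mult = (*), one = 1, ring.zero = 0, add = (+)\<rparr>"

definition Cn :: "nat \<Rightarrow> (nat \<Rightarrow> complex) topology" where
  "Cn n = product_topology (\<lambda>_. euclidean) {..<n}"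

text \<open>
  Points of complex \<open>n\<close>-space are extensional functions on \<open>{..<n}\<close>; holomorphic means continuous
  and holomorphic in each variable.
\<close>

definition holo :: "nat \<Rightarrow> (nat \<Rightarrow> complex) set \<Rightarrow> ((nat \<Rightarrow> complex) \<Rightarrow> complex) \<Rightarrow> bool" where
  "holo n U f \<longleftrightarrow> openin (Cn n) U \<and> continuous_map (subtopology (Cn n) U) euclidean f \<and>
     (\<forall>z\<in>U. \<forall>i<n. (\<lambda>w. f (z(i := w))) field_differentiable (at (z i)))"

text \<open>
  \<open>holo_germ n F z U g\<close> is the class of the function \<open>g\<close> on \<open>U\<close> in the stalk at \<open>z\<close> of the sheaf
  of holomorphic functions modulo the ideal sheaf generated by \<open>F\<close>.
\<close>

definition holo_germ ::
    "nat \<Rightarrow> ((nat \<Rightarrow> complex) \<Rightarrow> complex) set \<Rightarrow> (nat \<Rightarrow> complex) \<Rightarrow> (nat \<Rightarrow> complex) set \<Rightarrow>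
     ((nat \<Rightarrow> complex) \<Rightarrow> complex) \<Rightarrow> ((nat \<Rightarrow> complex) set \<times> ((nat \<Rightarrow> complex) \<Rightarrow> complex)) set" where
  "holo_germ n F z U g = {(V, h). z \<in> V \<and> holo n V h \<and>
     (\<exists>W c. openin (Cn n) W \<and> z \<in> W \<and> W \<subseteq> U \<inter> V \<and> (\<forall>f\<in>F. holo n W (c f)) \<and>
        (\<forall>y\<in>W. h y - g y = (\<Sum>f\<in>F. c f y * f y)))}"

type_synonym holo_class = "((nat \<Rightarrow> complex) set \<times> ((nat \<Rightarrow> complex) \<Rightarrow> complex)) set"

definition holo_op ::
    "nat \<Rightarrow> ((nat \<Rightarrow> complex) \<Rightarrow> complex) set \<Rightarrow> (complex \<Rightarrow> complex \<Rightarrow> complex) \<Rightarrow> (nat \<Rightarrow> complex) \<Rightarrow>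
     holo_class \<Rightarrow> holo_class \<Rightarrow> holo_class" where
  "holo_op n F oper z a b =
     (\<Union>(U, g)\<in>a. \<Union>(V, h)\<in>b. holo_germ n F z (U \<inter> V) (\<lambda>w. oper (g w) (h w)))"

definition holo_const ::
    "nat \<Rightarrow> ((nat \<Rightarrow> complex) \<Rightarrow> complex) set \<Rightarrow> (nat \<Rightarrow> complex) set \<Rightarrow> complex \<Rightarrow> (nat \<Rightarrow> complex) \<Rightarrow> holo_class" where
  "holo_const n F W c = (\<lambda>z\<in>W. holo_germ n F z (topspace (Cn n)) (\<lambda>_. c))"

definition zero_locus ::
    "(nat \<Rightarrow> complex) set \<Rightarrow> ((nat \<Rightarrow> complex) \<Rightarrow> complex) set \<Rightarrow> (nat \<Rightarrow> complex) set" where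
  "zero_locus D F = {z \<in> D. \<forall>f\<in>F. f z = 0}"

text \<open>
  The closed subspace of the open set \<open>D\<close> in complex \<open>n\<close>-space that is defined by the ideal
  generated by \<open>F\<close>; sections are functions into the stalks.
\<close>

definition local_model ::
    "nat \<Rightarrow> (nat \<Rightarrow> complex) set \<Rightarrow> ((nat \<Rightarrow> complex) \<Rightarrow> complex) set \<Rightarrow>
     (nat \<Rightarrow> complex, (nat \<Rightarrow> complex) \<Rightarrow> holo_class) rspace" where
  "local_model n D F =
     \<lparr>top_of = subtopology (Cn n) (zero_locus D F),
      sect = (\<lambda>W.
        \<lparr>carrier = {s \<in> extensional W. \<forall>z\<in>W. \<exists>U g. holo n U g \<and> z \<in> U \<and>
            (\<forall>y\<in>U \<inter> W. s y = holo_germ n F y U g)},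
         mult = (\<lambda>s t. \<lambda>z\<in>W. holo_op n F (*) z (s z) (t z)),
         one = holo_const n F W 1,
         ring.zero = holo_const n F W 0,
         add = (\<lambda>s t. \<lambda>z\<in>W. holo_op n F (+) z (s z) (t z))\<rparr>),
      rst = (\<lambda>V W s. restrict s W)\<rparr>"

definition calg_iso ::
    "('x, 'r) rspace \<Rightarrow> (complex \<Rightarrow> 'r) \<Rightarrow> ('y, 's) rspace \<Rightarrow> (complex \<Rightarrow> 's) \<Rightarrow> bool" where
  "calg_iso X c Y d \<longleftrightarrow> (\<exists>\<phi> \<psi>. lrs_inverse X Y \<phi> \<psi> \<and> calg_compatible Y c d \<phi>)"

definition complex_space :: "('x, 'r, 'y, 's) space \<Rightarrow> bool" where
  "complex_space X \<longleftrightarrow> (\<exists>Z c. X = (Z, CAlg c) \<and> lrs Z \<and> Hausdorff_space (top_of Z) \<and>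
     c \<in> ring_hom complex_ring (sect Z (topspace (top_of Z))) \<and>
     (\<forall>x\<in>topspace (top_of Z). \<exists>U n D F. openin (top_of Z) U \<and> x \<in> U \<and>
        openin (Cn n) D \<and> finite F \<and> (\<forall>f\<in>F. holo n D f) \<and>
        calg_iso (open_sub Z U) (\<lambda>z. rst Z (topspace (top_of Z)) U (c z))
          (local_model n D F) (holo_const n F (zero_locus D F))))"

definition complex_line :: "('x, 'r, 'y, 's) space \<Rightarrow> bool" where
  "complex_line X \<longleftrightarrow> complex_space X \<and>
     (\<exists>Z c. X = (Z, CAlg c) \<and>
        calg_iso Z c (local_model 1 (topspace (Cn 1)) {}) (holo_const 1 {} (topspace (Cn 1))))"

definition open_sub_space :: "('x, 'r, 'y, 's) space \<Rightarrow> 'x set \<Rightarrow> ('x, 'r, 'y, 's) space" where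
  "open_sub_space X U = (open_sub (fst X) U,
     case snd X of
       CAlg c \<Rightarrow> CAlg (\<lambda>z. rst (fst X) (topspace (top_of (fst X))) U (c z))
     | Over B \<alpha> \<Rightarrow> Over B (rmap_comp (open_sub (fst X) U) (fst X) B \<alpha> (open_incl (fst X) U)))"

definition strong_topology ::
    "(('x, 'r, 'y, 's) space, ('x, 'r, 'y, 's) space_map) cat \<Rightarrow>
     ('x, 'r, 'y, 's) space \<Rightarrow> ('x, 'r, 'y, 's) space_map set set" where
  "strong_topology C X = {S. sieve C X S \<and>
     (\<forall>x\<in>topspace (top_of (fst X)). \<exists>U. openin (top_of (fst X)) U \<and> x \<in> U \<and>
        (open_sub_space X U, open_incl (fst X) U, X) \<in> S)}"

definition complex_site ::
    "(('x, 'r, 'y, 's) space, ('x, 'r, 'y, 's) space_map) cat \<Rightarrow>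
     (('x, 'r, 'y, 's) space \<Rightarrow> ('x, 'r, 'y, 's) space_map set set) \<Rightarrow> ('x, 'r, 'y, 's) space \<Rightarrow> bool" where
  "complex_site C J A \<longleftrightarrow> C = space_cat complex_space \<and> J = strong_topology C \<and> complex_line A"


section \<open>Schemes of finite type over a base\<close>

definition frac :: "'r ring \<Rightarrow> 'r set \<Rightarrow> 'r \<Rightarrow> 'r \<Rightarrow> ('r \<times> 'r) set" where
  "frac R P a b = {(c, d). c \<in> carrier R \<and> d \<in> carrier R - P \<and>
     (\<exists>t\<in>carrier R - P. t \<otimes>\<^bsub>R\<^esub> (a \<otimes>\<^bsub>R\<^esub> d) = t \<otimes>\<^bsub>R\<^esub> (c \<otimes>\<^bsub>R\<^esub> b))}"

definition localize_at :: "'r ring \<Rightarrow> 'r set \<Rightarrow> ('r \<times> 'r) set ring" where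
  "localize_at R P =
     \<lparr>carrier = {frac R P a b | a b. a \<in> carrier R \<and> b \<in> carrier R - P},
      mult = (\<lambda>p q. \<Union>(a, b)\<in>p. \<Union>(c, d)\<in>q. frac R P (a \<otimes>\<^bsub>R\<^esub> c) (b \<otimes>\<^bsub>R\<^esub> d)),
      one = frac R P \<one>\<^bsub>R\<^esub> \<one>\<^bsub>R\<^esub>,
      ring.zero = frac R P \<zero>\<^bsub>R\<^esub> \<one>\<^bsub>R\<^esub>,
      add = (\<lambda>p q. \<Union>(a, b)\<in>p. \<Union>(c, d)\<in>q.
        frac R P (a \<otimes>\<^bsub>R\<^esub> d \<oplus>\<^bsub>R\<^esub> c \<otimes>\<^bsub>R\<^esub> b) (b \<otimes>\<^bsub>R\<^esub> d))\<rparr>"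

definition Spec_top :: "'r ring \<Rightarrow> 'r set topology" where
  "Spec_top R = topology (\<lambda>U. \<exists>E\<subseteq>carrier R. U = {P. primeideal P R \<and> \<not> E \<subseteq> P})"

definition Spec :: "'r ring \<Rightarrow> ('r set, 'r set \<Rightarrow> ('r \<times> 'r) set) rspace" where
  "Spec R =
     \<lparr>top_of = Spec_top R,
      sect = (\<lambda>U.
        \<lparr>carrier = {s \<in> (\<Pi>\<^sub>E P\<in>U. carrier (localize_at R P)).
            \<forall>P\<in>U. \<exists>V. openin (Spec_top R) V \<and> P \<in> V \<and> V \<subseteq> U \<and>
              (\<exists>a\<in>carrier R. \<exists>b\<in>carrier R. \<forall>Q\<in>V. b \<notin> Q \<and> s Q = frac R Q a b)},
         mult = (\<lambda>s t. \<lambda>P\<in>U. s P \<otimes>\<^bsub>localize_at R P\<^esub> t P),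
         one = (\<lambda>P\<in>U. \<one>\<^bsub>localize_at R P\<^esub>),
         ring.zero = (\<lambda>P\<in>U. \<zero>\<^bsub>localize_at R P\<^esub>),
         add = (\<lambda>s t. \<lambda>P\<in>U. s P \<oplus>\<^bsub>localize_at R P\<^esub> t P)\<rparr>),
      rst = (\<lambda>U V s. restrict s V)\<rparr>"

text \<open>
  As an affine scheme is the spectrum of its ring of global sections, it suffices to consider
  rings over the type of the sections.
\<close>

definition open_spec :: "('x, 'r) rspace \<Rightarrow> 'x set \<Rightarrow> 'r ring \<Rightarrow> bool" where
  "open_spec X U R \<longleftrightarrow> openin (top_of X) U \<and> cring R \<and>
     (\<exists>\<phi> \<psi>. lrs_inverse (open_sub X U) (Spec R) \<phi> \<psi>)"

definition affine_open :: "('x, 'r) rspace \<Rightarrow> 'x set \<Rightarrow> bool" where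
  "affine_open X U \<longleftrightarrow> (\<exists>R. open_spec X U R)"

definition is_scheme :: "('x, 'r) rspace \<Rightarrow> bool" where
  "is_scheme X \<longleftrightarrow> lrs X \<and> (\<forall>x\<in>topspace (top_of X). \<exists>U. x \<in> U \<and> affine_open X U)"

definition noetherian_scheme :: "('x, 'r) rspace \<Rightarrow> bool" where
  "noetherian_scheme X \<longleftrightarrow> is_scheme X \<and> compact_space (top_of X) \<and>
     (\<forall>x\<in>topspace (top_of X). \<exists>U R. x \<in> U \<and> open_spec X U R \<and> noetherian_ring R)"

definition irreducible_closed :: "'x topology \<Rightarrow> 'x set \<Rightarrow> bool" where
  "irreducible_closed T Z \<longleftrightarrow> closedin T Z \<and> Z \<noteq> {} \<and>
     (\<forall>A B. closedin T A \<and> closedin T B \<and> Z = A \<union> B \<longrightarrow> Z = A \<or> Z = B)"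

definition finite_dimensional :: "'x topology \<Rightarrow> bool" where
  "finite_dimensional T \<longleftrightarrow>
     (\<exists>n. \<nexists>Z :: nat \<Rightarrow> 'x set. (\<forall>i\<le>n. irreducible_closed T (Z i)) \<and> (\<forall>i<n. Z i \<subset> Z (Suc i)))"

definition fin_gen_algebra :: "'r ring \<Rightarrow> 's ring \<Rightarrow> ('r \<Rightarrow> 's) \<Rightarrow> bool" where
  "fin_gen_algebra R S h \<longleftrightarrow>
     (\<exists>E\<subseteq>carrier S. finite E \<and> carrier S = generate_ring S (h ` carrier R \<union> E))"

definition finite_type :: "('x, 'r) rspace \<Rightarrow> ('y, 's) rspace \<Rightarrow> ('x, 'r, 'y, 's) rmap \<Rightarrow> bool" where
  "finite_type X B = (\<lambda>(f, h). \<forall>b\<in>topspace (top_of B). \<exists>V. b \<in> V \<and> affine_open B V \<and>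
     (\<exists>\<U>. finite \<U> \<and> \<Union>\<U> = preim X f V \<and>
        (\<forall>U\<in>\<U>. affine_open X U \<and>
           fin_gen_algebra (sect B V) (sect X U) (\<lambda>s. rst X (preim X f V) U (h V s)))))"

definition ft_scheme :: "('y, 's) rspace \<Rightarrow> ('x, 'r, 'y, 's) space \<Rightarrow> bool" where
  "ft_scheme B X \<longleftrightarrow>
     (\<exists>Z \<pi>. X = (Z, Over B \<pi>) \<and> is_scheme Z \<and> lrs_map Z B \<pi> \<and> finite_type Z B \<pi>)"

text \<open>
  Flatness of \<open>S\<close> as an \<open>R\<close>-module, by the equational criterion: every linear relation in \<open>S\<close>
  comes from relations in \<open>R\<close>.
\<close>

definition flat_hom :: "'r ring \<Rightarrow> 's ring \<Rightarrow> ('r \<Rightarrow> 's) \<Rightarrow> bool" where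
  "flat_hom R S h \<longleftrightarrow> h \<in> ring_hom R S \<and>
     (\<forall>(n::nat) a s. (\<forall>i<n. a i \<in> carrier R \<and> s i \<in> carrier S) \<and>
        (\<Oplus>\<^bsub>S\<^esub>i\<in>{..<n}. h (a i) \<otimes>\<^bsub>S\<^esub> s i) = \<zero>\<^bsub>S\<^esub> \<longrightarrow>
        (\<exists>(m::nat) b t. (\<forall>i<n. \<forall>j<m. b i j \<in> carrier R) \<and> (\<forall>j<m. t j \<in> carrier S) \<and>
           (\<forall>i<n. s i = (\<Oplus>\<^bsub>S\<^esub>j\<in>{..<m}. h (b i j) \<otimes>\<^bsub>S\<^esub> t j)) \<and>
           (\<forall>j<m. (\<Oplus>\<^bsub>R\<^esub>i\<in>{..<n}. a i \<otimes>\<^bsub>R\<^esub> b i j) = \<zero>\<^bsub>R\<^esub>)))"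

definition flat_map :: "('x, 'r) rspace \<Rightarrow> ('y, 's) rspace \<Rightarrow> ('x, 'r, 'y, 's) rmap \<Rightarrow> bool" where
  "flat_map X Y \<phi> \<longleftrightarrow> lrs_map X Y \<phi> \<and>
     (\<forall>x\<in>topspace (top_of X). flat_hom (stalk Y (fst \<phi> x)) (stalk X x) (stalk_map X \<phi> x))"

text \<open>
  Only used for noetherian schemes, where all morphisms are quasi-compact and where a jointly
  surjective family of flat morphisms of finite type has a finite jointly surjective subfamily,
  as these morphisms are open.
\<close>

definition qc_flat_topology ::
    "(('x, 'r, 'y, 's) space, ('x, 'r, 'y, 's) space_map) cat \<Rightarrow>
     ('x, 'r, 'y, 's) space \<Rightarrow> ('x, 'r, 'y, 's) space_map set set" where
  "qc_flat_topology C X = {S. sieve C X S \<and>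
     (\<exists>E\<subseteq>S. finite E \<and> (\<forall>(U, \<phi>, V)\<in>E. flat_map (fst U) (fst V) \<phi>) \<and>
        topspace (top_of (fst X)) \<subseteq> (\<Union>(U, \<phi>, V)\<in>E. fst \<phi> ` topspace (top_of (fst U))))}"

text \<open>
  The relative spectrum of the polynomial algebra over the structure sheaf of \<open>B\<close>, which is
  determined up to isomorphism.
\<close>

definition affine_line :: "('y, 's) rspace \<Rightarrow> ('x, 'r, 'y, 's) space \<Rightarrow> bool" where
  "affine_line B A \<longleftrightarrow> ft_scheme B A \<and>
     (\<exists>L p h t. A = (L, Over B (p, h)) \<and> t \<in> carrier (sect L (topspace (top_of L))) \<and>
        (\<forall>V. affine_open B V \<longrightarrow> affine_open L (preim L p V) \<and>
           bij_betw (eval (sect B V) (sect L (preim L p V)) (h V)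
               (rst L (topspace (top_of L)) (preim L p V) t))
             (carrier (UP (sect B V))) (carrier (sect L (preim L p V)))))"

definition algebraic_site ::
    "('y, 's) rspace \<Rightarrow> (('x, 'r, 'y, 's) space, ('x, 'r, 'y, 's) space_map) cat \<Rightarrow>
     (('x, 'r, 'y, 's) space \<Rightarrow> ('x, 'r, 'y, 's) space_map set set) \<Rightarrow> ('x, 'r, 'y, 's) space \<Rightarrow> bool" where
  "algebraic_site B C J A \<longleftrightarrow> noetherian_scheme B \<and> finite_dimensional (top_of B) \<and>
     C = space_cat (ft_scheme B) \<and> grothendieck_topology C J \<and>
     (\<forall>X\<in>ob C. J X \<subseteq> qc_flat_topology C X) \<and> affine_line B A"

end

theory Submission
  imports Defs
begin

text \<open>
  As \<open>Y\<close> is hyperbolic, composition with the affine weak equivalence \<open>r\<close> is a bijection on morphisms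
  to \<open>Y\<close> in the homotopy category, which gives \<open>f'\<close>. It remains to see that sheaf maps that become
  equal in the homotopy category are equal. The clopen subsets of the realization of a stalk depend
  functorially on the simplicial sheaf, and simplicial weak equivalences induce bijections on them,
  so they are defined on the homotopy category; for a constant simplicial sheaf they are all sets of
  germs. Hence the two sheaf maps agree on all stalks, and there are enough points: by assumption in
  the algebraic case, and by the germs at the points of complex spaces in the complex case.
\<close>

section \<open>Categories and functors\<close>

text \<open>A zigzag passes through simplicial sheaves whose stalks are far from constant. So an
  invariant is needed that makes sense for all of them, is inverted by homotopy equivalences, and
  still sees every element of a constant stalk. Clopen subsets pull back along continuous maps, so
  the invariant is a contravariant functor to sets, and its homotopy invariance rests on nothing but
  the connectedness of the unit interval. Points are used in two ways. Conservativity of the stalk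
  functors speaks of isomorphisms, not of equality of maps, so for the algebraic site equality has
  to be coded as an isomorphism. For complex spaces equality of sections is tested directly on
  neighbourhoods; the work there is to make open subspaces objects of the site and restrictions of
  maps arrows of it, with equations between objects holding literally, since arrows carry their
  source and target. That sheaves, simplicial sheaves and the simplex category form categories is
  read off from the hypotheses, as \<open>is_functor\<close> includes it.\<close>

lemma opposite_simps [simp]:
  "ob (opposite C) = ob C" "ar (opposite C) = ar C" "src (opposite C) = tgt C"
  "tgt (opposite C) = src C" "ide (opposite C) = ide C" "cmp (opposite C) g f = cmp C f g"
  by (simp_all add: opposite_def)

lemma opposite_opposite [simp]: "opposite (opposite C) = C"
  by (simp add: opposite_def)

lemma Hom_opposite [simp]: "Hom (opposite C) X Y = Hom C Y X"
  by (auto simp: Hom_def)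

lemma HomI: "f \<in> ar C \<Longrightarrow> src C f = X \<Longrightarrow> tgt C f = Y \<Longrightarrow> f \<in> Hom C X Y"
  by (simp add: Hom_def)

lemma HomD:
  assumes "f \<in> Hom C X Y"
  shows "f \<in> ar C" "src C f = X" "tgt C f = Y"
  using assms by (auto simp: Hom_def)

lemma category_src: "category C \<Longrightarrow> f \<in> ar C \<Longrightarrow> src C f \<in> ob C"
  and category_tgt: "category C \<Longrightarrow> f \<in> ar C \<Longrightarrow> tgt C f \<in> ob C"
  and category_ide: "category C \<Longrightarrow> X \<in> ob C \<Longrightarrow> ide C X \<in> Hom C X X"
  by (simp_all add: category_def)

lemma category_cmp: "category C \<Longrightarrow> f \<in> Hom C X Y \<Longrightarrow> g \<in> Hom C Y Z \<Longrightarrow> cmp C g f \<in> Hom C X Z"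
  by (auto simp: category_def Hom_def)

lemma category_cmp_ide:
  assumes "category C" "f \<in> Hom C X Y"
  shows "cmp C f (ide C X) = f" "cmp C (ide C Y) f = f"
  using assms by (auto simp: category_def Hom_def)

lemma category_assoc:
  assumes "category C" "f \<in> Hom C X Y" "g \<in> Hom C Y Z" "h \<in> Hom C Z W"
  shows "cmp C h (cmp C g f) = cmp C (cmp C h g) f"
proof -
  have "\<forall>f\<in>ar C. \<forall>g\<in>ar C. \<forall>h\<in>ar C. src C g = tgt C f \<and> src C h = tgt C g \<longrightarrow>
        cmp C h (cmp C g f) = cmp C (cmp C h g) f"
    using assms(1) unfolding category_def by (elim conjE)
  with assms(2-) show ?thesis by (simp add: Hom_def)
qed

lemma category_opposite: "category C \<Longrightarrow> category (opposite C)"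
  by (simp add: category_def)

lemma Hom_set_cat: "(A, f, B) \<in> Hom set_cat X Y \<longleftrightarrow> A = X \<and> B = Y \<and> f \<in> X \<rightarrow>\<^sub>E Y"
  by (auto simp: Hom_def set_cat_def)

lemma set_cat_eqI:
  assumes "g \<in> Hom set_cat X Y" "h \<in> Hom set_cat X Y" "\<And>x. x \<in> X \<Longrightarrow> app g x = app h x"
  shows "g = h"
proof -
  obtain g' where g: "g = (X, g', Y)" "g' \<in> X \<rightarrow>\<^sub>E Y"
    using assms(1) by (cases g) (auto simp: Hom_set_cat)
  obtain h' where h: "h = (X, h', Y)" "h' \<in> X \<rightarrow>\<^sub>E Y"
    using assms(2) by (cases h) (auto simp: Hom_set_cat)
  have "g' = h'"
    using assms(3) by (intro PiE_ext[OF g(2) h(2)]) (simp add: g h app_def)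
  then show ?thesis by (simp add: g h)
qed

lemma app_in: "g \<in> Hom set_cat X Y \<Longrightarrow> x \<in> X \<Longrightarrow> app g x \<in> Y"
  by (cases g) (auto simp: Hom_set_cat app_def)

lemma app_cmp:
  assumes "f \<in> Hom set_cat X Y" "x \<in> X"
  shows "app (cmp set_cat g f) x = app g (app f x)"
  using assms by (cases f, cases g) (auto simp: Hom_set_cat app_def compose_def set_cat_def[THEN arg_cong[of _ _ cmp]])

lemma app_ide: "x \<in> X \<Longrightarrow> app (ide set_cat X) x = x"
  by (simp add: app_def set_cat_def)

lemma category_set_cat: "category set_cat"
proof -
  have cmp: "cmp set_cat g f \<in> Hom set_cat X Z"
    if "f \<in> Hom set_cat X Y" "g \<in> Hom set_cat Y Z"
    for f g :: "'a set \<times> ('a \<Rightarrow> 'a) \<times> 'a set" and X Y Z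
    using that by (cases f, cases g) (auto simp: Hom_set_cat set_cat_def[of] compose_def Hom_def)
  have ide: "ide set_cat X \<in> Hom set_cat X X" for X :: "'a set"
    by (auto simp: set_cat_def Hom_def)
  show ?thesis
    unfolding category_def
  proof (intro conjI ballI impI)
    fix f :: "'a set \<times> ('a \<Rightarrow> 'a) \<times> 'a set" assume f: "f \<in> ar set_cat"
    then have f': "f \<in> Hom set_cat (src set_cat f) (tgt set_cat f)" by (simp add: Hom_def)
    show "src set_cat f \<in> ob set_cat" "tgt set_cat f \<in> ob set_cat" by (simp_all add: set_cat_def)
    show "cmp set_cat f (ide set_cat (src set_cat f)) = f"
      by (rule set_cat_eqI[OF cmp[OF ide f'] f']) (simp add: app_cmp[OF ide] app_ide)
    show "cmp set_cat (ide set_cat (tgt set_cat f)) f = f"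
      by (rule set_cat_eqI[OF cmp[OF f' ide] f']) (simp add: app_cmp[OF f'] app_ide app_in[OF f'])
    fix g :: "'a set \<times> ('a \<Rightarrow> 'a) \<times> 'a set"
    assume g: "g \<in> ar set_cat" and gf: "src set_cat g = tgt set_cat f"
    then have g': "g \<in> Hom set_cat (tgt set_cat f) (tgt set_cat g)" by (simp add: Hom_def)
    show "cmp set_cat g f \<in> Hom set_cat (src set_cat f) (tgt set_cat g)"
      by (rule cmp[OF f' g'])
  next
    fix f g h :: "'a set \<times> ('a \<Rightarrow> 'a) \<times> 'a set"
    assume *: "f \<in> ar set_cat" "g \<in> ar set_cat" "h \<in> ar set_cat"
      "src set_cat g = tgt set_cat f \<and> src set_cat h = tgt set_cat g"
    have f: "f \<in> Hom set_cat (src set_cat f) (tgt set_cat f)"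
      and g: "g \<in> Hom set_cat (tgt set_cat f) (tgt set_cat g)"
      and h: "h \<in> Hom set_cat (tgt set_cat g) (tgt set_cat h)"
      using * by (simp_all add: Hom_def)
    show "cmp set_cat h (cmp set_cat g f) = cmp set_cat (cmp set_cat h g) f"
      by (rule set_cat_eqI[OF cmp[OF cmp[OF f g] h] cmp[OF f cmp[OF g h]]])
        (simp add: app_cmp[OF cmp[OF f g]] app_cmp[OF f] app_cmp[OF g] app_in[OF f])
  qed (use ide in \<open>auto\<close>)
qed

lemma functor_Hom: "is_functor C D F \<Longrightarrow> f \<in> Hom C X Y \<Longrightarrow> on_ar F f \<in> Hom D (on_ob F X) (on_ob F Y)"
  by (auto simp: is_functor_def Hom_def)

lemma functor_ide: "is_functor C D F \<Longrightarrow> X \<in> ob C \<Longrightarrow> on_ar F (ide C X) = ide D (on_ob F X)"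
  by (simp add: is_functor_def)

lemma functor_cmp:
  "is_functor C D F \<Longrightarrow> f \<in> Hom C X Y \<Longrightarrow> g \<in> Hom C Y Z \<Longrightarrow>
    on_ar F (cmp C g f) = cmp D (on_ar F g) (on_ar F f)"
  by (simp add: is_functor_def Hom_def)

lemma set_functor_in:
  "is_functor C set_cat F \<Longrightarrow> f \<in> Hom C X Y \<Longrightarrow> x \<in> on_ob F X \<Longrightarrow> app (on_ar F f) x \<in> on_ob F Y"
  by (rule app_in[OF functor_Hom])

lemma set_functor_cmp:
  "is_functor C set_cat F \<Longrightarrow> f \<in> Hom C X Y \<Longrightarrow> g \<in> Hom C Y Z \<Longrightarrow> x \<in> on_ob F X \<Longrightarrow>
    app (on_ar F (cmp C g f)) x = app (on_ar F g) (app (on_ar F f) x)"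
  by (simp add: functor_cmp app_cmp[OF functor_Hom])

lemma set_functor_ide:
  "is_functor C set_cat F \<Longrightarrow> X \<in> ob C \<Longrightarrow> x \<in> on_ob F X \<Longrightarrow> app (on_ar F (ide C X)) x = x"
  by (simp add: functor_ide app_ide)

lemma functor_cat_simps [simp]:
  "ob (functor_cat C D) = {F. is_functor C D F}"
  "src (functor_cat C D) \<eta> = fst \<eta>" "tgt (functor_cat C D) \<eta> = snd (snd \<eta>)"
  "ide (functor_cat C D) F = (F, \<lambda>X\<in>ob C. ide D (on_ob F X), F)"
  "cmp (functor_cat C D) \<theta> \<eta> = (fst \<eta>, \<lambda>X\<in>ob C. cmp D (fst (snd \<theta>) X) (fst (snd \<eta>) X), snd (snd \<theta>))"
  by (auto simp: functor_cat_def split: prod.splits)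

lemma functor_cat_ar:
  "(F, \<eta>, G) \<in> ar (functor_cat C D) \<longleftrightarrow>
     is_functor C D F \<and> is_functor C D G \<and> \<eta> \<in> extensional (ob C) \<and>
     (\<forall>X\<in>ob C. \<eta> X \<in> Hom D (on_ob F X) (on_ob G X)) \<and>
     (\<forall>f\<in>ar C. cmp D (\<eta> (tgt C f)) (on_ar F f) = cmp D (on_ar G f) (\<eta> (src C f)))"
  by (simp add: functor_cat_def)

lemma ntrans_in:
  "(F, \<eta>, G) \<in> ar (functor_cat C set_cat) \<Longrightarrow> X \<in> ob C \<Longrightarrow> x \<in> on_ob F X \<Longrightarrow> app (\<eta> X) x \<in> on_ob G X"
  by (meson app_in functor_cat_ar)

lemma ntrans_natural:
  assumes "(F, \<eta>, G) \<in> ar (functor_cat C set_cat)" "f \<in> Hom C X Y" "x \<in> on_ob F X"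
  shows "app (\<eta> Y) (app (on_ar F f) x) = app (on_ar G f) (app (\<eta> X) x)"
proof -
  have F: "is_functor C set_cat F"
    and \<eta>: "\<And>X. X \<in> ob C \<Longrightarrow> \<eta> X \<in> Hom set_cat (on_ob F X) (on_ob G X)"
    and nat: "cmp set_cat (\<eta> Y) (on_ar F f) = cmp set_cat (on_ar G f) (\<eta> X)"
    using assms by (auto simp: functor_cat_ar Hom_def)
  have X: "X \<in> ob C"
    using F assms(2) by (auto simp: is_functor_def Hom_def dest: category_src)
  show ?thesis
    using arg_cong[OF nat, of "\<lambda>g. app g x"] app_cmp[OF functor_Hom[OF F assms(2)] assms(3)]
      app_cmp[OF \<eta>[OF X] assms(3)] by simp
qed

lemma ntrans_eqI:
  assumes "(F, \<eta>, G) \<in> ar (functor_cat C set_cat)" "(F, \<theta>, G) \<in> ar (functor_cat C set_cat)"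
    and "\<And>X x. X \<in> ob C \<Longrightarrow> x \<in> on_ob F X \<Longrightarrow> app (\<eta> X) x = app (\<theta> X) x"
  shows "\<eta> = \<theta>"
proof (rule extensionalityI)
  show "\<eta> \<in> extensional (ob C)" "\<theta> \<in> extensional (ob C)"
    using assms(1,2) by (auto simp: functor_cat_ar)
  show "\<eta> X = \<theta> X" if "X \<in> ob C" for X
    using assms that by (intro set_cat_eqI[of _ "on_ob F X" "on_ob G X"]) (auto simp: functor_cat_ar)
qed

section \<open>Functors on a localization\<close>


lemma zigzag_start: "category C \<Longrightarrow> zigzag C W X ps Y \<Longrightarrow> X \<in> ob C"
  by (erule zigzag.cases) (auto intro: category_src category_tgt)

text \<open>Recovers where the tail behind a reduced segment starts, since a list of steps does not
  name its endpoints.\<close>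

lemma zigzag_append:
  assumes "category C" "zigzag C W X (ps @ qs) Y"
  shows "\<exists>Z. zigzag C W X ps Z \<and> zigzag C W Z qs Y"
  using assms(2)
proof (induction ps arbitrary: X)
  case Nil
  then show ?case using zigzag_start[OF assms(1) Nil] by (auto intro: zigzag.empty)
next
  case (Cons p ps)
  show ?case
    using Cons.prems
    by (cases rule: zigzag.cases) (auto dest!: Cons.IH intro: zigzag.forward zigzag.backward)
qed

text \<open>A contravariant functor to sets that inverts \<open>W\<close>; \<open>act f\<close> goes
  from \<open>G Y\<close> to \<open>G X\<close> because clopen subsets pull back. By the universal
  property such a functor factors through the localization; what matters here is the consequence
  that arrows with equal images there act equally.\<close>

locale localized_functor =
  fixes C :: "('o, 'a) cat" and W :: "'a set" and G :: "'o \<Rightarrow> 'b set" and act :: "'a \<Rightarrow> 'b \<Rightarrow> 'b"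
  assumes category: "category C"
    and act_in: "f \<in> Hom C X Y \<Longrightarrow> U \<in> G Y \<Longrightarrow> act f U \<in> G X"
    and act_ide: "X \<in> ob C \<Longrightarrow> U \<in> G X \<Longrightarrow> act (ide C X) U = U"
    and act_cmp: "f \<in> Hom C X Y \<Longrightarrow> g \<in> Hom C Y Z \<Longrightarrow> U \<in> G Z \<Longrightarrow> act (cmp C g f) U = act f (act g U)"
    and weq: "w \<in> W \<Longrightarrow> w \<in> Hom C X Y \<Longrightarrow> bij_betw (act w) (G Y) (G X)"
    and W_ar: "W \<subseteq> ar C"
begin

text \<open>The head of a list is applied first, hence acts last. A backward step along
  \<open>w\<close> runs from \<open>tgt C w\<close> to \<open>src C w\<close>, so its action has to
  map \<open>G (src C w)\<close> to \<open>G (tgt C w)\<close>, which is what the inverse of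
  \<open>act w\<close> does.\<close>

primrec zig_act :: "'a zig list \<Rightarrow> 'b \<Rightarrow> 'b" where
  "zig_act [] U = U"
| "zig_act (p # ps) U = (case p of
     Fwd f \<Rightarrow> act f (zig_act ps U)
   | Bwd w \<Rightarrow> inv_into (G (tgt C w)) (act w) (zig_act ps U))"

lemma zig_act_append: "zig_act (ps @ qs) U = zig_act ps (zig_act qs U)"
  by (induction ps) (auto split: zig.splits)

lemma weq': "w \<in> W \<Longrightarrow> bij_betw (act w) (G (tgt C w)) (G (src C w))"
  using weq[of w "src C w" "tgt C w"] W_ar by (auto simp: Hom_def)

lemma zig_act_in: "zigzag C W X ps Y \<Longrightarrow> U \<in> G Y \<Longrightarrow> zig_act ps U \<in> G X"
proof (induction rule: zigzag.induct)
  case (forward f ps Y)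
  then show ?case using act_in[of f "src C f" "tgt C f"] by (simp add: Hom_def)
next
  case (backward w ps Y)
  then show ?case using bij_betw_inv_into[OF weq', of w] by (auto simp: bij_betw_def)
qed simp

text \<open>Each rule is an equation that holds for any functor inverting \<open>W\<close>, and the
  common prefix acts in the same way on both sides. The equations hold only on elements of the right
  set, so the start of the tail \<open>qs\<close> is found by inverting the zigzag rules; then
  \<open>zig_act qs U\<close> lies in that set.\<close>

lemma zig_act_reduces:
  assumes "zig_reduces C W as bs" "zigzag C W X as Y" "zigzag C W X bs Y" "U \<in> G Y"
  shows "zig_act as U = zig_act bs U"
  using assms
proof cases
  case (identity Z ps qs)
  obtain Z' where "zigzag C W Z' (Fwd (ide C Z) # qs) Y"
    using zigzag_append[OF category assms(2)[unfolded identity]] by auto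
  then have "zigzag C W Z qs Y"
    using HomD[OF category_ide[OF category identity(3)]] by (cases rule: zigzag.cases) auto
  then show ?thesis
    using zig_act_in[OF _ assms(4)] identity by (simp add: zig_act_append act_ide)
next
  case (composite f g ps qs)
  obtain Z where "zigzag C W Z (Fwd f # Fwd g # qs) Y"
    using zigzag_append[OF category assms(2)[unfolded composite]] by auto
  then have "zigzag C W (tgt C f) (Fwd g # qs) Y" by (cases rule: zigzag.cases) auto
  then have "zigzag C W (tgt C g) qs Y" by (cases rule: zigzag.cases) auto
  then show ?thesis
    using act_cmp[of f "src C f" "tgt C f" g "tgt C g"] zig_act_in[OF _ assms(4)] composite
    by (simp add: zig_act_append Hom_def)
next
  case (left_inverse w ps qs)
  obtain Z where "zigzag C W Z (Fwd w # Bwd w # qs) Y"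
    using zigzag_append[OF category assms(2)[unfolded left_inverse]] by auto
  then have "zigzag C W (tgt C w) (Bwd w # qs) Y" by (cases rule: zigzag.cases) auto
  then have "zigzag C W (src C w) qs Y" by (cases rule: zigzag.cases) auto
  then show ?thesis
    using bij_betw_inv_into_right[OF weq'] zig_act_in[OF _ assms(4)] left_inverse
    by (simp add: zig_act_append)
next
  case (right_inverse w ps qs)
  obtain Z where "zigzag C W Z (Bwd w # Fwd w # qs) Y"
    using zigzag_append[OF category assms(2)[unfolded right_inverse]] by auto
  then have "zigzag C W (src C w) (Fwd w # qs) Y" by (cases rule: zigzag.cases) auto
  then have "zigzag C W (tgt C w) qs Y" by (cases rule: zigzag.cases) auto
  then show ?thesis
    using bij_betw_inv_into_left[OF weq'] zig_act_in[OF _ assms(4)] right_inverse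
    by (simp add: zig_act_append)
qed

text \<open>Equal classes mean that a finite chain of reductions, in either direction, joins the
  one-step zigzags. The chain relation requires both neighbours to be zigzags from \<open>X\<close>
  to \<open>Y\<close>, which is what makes \<open>zig_act\<close> constant along it.\<close>

lemma act_eq_if_loc_ar_eq:
  assumes eq: "loc_ar C W f = loc_ar C W g" and f: "f \<in> Hom C X Y" and g: "g \<in> Hom C X Y"
    and U: "U \<in> G Y"
  shows "act f U = act g U"
proof -
  let ?R = "\<lambda>as bs. zigzag C W X as Y \<and> zigzag C W X bs Y \<and> zig_reduces C W as bs"
  have "[Fwd g] \<in> zig_class C W X Y [Fwd g]" by (simp add: zig_class_def)
  also have "\<dots> = zig_class C W X Y [Fwd f]"
    using eq HomD[OF f] HomD[OF g] by (simp add: loc_ar_def)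
  finally have "equivclp ?R [Fwd f] [Fwd g]" by (simp add: zig_class_def)
  then have "zig_act [Fwd f] U = zig_act [Fwd g] U"
  proof (induction rule: equivclp_induct)
    case (step y z)
    then show ?case using zig_act_reduces[OF _ _ _ U] by metis
  qed simp
  then show ?thesis by simp
qed

end

section \<open>Clopen subsets of realizations\<close>

definition clopens :: "'a topology \<Rightarrow> 'a set set" where
  "clopens T = {U. openin T U \<and> closedin T U}"

text \<open>Cut down to the underlying space, because the maps between realizations have meaningless
  values elsewhere.\<close>

definition preimage_in :: "'a topology \<Rightarrow> ('a \<Rightarrow> 'b) \<Rightarrow> 'b set \<Rightarrow> 'a set" where
  "preimage_in T f U = {x \<in> topspace T. f x \<in> U}"

lemma preimage_in_clopens:
  "continuous_map T T' f \<Longrightarrow> U \<in> clopens T' \<Longrightarrow> preimage_in T f U \<in> clopens T"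
  by (simp add: clopens_def preimage_in_def openin_continuous_map_preimage
      closedin_continuous_map_preimage)

lemma clopens_subset_topspace: "U \<in> clopens T \<Longrightarrow> U \<subseteq> topspace T"
  by (simp add: clopens_def openin_subset)

text \<open>The homotopy gives a path from \<open>f x\<close> to \<open>g x\<close>, and a path can
  neither enter nor leave a clopen set.\<close>

lemma homotopic_with_clopen:
  assumes "homotopic_with (\<lambda>_. True) X Y f g" "U \<in> clopens Y" "x \<in> topspace X"
  shows "f x \<in> U \<longleftrightarrow> g x \<in> U"
proof -
  obtain h where h: "continuous_map (prod_topology (top_of_set {0..1::real}) X) Y h"
    "\<And>x. h (0, x) = f x" "\<And>x. h (1, x) = g x"
    using assms(1) unfolding homotopic_with_def by auto
  have "continuous_map (top_of_set {0..1::real}) Y (h \<circ> (\<lambda>t. (t, x)))"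
    by (rule continuous_map_compose[OF _ h(1)]) (simp add: continuous_map_pairwise o_def assms(3))
  from preimage_in_clopens[OF this assms(2)]
  have "preimage_in (top_of_set {0..1::real}) (\<lambda>t. h (t, x)) U \<in> {{}, {0..1}}"
    using connected_space_clopen_in[of "top_of_set {0..1::real}"]
    by (simp add: clopens_def o_def connected_space_subtopology connectedin_def[symmetric])
  then have P: "preimage_in (top_of_set {0..1::real}) (\<lambda>t. h (t, x)) U = {} \<or>
    preimage_in (top_of_set {0..1::real}) (\<lambda>t. h (t, x)) U = {0..1}" by blast
  have "0 \<in> preimage_in (top_of_set {0..1::real}) (\<lambda>t. h (t, x)) U \<longleftrightarrow>
    1 \<in> preimage_in (top_of_set {0..1::real}) (\<lambda>t. h (t, x)) U"
    using P by (elim disjE) (simp_all only: empty_iff atLeastAtMost_iff order_refl zero_le_one)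
  then show ?thesis
    using h(2,3) by (simp add: preimage_in_def)
qed

text \<open>Pulling back along a homotopy inverse is a two-sided inverse: the composites are
  homotopic to identities, and homotopic maps pull clopen sets back to the same set.\<close>

lemma homotopy_equivalence_clopens:
  assumes "homotopy_equivalence X Y f"
  shows "bij_betw (preimage_in X f) (clopens Y) (clopens X)"
proof -
  obtain g where f: "continuous_map X Y f" and g: "continuous_map Y X g"
    and gf: "homotopic_with (\<lambda>_. True) X X (g \<circ> f) id" and fg: "homotopic_with (\<lambda>_. True) Y Y (f \<circ> g) id"
    using assms by (auto simp: homotopy_equivalence_def)
  have inv: "preimage_in Y g (preimage_in X f U) = U" if "U \<in> clopens Y" for U
    using homotopic_with_clopen[OF fg that] clopens_subset_topspace[OF that]
      continuous_map_image_subset_topspace[OF g]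
    by (auto simp: preimage_in_def)
  have inv': "preimage_in X f (preimage_in Y g U) = U" if "U \<in> clopens X" for U
    using homotopic_with_clopen[OF gf that] clopens_subset_topspace[OF that]
      continuous_map_image_subset_topspace[OF f]
    by (auto simp: preimage_in_def)
  show ?thesis
    by (rule bij_betw_byWitness[where f' = "preimage_in Y g"])
      (use inv inv' preimage_in_clopens[OF f] preimage_in_clopens[OF g] in auto)
qed

section \<open>Topology and functoriality of geometric realizations\<close>

abbreviation simplex_topology :: "nat \<Rightarrow> (nat \<Rightarrow> real) topology" where
  "simplex_topology n \<equiv> subtopology (powertop_real UNIV) (standard_simplex n)"

text \<open>\<open>topology\<close> is known to return the intended open sets once the predicate
  satisfies \<open>istopology\<close>. This one does, since it asks for openness of preimages, one
  for each cell, and preimages commute with intersections and unions.\<close>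

lemma openin_realization:
  "openin (realization S) U \<longleftrightarrow> U \<subseteq> cell_class S ` cells S \<and>
     (\<forall>n. \<forall>x\<in>on_ob S n. openin (simplex_topology n)
        {t \<in> standard_simplex n. cell_class S (n, x, t) \<in> U})"
proof -
  let ?P = "\<lambda>U. U \<subseteq> cell_class S ` cells S \<and>
     (\<forall>n. \<forall>x\<in>on_ob S n. openin (simplex_topology n)
        {t \<in> standard_simplex n. cell_class S (n, x, t) \<in> U})"
  have "istopology ?P"
    unfolding istopology_def
  proof (intro conjI allI impI)
    fix U V assume U: "?P U" and V: "?P V"
    show "U \<inter> V \<subseteq> cell_class S ` cells S" using U by blast
    show "\<forall>x\<in>on_ob S n. openin (simplex_topology n)
        {t \<in> standard_simplex n. cell_class S (n, x, t) \<in> U \<inter> V}" for n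
    proof
      fix x assume x: "x \<in> on_ob S n"
      have "{t \<in> standard_simplex n. cell_class S (n, x, t) \<in> U \<inter> V} =
        {t \<in> standard_simplex n. cell_class S (n, x, t) \<in> U} \<inter>
        {t \<in> standard_simplex n. cell_class S (n, x, t) \<in> V}" by auto
      then show "openin (simplex_topology n)
        {t \<in> standard_simplex n. cell_class S (n, x, t) \<in> U \<inter> V}"
        using U V x by (simp add: openin_Int)
    qed
  next
    fix \<U> assume U: "\<forall>U\<in>\<U>. ?P U"
    show "\<Union>\<U> \<subseteq> cell_class S ` cells S" using U by blast
    show "\<forall>x\<in>on_ob S n. openin (simplex_topology n)
        {t \<in> standard_simplex n. cell_class S (n, x, t) \<in> \<Union>\<U>}" for n
    proof
      fix x assume x: "x \<in> on_ob S n"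
      have "{t \<in> standard_simplex n. cell_class S (n, x, t) \<in> \<Union>\<U>} =
        (\<Union>U\<in>\<U>. {t \<in> standard_simplex n. cell_class S (n, x, t) \<in> U})" by auto
      then show "openin (simplex_topology n)
        {t \<in> standard_simplex n. cell_class S (n, x, t) \<in> \<Union>\<U>}"
        using U x by (auto intro!: openin_Union)
    qed
  qed
  then show ?thesis by (simp add: realization_def)
qed

lemma topspace_realization: "topspace (realization S) = cell_class S ` cells S"
proof
  show "topspace (realization S) \<subseteq> cell_class S ` cells S"
    using openin_realization[of S "topspace (realization S)"] by simp
  have "openin (realization S) (cell_class S ` cells S)"
    unfolding openin_realization
  proof (intro conjI allI ballI)
    fix n x assume "x \<in> on_ob S n"
    then have "{t \<in> standard_simplex n. cell_class S (n, x, t) \<in> cell_class S ` cells S} =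
      topspace (simplex_topology n)"
      by (auto simp: cells_def)
    then show "openin (simplex_topology n)
      {t \<in> standard_simplex n. cell_class S (n, x, t) \<in> cell_class S ` cells S}" by (simp only: openin_topspace)
  qed simp
  then show "cell_class S ` cells S \<subseteq> topspace (realization S)"
    by (rule openin_subset)
qed

lemma cell_class_eq: "cell_class S c = cell_class S d \<longleftrightarrow> equivclp (glue S) c d"
proof -
  have "equivclp (glue S) c d \<longleftrightarrow> equivclp (glue S) c = equivclp (glue S) d"
    using equivp_evquivclp[of "glue S"] unfolding equivp_def by blast
  then show ?thesis by (simp add: cell_class_def fun_eq_iff Set.set_eq_iff)
qed

lemma simplex_cat_simps [simp]:
  "ob simplex_cat = UNIV" "src simplex_cat (m, \<theta>, n) = m" "tgt simplex_cat (m, \<theta>, n) = n"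
  by (simp_all add: simplex_cat_def)

lemma equivclp_invariant:
  assumes "equivclp R c d" "\<And>c d. R c d \<Longrightarrow> h c = h d"
  shows "h c = h d"
  using assms(1) by (induction rule: equivclp_induct) (auto dest: assms(2))

text \<open>The map is defined as a union over all representatives of a class. Naturality sends
  glued cells to glued cells, so all representatives give the same class and the union collapses to
  it.\<close>

lemma realization_map_cell_class:
  assumes "(S, \<eta>, S') \<in> ar (functor_cat (opposite simplex_cat) set_cat)"
  shows "realization_map (S, \<eta>, S') (cell_class S (n, x, t)) = cell_class S' (n, app (\<eta> n) x, t)"
proof -
  let ?m = "\<lambda>(n, x, t). (n, app (\<eta> n) x, t)"
  have glue: "glue S' (?m c) (?m d)" if g: "glue S c d" for c d
  proof -
    obtain m \<theta> n x t where *: "(m, \<theta>, n) \<in> ar simplex_cat" "x \<in> on_ob S n" "t \<in> standard_simplex m"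
      "c = (m, app (on_ar S (m, \<theta>, n)) x, t)" "d = (n, x, push_simplex (m, \<theta>, n) t)"
      using g unfolding glue_def by blast
    have "(m, \<theta>, n) \<in> Hom (opposite simplex_cat) n m"
      using *(1) by (simp add: Hom_def)
    from ntrans_natural[OF assms this *(2)] ntrans_in[OF assms _ *(2)] *(1-3) show ?thesis
      unfolding glue_def *(4,5)
      by (intro exI[of _ m] exI[of _ \<theta>] exI[of _ n] exI[of _ "app (\<eta> n) x"] exI[of _ t]) simp
  qed
  have "cell_class S' (?m c) = cell_class S' (?m d)" if "glue S c d" for c d
    unfolding cell_class_eq by (rule r_into_equivclp) (rule glue[OF that])
  then have *: "cell_class S' (?m (n, x, t)) = cell_class S' (?m d)" if "d \<in> cell_class S (n, x, t)" for d
    using that unfolding cell_class_def[of S] mem_Collect_eq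
    by (rule equivclp_invariant[where h = "\<lambda>c. cell_class S' (?m c)", rotated]) assumption
  have mem: "(n, x, t) \<in> cell_class S (n, x, t)" by (simp add: cell_class_def)
  have "realization_map (S, \<eta>, S') (cell_class S (n, x, t)) = (\<Union>d\<in>cell_class S (n, x, t). cell_class S' (?m d))"
    by (simp add: realization_map_def split_beta)
  also have "\<dots> = cell_class S' (?m (n, x, t))"
    by (rule UN_constant_eq[OF mem]) (intro ballI *[symmetric])
  finally show ?thesis by simp
qed

text \<open>Seen in the cell of \<open>x\<close>, the preimage of \<open>U\<close> is what
  \<open>U\<close> cuts out in the cell of the image of \<open>x\<close>, so the openness condition
  for \<open>S\<close> is part of the one for \<open>S'\<close>.\<close>

lemma continuous_map_realization:
  assumes "(S, \<eta>, S') \<in> ar (functor_cat (opposite simplex_cat) set_cat)"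
  shows "continuous_map (realization S) (realization S') (realization_map (S, \<eta>, S'))"
proof -
  note rm = realization_map_cell_class[OF assms]
  have in_cells: "app (\<eta> n) x \<in> on_ob S' n" if "x \<in> on_ob S n" for n x
    using ntrans_in[OF assms _ that] by simp
  show ?thesis
    unfolding continuous_map_def
  proof (intro conjI allI impI)
    show "realization_map (S, \<eta>, S') \<in> topspace (realization S) \<rightarrow> topspace (realization S')"
      using in_cells by (auto simp: topspace_realization cells_def rm)
    fix U assume U: "openin (realization S') U"
    show "openin (realization S) {x \<in> topspace (realization S). realization_map (S, \<eta>, S') x \<in> U}"
      unfolding openin_realization
    proof (intro conjI allI ballI)
      fix n x assume x: "x \<in> on_ob S n"
      have "{t \<in> standard_simplex n. cell_class S (n, x, t) \<in>
          {x \<in> topspace (realization S). realization_map (S, \<eta>, S') x \<in> U}} =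
        {t \<in> standard_simplex n. cell_class S' (n, app (\<eta> n) x, t) \<in> U}"
        using x by (auto simp: topspace_realization cells_def rm)
      then show "openin (simplex_topology n)
        {t \<in> standard_simplex n. cell_class S (n, x, t) \<in>
          {x \<in> topspace (realization S). realization_map (S, \<eta>, S') x \<in> U}}"
        using U in_cells[OF x] by (simp add: openin_realization)
    qed (auto simp: topspace_realization)
  qed
qed

lemma realization_map_ide:
  assumes "c \<in> topspace (realization S)"
    and "(S, \<eta>, S) \<in> ar (functor_cat (opposite simplex_cat) set_cat)"
    and "\<And>n x. x \<in> on_ob S n \<Longrightarrow> app (\<eta> n) x = x"
  shows "realization_map (S, \<eta>, S) c = c"
proof -
  obtain n x t where "c = cell_class S (n, x, t)" "x \<in> on_ob S n"
    using assms(1) by (auto simp: topspace_realization cells_def)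
  then show ?thesis
    by (simp add: realization_map_cell_class[OF assms(2)] assms(3))
qed

lemma realization_map_cmp:
  assumes "(S, \<eta>, S') \<in> ar (functor_cat (opposite simplex_cat) set_cat)"
    and "(S', \<theta>, S'') \<in> ar (functor_cat (opposite simplex_cat) set_cat)"
    and "(S, \<zeta>, S'') \<in> ar (functor_cat (opposite simplex_cat) set_cat)"
    and "\<And>n x. x \<in> on_ob S n \<Longrightarrow> app (\<zeta> n) x = app (\<theta> n) (app (\<eta> n) x)"
    and "c \<in> topspace (realization S)"
  shows "realization_map (S, \<zeta>, S'') c = realization_map (S', \<theta>, S'') (realization_map (S, \<eta>, S') c)"
proof -
  obtain n x t where "c = cell_class S (n, x, t)" "x \<in> on_ob S n"
    using assms(5) by (auto simp: topspace_realization cells_def)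
  then show ?thesis
    by (simp add: realization_map_cell_class[OF assms(1)] realization_map_cell_class[OF assms(2)]
      realization_map_cell_class[OF assms(3)] assms(4))
qed

text \<open>All structure maps are identities, so gluing changes the dimension and the simplex
  coordinates but never the element: the element is an invariant of the class. Hence in each cell
  the set belonging to \<open>L\<close> is everything or nothing, and its complement belongs to
  \<open>- L\<close>.\<close>

lemma constant_sset_clopen:
  assumes "S = \<lparr>on_ob = \<lambda>_. K, on_ar = \<lambda>_. ide set_cat K\<rparr>"
  shows "{cell_class S (n, x, t) | n x t. x \<in> K \<inter> L \<and> t \<in> standard_simplex n} \<in> clopens (realization S)"
    and "cell_class S (n, x, t) = cell_class S (m, y, s) \<Longrightarrow> x = y"
proof -
  have K: "on_ob S = (\<lambda>_. K)" and ide: "on_ar S = (\<lambda>_. ide set_cat K)"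
    unfolding assms by simp_all
  have glue: "fst (snd c) = fst (snd d)" if "glue S c d" for c d
    using that unfolding glue_def K ide by (elim exE conjE) (simp add: app_ide)
  show inj: "x = y" if "cell_class S (n, x, t) = cell_class S (m, y, s)" for n x t m y s
    using equivclp_invariant[where h = "\<lambda>c. fst (snd c)", OF that[unfolded cell_class_eq]] glue by simp
  define U where "U L = {cell_class S (n, x, t) | n x t. x \<in> K \<inter> L \<and> t \<in> standard_simplex n}" for L
  have mem: "cell_class S (n, x, t) \<in> U L \<longleftrightarrow> x \<in> L" if "x \<in> K" "t \<in> standard_simplex n" for n x t L
  proof
    assume "cell_class S (n, x, t) \<in> U L"
    then obtain m y s where "cell_class S (n, x, t) = cell_class S (m, y, s)" "y \<in> L" by (auto simp: U_def)
    with inj show "x \<in> L" by metis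
  qed (use that in \<open>auto simp: U_def\<close>)
  have op: "openin (realization S) (U L)" for L
    unfolding openin_realization
  proof (intro conjI allI ballI)
    show "U L \<subseteq> cell_class S ` cells S" by (auto simp: U_def cells_def K)
    fix n x assume x: "x \<in> on_ob S n"
    then have x': "x \<in> K" by (simp add: K)
    have *: "{t \<in> standard_simplex n. cell_class S (n, x, t) \<in> U L} =
      (if x \<in> L then topspace (simplex_topology n) else {})"
      using mem[OF x', of _ n] by (auto simp del: split_paired_Ex)
    show "openin (simplex_topology n)
      {t \<in> standard_simplex n. cell_class S (n, x, t) \<in> U L}"
      unfolding * by (simp only: openin_topspace openin_empty split: if_split) simp
  qed
  have "topspace (realization S) - U L = U (- L)"
  proof (rule Set.set_eqI)
    fix c
    show "c \<in> topspace (realization S) - U L \<longleftrightarrow> c \<in> U (- L)"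
    proof (cases "c \<in> topspace (realization S)")
      case True
      then obtain n x t where c: "c = cell_class S (n, x, t)" and "x \<in> K" "t \<in> standard_simplex n"
        by (auto simp: topspace_realization cells_def K)
      then have "c \<in> U (- L) \<longleftrightarrow> c \<notin> U L"
        unfolding c by (simp only: mem Compl_iff)
      with True show ?thesis by blast
    next
      case False
      with openin_subset[OF op[of "- L"]] show ?thesis by blast
    qed
  qed
  with op[of "- L"] op[of L] show "{cell_class S (n, x, t) | n x t. x \<in> K \<inter> L \<and> t \<in> standard_simplex n} \<in> clopens (realization S)"
    unfolding clopens_def closedin_def U_def[symmetric] by (auto dest: openin_subset)
qed

text \<open>The test set consists of the classes over the single element
  \<open>app (\<eta> 0) x\<close>. The vertex of \<open>x\<close> lies in its pullback along
  \<open>\<eta>\<close>, hence also along \<open>\<theta>\<close>, which forces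
  \<open>app (\<theta> 0) x\<close> to be that element.\<close>

lemma constant_sset_separated:
  assumes S': "S' = \<lparr>on_ob = \<lambda>_. K, on_ar = \<lambda>_. ide set_cat K\<rparr>"
    and \<eta>: "(S, \<eta>, S') \<in> ar (functor_cat (opposite simplex_cat) set_cat)"
    and \<theta>: "(S, \<theta>, S') \<in> ar (functor_cat (opposite simplex_cat) set_cat)"
    and eq: "\<And>U. U \<in> clopens (realization S') \<Longrightarrow>
      preimage_in (realization S) (realization_map (S, \<eta>, S')) U =
      preimage_in (realization S) (realization_map (S, \<theta>, S')) U"
    and x: "x \<in> on_ob S 0"
  shows "app (\<eta> 0) x = app (\<theta> 0) x"
proof -
  \<comment> \<open>The only point of the 0-simplex, so that \<open>(0, x, t)\<close> is the vertex
    belonging to \<open>x\<close>.\<close>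
  define t :: "nat \<Rightarrow> real" where "t = (\<lambda>i. if i = 0 then 1 else 0)"
  have t: "t \<in> standard_simplex 0" by (simp add: standard_simplex_def t_def)
  define U where "U = {cell_class S' (n, y, t) | n y t. y \<in> K \<inter> {app (\<eta> 0) x} \<and> t \<in> standard_simplex n}"
  have U: "preimage_in (realization S) (realization_map (S, \<eta>, S')) U =
    preimage_in (realization S) (realization_map (S, \<theta>, S')) U"
    unfolding U_def by (rule eq[OF constant_sset_clopen(1)[OF S']])
  have "app (\<eta> 0) x \<in> K"
    using ntrans_in[OF \<eta> _ x] unfolding S' by simp
  then have "cell_class S (0, x, t) \<in> preimage_in (realization S) (realization_map (S, \<eta>, S')) U"
    using t x by (auto simp: preimage_in_def topspace_realization cells_def realization_map_cell_class[OF \<eta>] U_def)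
  then have "cell_class S (0, x, t) \<in> preimage_in (realization S) (realization_map (S, \<theta>, S')) U"
    using U by simp
  then have "cell_class S' (0, app (\<theta> 0) x, t) \<in> U"
    by (simp add: preimage_in_def realization_map_cell_class[OF \<theta>])
  then obtain n s where "cell_class S' (0, app (\<theta> 0) x, t) = cell_class S' (n, app (\<eta> 0) x, s)"
    by (auto simp: U_def)
  from constant_sset_clopen(2)[OF S' this] show ?thesis by simp
qed

section \<open>Stalks of sheaves\<close>

lemma Sh_simps [simp]:
  "ob (Sh C J) = {F. is_functor (opposite C) set_cat F \<and> is_sheaf C J F}"
  "src (Sh C J) \<eta> = fst \<eta>" "tgt (Sh C J) \<eta> = snd (snd \<eta>)"
  "ide (Sh C J) F = (F, \<lambda>U\<in>ob C. ide set_cat (on_ob F U), F)"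
  "cmp (Sh C J) \<theta> \<eta> = (fst \<eta>, \<lambda>U\<in>ob C. cmp set_cat (fst (snd \<theta>) U) (fst (snd \<eta>) U), snd (snd \<theta>))"
  by (simp_all add: Sh_def full_subcat_def)

lemma Sh_ar:
  "\<eta> \<in> ar (Sh C J) \<longleftrightarrow> \<eta> \<in> ar (functor_cat (opposite C) set_cat) \<and>
     is_sheaf C J (fst \<eta>) \<and> is_sheaf C J (snd (snd \<eta>))"
  by (auto simp: Sh_def full_subcat_def)

lemma Sh_Hom:
  "\<phi> \<in> Hom (Sh C J) F G \<longleftrightarrow> (\<exists>\<eta>. \<phi> = (F, \<eta>, G) \<and>
     (F, \<eta>, G) \<in> ar (functor_cat (opposite C) set_cat) \<and> is_sheaf C J F \<and> is_sheaf C J G)"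
  by (cases \<phi>) (auto simp: Hom_def Sh_ar)

lemma sSh_Hom:
  "\<phi> \<in> Hom (sSh C J) F G \<longleftrightarrow> (\<exists>\<eta>. \<phi> = (F, \<eta>, G) \<and>
     (F, \<eta>, G) \<in> ar (functor_cat (opposite simplex_cat) (Sh C J)))"
  by (cases \<phi>) (auto simp: Hom_def sSh_def)

lemma psh_in:
  "is_functor (opposite C) set_cat F \<Longrightarrow> g \<in> Hom C V U \<Longrightarrow> s \<in> on_ob F U \<Longrightarrow> app (on_ar F g) s \<in> on_ob F V"
  by (rule set_functor_in[of "opposite C"]) simp_all

lemma psh_cmp:
  "is_functor (opposite C) set_cat F \<Longrightarrow> g \<in> Hom C V U \<Longrightarrow> h \<in> Hom C W V \<Longrightarrow> s \<in> on_ob F U \<Longrightarrow>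
    app (on_ar F (cmp C g h)) s = app (on_ar F h) (app (on_ar F g) s)"
  using set_functor_cmp[of "opposite C" F g U V h W s] by simp

lemma psh_ide:
  "is_functor (opposite C) set_cat F \<Longrightarrow> U \<in> ob C \<Longrightarrow> s \<in> on_ob F U \<Longrightarrow> app (on_ar F (ide C U)) s = s"
  using set_functor_ide[of "opposite C" F U s] by simp

lemma psh_map_in:
  "(F, \<eta>, G) \<in> ar (functor_cat (opposite C) set_cat) \<Longrightarrow> U \<in> ob C \<Longrightarrow> s \<in> on_ob F U \<Longrightarrow>
    app (\<eta> U) s \<in> on_ob G U"
  using ntrans_in[of F \<eta> G "opposite C" U s] by simp

lemma psh_map_natural:
  "(F, \<eta>, G) \<in> ar (functor_cat (opposite C) set_cat) \<Longrightarrow> g \<in> Hom C V U \<Longrightarrow> s \<in> on_ob F U \<Longrightarrow>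
    app (\<eta> V) (app (on_ar F g) s) = app (on_ar G g) (app (\<eta> U) s)"
  using ntrans_natural[of F \<eta> G "opposite C" g U V s] by simp

lemma Hom_ob:
  assumes "category C" "f \<in> Hom C X Y"
  shows "X \<in> ob C" "Y \<in> ob C"
  using assms category_src[of C f] category_tgt[of C f] by (auto simp: Hom_def)

section \<open>Germs at a point of the topos\<close>

locale topos_point =
  fixes C :: "('o, 'a) cat" and J :: "'o \<Rightarrow> 'a set set" and u :: "('o, 'a) site_point"
  assumes catC: "category C" and is_point: "is_point C J u"
begin

lemma functor_u: "is_functor C set_cat u"
  using is_point unfolding is_point_def by (elim conjE)

text \<open>Flatness says that the category of elements of \<open>u\<close> is cofiltered: here two
  elements are dominated by a third, and in \<open>equalized\<close> two arrows that agree on an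
  element become equal after composition with an arrow that hits this element.\<close>

lemma directed:
  assumes "U \<in> ob C" "V \<in> ob C" "x \<in> on_ob u U" "y \<in> on_ob u V"
  obtains W w f g where "W \<in> ob C" "w \<in> on_ob u W" "f \<in> Hom C W U" "g \<in> Hom C W V"
    "app (on_ar u f) w = x" "app (on_ar u g) w = y"
proof -
  have "\<forall>U\<in>ob C. \<forall>V\<in>ob C. \<forall>x\<in>on_ob u U. \<forall>y\<in>on_ob u V.
        \<exists>W\<in>ob C. \<exists>w\<in>on_ob u W. \<exists>f\<in>Hom C W U. \<exists>g\<in>Hom C W V.
          app (on_ar u f) w = x \<and> app (on_ar u g) w = y"
    using is_point unfolding is_point_def by (elim conjE)
  with assms that show thesis by meson
qed

lemma equalized:
  assumes "f \<in> Hom C U V" "g \<in> Hom C U V" "x \<in> on_ob u U" "app (on_ar u f) x = app (on_ar u g) x"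
  obtains W w h where "W \<in> ob C" "w \<in> on_ob u W" "h \<in> Hom C W U" "app (on_ar u h) w = x" "cmp C f h = cmp C g h"
proof -
  have "\<forall>U\<in>ob C. \<forall>V\<in>ob C. \<forall>f\<in>Hom C U V. \<forall>g\<in>Hom C U V. \<forall>x\<in>on_ob u U.
        app (on_ar u f) x = app (on_ar u g) x \<longrightarrow>
        (\<exists>W\<in>ob C. \<exists>w\<in>on_ob u W. \<exists>h\<in>Hom C W U. app (on_ar u h) w = x \<and> cmp C f h = cmp C g h)"
    using is_point unfolding is_point_def by (elim conjE)
  with assms that Hom_ob[OF catC assms(1)] show thesis by meson
qed

text \<open>The relation behind \<open>point_germ\<close>, freed from the conditions on the second
  triple, so that it can be handled as an equivalence relation on the triples that satisfy
  them.\<close>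

definition germ_rel :: "('o, 'a, 'v) psh \<Rightarrow> 'o \<times> 'a set \<times> 'v \<Rightarrow> 'o \<times> 'a set \<times> 'v \<Rightarrow> bool" where
  "germ_rel F = (\<lambda>(U, x, s) (V, y, t). \<exists>W\<in>ob C. \<exists>w\<in>on_ob u W. \<exists>f\<in>Hom C W U. \<exists>g\<in>Hom C W V.
     app (on_ar u f) w = x \<and> app (on_ar u g) w = y \<and> app (on_ar F f) s = app (on_ar F g) t)"

definition germs_dom :: "('o, 'a, 'v) psh \<Rightarrow> ('o \<times> 'a set \<times> 'v) set" where
  "germs_dom F = {(U, x, s). U \<in> ob C \<and> x \<in> on_ob u U \<and> s \<in> on_ob F U}"

lemma germ_relI:
  "w \<in> on_ob u W \<Longrightarrow> f \<in> Hom C W U \<Longrightarrow> g \<in> Hom C W V \<Longrightarrow> app (on_ar u f) w = x \<Longrightarrow>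
    app (on_ar u g) w = y \<Longrightarrow> app (on_ar F f) s = app (on_ar F g) t \<Longrightarrow> germ_rel F (U, x, s) (V, y, t)"
  using Hom_ob[OF catC] unfolding germ_rel_def by blast

lemma germ_relE:
  assumes "germ_rel F (U, x, s) (V, y, t)"
  obtains W w f g where "W \<in> ob C" "w \<in> on_ob u W" "f \<in> Hom C W U" "g \<in> Hom C W V"
    "app (on_ar u f) w = x" "app (on_ar u g) w = y" "app (on_ar F f) s = app (on_ar F g) t"
  using assms unfolding germ_rel_def by blast

lemma germ_rel_refl:
  assumes "U \<in> ob C" "x \<in> on_ob u U"
  shows "germ_rel F (U, x, s) (U, x, s)"
  using category_ide[OF catC assms(1)] set_functor_ide[OF functor_u assms] assms(2)
  by (intro germ_relI[of x U "ide C U" U "ide C U"]) simp_all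

lemma germ_rel_sym: "germ_rel F (U, x, s) (V, y, t) \<Longrightarrow> germ_rel F (V, y, t) (U, x, s)"
  by (erule germ_relE) (rule germ_relI[OF _ _ _ _ _ sym], assumption+)

text \<open>Two witnesses are dominated by some \<open>D\<close>, since the category of elements is
  cofiltered. There the two arrows to the middle object \<open>V\<close> agree only on the element
  \<open>d\<close>, so a second refinement \<open>E\<close> makes them equal before the sections are
  compared.\<close>

lemma germ_rel_trans:
  assumes F: "is_functor (opposite C) set_cat F"
    and s: "s \<in> on_ob F U" and t: "t \<in> on_ob F V" and r: "r \<in> on_ob F Z"
    and st: "germ_rel F (U, x, s) (V, y, t)" and tr: "germ_rel F (V, y, t) (Z, z, r)"
  shows "germ_rel F (U, x, s) (Z, z, r)"
proof -
  obtain W1 w1 f1 g1 where 1: "W1 \<in> ob C" "w1 \<in> on_ob u W1" "f1 \<in> Hom C W1 U" "g1 \<in> Hom C W1 V"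
    "app (on_ar u f1) w1 = x" "app (on_ar u g1) w1 = y" "app (on_ar F f1) s = app (on_ar F g1) t"
    using st by (rule germ_relE)
  obtain W2 w2 f2 g2 where 2: "W2 \<in> ob C" "w2 \<in> on_ob u W2" "f2 \<in> Hom C W2 V" "g2 \<in> Hom C W2 Z"
    "app (on_ar u f2) w2 = y" "app (on_ar u g2) w2 = z" "app (on_ar F f2) t = app (on_ar F g2) r"
    using tr by (rule germ_relE)
  obtain D d a b where d: "D \<in> ob C" "d \<in> on_ob u D" "a \<in> Hom C D W1" "b \<in> Hom C D W2"
    "app (on_ar u a) d = w1" "app (on_ar u b) d = w2"
    using directed[OF 1(1) 2(1) 1(2) 2(2)] .
  note ucmp = set_functor_cmp[OF functor_u]
  have ga: "cmp C g1 a \<in> Hom C D V" and fb: "cmp C f2 b \<in> Hom C D V"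
    and fa: "cmp C f1 a \<in> Hom C D U" and gb: "cmp C g2 b \<in> Hom C D Z"
    using 1 2 d by (auto intro: category_cmp[OF catC])
  have "app (on_ar u (cmp C g1 a)) d = app (on_ar u (cmp C f2 b)) d"
    by (simp add: ucmp[OF d(3) 1(4) d(2)] ucmp[OF d(4) 2(3) d(2)] d 1 2)
  then obtain E e h where e: "E \<in> ob C" "e \<in> on_ob u E" "h \<in> Hom C E D" "app (on_ar u h) e = d"
    "cmp C (cmp C g1 a) h = cmp C (cmp C f2 b) h"
    using equalized[OF ga fb d(2)] by blast
  show ?thesis
  proof (rule germ_relI[OF e(2)])
    show "cmp C (cmp C f1 a) h \<in> Hom C E U" "cmp C (cmp C g2 b) h \<in> Hom C E Z"
      using fa gb e(3) by (auto intro: category_cmp[OF catC])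
    show "app (on_ar u (cmp C (cmp C f1 a) h)) e = x"
      by (simp add: ucmp[OF e(3) fa e(2)] e(4) ucmp[OF d(3) 1(3) d(2)] d(5) 1(5))
    show "app (on_ar u (cmp C (cmp C g2 b) h)) e = z"
      by (simp add: ucmp[OF e(3) gb e(2)] e(4) ucmp[OF d(4) 2(4) d(2)] d(6) 2(6))
    note fcmp = psh_cmp[OF F]
    have "app (on_ar F (cmp C (cmp C f1 a) h)) s = app (on_ar F h) (app (on_ar F a) (app (on_ar F g1) t))"
      by (simp add: fcmp[OF fa e(3) s] fcmp[OF 1(3) d(3) s] 1(7))
    also have "\<dots> = app (on_ar F (cmp C (cmp C f2 b) h)) t"
      by (simp add: e(5)[symmetric] fcmp[OF ga e(3) t] fcmp[OF 1(4) d(3) t])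
    also have "\<dots> = app (on_ar F (cmp C (cmp C g2 b) h)) r"
      by (simp add: fcmp[OF fb e(3) t] fcmp[OF 2(3) d(4) t] fcmp[OF gb e(3) r] fcmp[OF 2(4) d(4) r] 2(7))
    finally show "app (on_ar F (cmp C (cmp C f1 a) h)) s = app (on_ar F (cmp C (cmp C g2 b) h)) r" .
  qed
qed

lemma mem_point_germ:
  "(V, y, t) \<in> point_germ C u F (U, x, s) \<longleftrightarrow>
     V \<in> ob C \<and> y \<in> on_ob u V \<and> t \<in> on_ob F V \<and> germ_rel F (U, x, s) (V, y, t)"
  by (simp add: point_germ_def germ_rel_def)

lemma point_germ_eq:
  assumes F: "is_functor (opposite C) set_cat F"
    and x: "U \<in> ob C" "x \<in> on_ob u U" "s \<in> on_ob F U" and y: "V \<in> ob C" "y \<in> on_ob u V" "t \<in> on_ob F V"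
  shows "point_germ C u F (U, x, s) = point_germ C u F (V, y, t) \<longleftrightarrow> germ_rel F (U, x, s) (V, y, t)"
proof
  assume "point_germ C u F (U, x, s) = point_germ C u F (V, y, t)"
  moreover have "(V, y, t) \<in> point_germ C u F (V, y, t)"
    using y germ_rel_refl[OF y(1,2)] by (simp add: mem_point_germ)
  ultimately show "germ_rel F (U, x, s) (V, y, t)"
    by (metis mem_point_germ)
next
  assume st: "germ_rel F (U, x, s) (V, y, t)"
  have "c \<in> point_germ C u F (U, x, s) \<longleftrightarrow> c \<in> point_germ C u F (V, y, t)" for c
  proof (cases c)
    case (fields Z z r)
    have "germ_rel F (U, x, s) (Z, z, r) \<longleftrightarrow> germ_rel F (V, y, t) (Z, z, r)" if r: "r \<in> on_ob F Z"
      using germ_rel_trans[OF F x(3) y(3) r st] germ_rel_trans[OF F y(3) x(3) r germ_rel_sym[OF st]] by blast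
    then show ?thesis by (auto simp: fields mem_point_germ)
  qed
  then show "point_germ C u F (U, x, s) = point_germ C u F (V, y, t)" by blast
qed

abbreviation "stalk_ar \<equiv> on_ar (stalk_functor C u)"

text \<open>As for realizations, the union over representatives collapses: naturality turns a
  witness for two representatives into one for their images.\<close>

lemma stalk_map_point_germ:
  assumes \<eta>: "(F, \<eta>, G) \<in> ar (functor_cat (opposite C) set_cat)"
    and x: "U \<in> ob C" "x \<in> on_ob u U" "s \<in> on_ob F U"
  shows "app (stalk_ar (F, \<eta>, G)) (point_germ C u F (U, x, s)) =
    point_germ C u G (U, x, app (\<eta> U) s)"
proof -
  have F: "is_functor (opposite C) set_cat F" and G: "is_functor (opposite C) set_cat G"
    using \<eta> by (auto simp: functor_cat_ar)
  have "point_germ C u F (U, x, s) \<in> stalk_set C u F"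
    using x by (auto simp: stalk_set_def)
  then have "app (stalk_ar (F, \<eta>, G)) (point_germ C u F (U, x, s)) =
    (\<Union>c\<in>point_germ C u F (U, x, s). case c of (V, y, t) \<Rightarrow> point_germ C u G (V, y, app (\<eta> V) t))"
    by (simp add: stalk_functor_def app_def)
  also have "\<dots> = (case (U, x, s) of (V, y, t) \<Rightarrow> point_germ C u G (V, y, app (\<eta> V) t))"
  proof (rule UN_constant_eq)
    show "(U, x, s) \<in> point_germ C u F (U, x, s)"
      using x germ_rel_refl[OF x(1,2)] by (simp add: mem_point_germ)
    have "point_germ C u G (V, y, app (\<eta> V) t) = point_germ C u G (U, x, app (\<eta> U) s)"
      if "(V, y, t) \<in> point_germ C u F (U, x, s)" for V y t
    proof -
      have y: "V \<in> ob C" "y \<in> on_ob u V" "t \<in> on_ob F V" and st: "germ_rel F (U, x, s) (V, y, t)"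
        using that by (simp_all add: mem_point_germ)
      obtain W w f g where "w \<in> on_ob u W" and f: "f \<in> Hom C W U" and g: "g \<in> Hom C W V"
        and "app (on_ar u f) w = x" "app (on_ar u g) w = y" "app (on_ar F f) s = app (on_ar F g) t"
        using st by (rule germ_relE)
      with psh_map_natural[OF \<eta> f x(3)] psh_map_natural[OF \<eta> g y(3)]
      have "germ_rel G (V, y, app (\<eta> V) t) (U, x, app (\<eta> U) s)"
        by (intro germ_relI[of w W g V f U]) simp_all
      then show ?thesis
        using point_germ_eq[OF G y(1,2) psh_map_in[OF \<eta> y(1,3)] x(1,2) psh_map_in[OF \<eta> x(1,3)]] by simp
    qed
    then show "\<forall>c\<in>point_germ C u F (U, x, s). (case c of (V, y, t) \<Rightarrow> point_germ C u G (V, y, app (\<eta> V) t)) =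
      (case (U, x, s) of (V, y, t) \<Rightarrow> point_germ C u G (V, y, app (\<eta> V) t))"
      by auto
  qed
  finally show ?thesis by simp
qed

lemma stalk_setE:
  assumes "c \<in> stalk_set C u F"
  obtains U x s where "c = point_germ C u F (U, x, s)" "U \<in> ob C" "x \<in> on_ob u U" "s \<in> on_ob F U"
  using assms unfolding stalk_set_def by blast

lemma stalk_map_Hom:
  assumes \<eta>: "(F, \<eta>, G) \<in> ar (functor_cat (opposite C) set_cat)"
  shows "stalk_ar (F, \<eta>, G) \<in> Hom set_cat (stalk_set C u F) (stalk_set C u G)"
proof -
  have "app (stalk_ar (F, \<eta>, G)) c \<in> stalk_set C u G" if c: "c \<in> stalk_set C u F" for c
  proof -
    obtain U x s where x: "c = point_germ C u F (U, x, s)" "U \<in> ob C" "x \<in> on_ob u U" "s \<in> on_ob F U"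
      using c by (rule stalk_setE)
    with psh_map_in[OF \<eta> x(2,4)] show ?thesis
      unfolding x(1) stalk_map_point_germ[OF \<eta> x(2-4)] stalk_set_def by blast
  qed
  then show ?thesis
    by (simp add: stalk_functor_def Hom_set_cat app_def)
qed

text \<open>Both functor equations are checked on the germ of one section. That sheaves form a
  category is an assumption here, which the hypotheses of the theorem supply.\<close>

lemma is_functor_stalk:
  assumes "category (Sh C J :: (('o, 'a, 'v) psh, ('o, 'a, 'v) psh_map) cat)"
  shows "is_functor (Sh C J) set_cat
    (stalk_functor C u :: (('o, 'a, 'v) psh, ('o, 'a, 'v) psh_map, _, _) fctr)"
  unfolding is_functor_def
proof (intro conjI ballI impI)
  have ob: "on_ob (stalk_functor C u) F = stalk_set C u F" for F :: "('o, 'a, 'v) psh" by (simp add: stalk_functor_def)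
  show "on_ob (stalk_functor C u) F \<in> ob set_cat" for F :: "('o, 'a, 'v) psh"
    by (simp add: set_cat_def)
  show Hom: "stalk_ar \<phi> \<in> Hom set_cat (on_ob (stalk_functor C u) (src (Sh C J) \<phi>))
      (on_ob (stalk_functor C u) (tgt (Sh C J) \<phi>))"
    if "\<phi> \<in> ar (Sh C J)" for \<phi> :: "('o, 'a, 'v) psh_map"
    using that by (cases \<phi>) (simp add: Sh_ar ob stalk_map_Hom)
  show "stalk_ar (ide (Sh C J) F) = ide set_cat (on_ob (stalk_functor C u) F)"
    if F: "F \<in> ob (Sh C J)" for F :: "('o, 'a, 'v) psh"
  proof -
    have ide: "ide (Sh C J) F \<in> Hom (Sh C J) F F" by (rule category_ide[OF assms F])
    then have ide': "(F, \<lambda>U\<in>ob C. ide set_cat (on_ob F U), F) \<in> ar (functor_cat (opposite C) set_cat)"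
      by (simp add: Sh_Hom)
    show ?thesis
    proof (rule set_cat_eqI)
      show "stalk_ar (ide (Sh C J) F) \<in> Hom set_cat (stalk_set C u F) (stalk_set C u F)"
        using stalk_map_Hom[OF ide'] by simp
      show "ide set_cat (on_ob (stalk_functor C u) F) \<in> Hom set_cat (stalk_set C u F) (stalk_set C u F)"
        unfolding ob by (rule category_ide[OF category_set_cat]) (simp add: set_cat_def)
      fix c assume c: "c \<in> stalk_set C u F"
      then obtain U x s where "c = point_germ C u F (U, x, s)" "U \<in> ob C" "x \<in> on_ob u U" "s \<in> on_ob F U"
        by (rule stalk_setE)
      with c show "app (stalk_ar (ide (Sh C J) F)) c = app (ide set_cat (on_ob (stalk_functor C u) F)) c"
        by (simp add: ob app_ide stalk_map_point_germ[OF ide'])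
    qed
  qed
  show "stalk_ar (cmp (Sh C J) \<theta> \<eta>) =
      cmp set_cat (stalk_ar \<theta>) (stalk_ar \<eta>)"
    if \<eta>: "\<eta> \<in> ar (Sh C J)" and \<theta>: "\<theta> \<in> ar (Sh C J)" and eq: "src (Sh C J) \<theta> = tgt (Sh C J) \<eta>"
    for \<eta> \<theta> :: "('o, 'a, 'v) psh_map"
  proof -
    obtain F e G where e: "\<eta> = (F, e, G)" by (cases \<eta>)
    obtain d K where d: "\<theta> = (G, d, K)" using eq e by (cases \<theta>) auto
    have \<eta>': "\<eta> \<in> Hom (Sh C J) F G" and \<theta>': "\<theta> \<in> Hom (Sh C J) G K"
      using \<eta> \<theta> by (auto intro: HomI simp: e d)
    have e': "(F, e, G) \<in> ar (functor_cat (opposite C) set_cat)"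
      and d': "(G, d, K) \<in> ar (functor_cat (opposite C) set_cat)"
      using \<eta> \<theta> by (auto simp: Sh_ar e d)
    have c': "(F, \<lambda>U\<in>ob C. cmp set_cat (d U) (e U), K) \<in> ar (functor_cat (opposite C) set_cat)"
      using category_cmp[OF assms \<eta>' \<theta>'] by (simp add: Sh_Hom e d)
    show ?thesis
    proof (rule set_cat_eqI)
      show "stalk_ar (cmp (Sh C J) \<theta> \<eta>) \<in> Hom set_cat (stalk_set C u F) (stalk_set C u K)"
        using stalk_map_Hom[OF c'] by (simp add: e d)
      show "cmp set_cat (stalk_ar \<theta>) (stalk_ar \<eta>) \<in>
        Hom set_cat (stalk_set C u F) (stalk_set C u K)"
        unfolding e d by (rule category_cmp[OF category_set_cat stalk_map_Hom[OF e'] stalk_map_Hom[OF d']])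
      fix c assume c: "c \<in> stalk_set C u F"
      then obtain U x s where x: "c = point_germ C u F (U, x, s)" "U \<in> ob C" "x \<in> on_ob u U" "s \<in> on_ob F U"
        by (rule stalk_setE)
      have eU: "e U \<in> Hom set_cat (on_ob F U) (on_ob G U)"
        using e' x(2) by (simp add: functor_cat_ar)
      show "app (stalk_ar (cmp (Sh C J) \<theta> \<eta>)) c =
        app (cmp set_cat (stalk_ar \<theta>) (stalk_ar \<eta>)) c"
        unfolding e d app_cmp[OF stalk_map_Hom[OF e'] c] unfolding x(1)
        by (simp add: x(2) stalk_map_point_germ[OF c' x(2-4)] stalk_map_point_germ[OF e' x(2-4)]
            stalk_map_point_germ[OF d' x(2,3) app_in[OF eU x(4)]] app_cmp[OF eU x(4)])
    qed
  qed
qed (simp_all add: assms category_set_cat)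

end

lemma is_functor_levelwise_ob:
  assumes F: "is_functor D E F" and X: "is_functor (opposite simplex_cat) D X"
  shows "is_functor (opposite simplex_cat) E (levelwise_ob F X)"
  using assms unfolding is_functor_def levelwise_ob_def
  by (auto simp: Hom_def)

lemma levelwise_ar_Hom:
  assumes F: "is_functor D E F" and \<eta>: "(X, \<eta>, Y) \<in> ar (functor_cat (opposite simplex_cat) D)"
  shows "(levelwise_ob F X, \<lambda>n. on_ar F (\<eta> n), levelwise_ob F Y) \<in> ar (functor_cat (opposite simplex_cat) E)"
proof -
  have X: "is_functor (opposite simplex_cat) D X" and Y: "is_functor (opposite simplex_cat) D Y"
    and e: "\<And>n. \<eta> n \<in> Hom D (on_ob X n) (on_ob Y n)"
    and nat: "\<And>f. f \<in> ar simplex_cat \<Longrightarrow>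
      cmp D (\<eta> (src simplex_cat f)) (on_ar X f) = cmp D (on_ar Y f) (\<eta> (tgt simplex_cat f))"
    using \<eta> by (auto simp: functor_cat_ar)
  have "cmp E (on_ar F (\<eta> (src simplex_cat f))) (on_ar F (on_ar X f)) =
    cmp E (on_ar F (on_ar Y f)) (on_ar F (\<eta> (tgt simplex_cat f)))" if f: "f \<in> ar simplex_cat" for f
  proof -
    have f': "f \<in> Hom (opposite simplex_cat) (tgt simplex_cat f) (src simplex_cat f)"
      using f by (simp add: Hom_def)
    show ?thesis
      using nat[OF f] functor_cmp[OF F functor_Hom[OF X f'] e] functor_cmp[OF F e functor_Hom[OF Y f']] by simp
  qed
  then show ?thesis
    using is_functor_levelwise_ob[OF F X] is_functor_levelwise_ob[OF F Y] functor_Hom[OF F e]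
    by (simp add: functor_cat_ar levelwise_ob_def extensional_def)
qed

section \<open>Faithfulness of the embedding of sheaves into the homotopy category\<close>

lemma const_ob_in_sSh:
  fixes X :: "('o, 'a, 'v) psh"
  assumes "category (opposite simplex_cat)"
    and "category (Sh C J :: (('o, 'a, 'v) psh, ('o, 'a, 'v) psh_map) cat)"
    and "X \<in> ob (Sh C J)"
  shows "const_ob C J X \<in> ob (sSh C J)"
proof -
  note ide = category_ide[OF assms(2,3)]
  have "cmp (Sh C J) (ide (Sh C J) X) (ide (Sh C J) X) = ide (Sh C J) X"
    by (rule category_cmp_ide(1)[OF assms(2) ide])
  then have "is_functor (opposite simplex_cat) (Sh C J) (const_ob C J X)"
    using assms ide unfolding is_functor_def const_ob_def
    by (simp del: Sh_simps)
  then show ?thesis by (simp add: sSh_def)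
qed

lemma const_ar_Hom:
  fixes f :: "('o, 'a, 'v) psh_map"
  assumes "category (opposite simplex_cat)"
    and "category (Sh C J :: (('o, 'a, 'v) psh, ('o, 'a, 'v) psh_map) cat)"
    and "f \<in> Hom (Sh C J) X Y"
  shows "const_ar C J f \<in> Hom (sSh C J) (const_ob C J X) (const_ob C J Y)"
proof -
  note ob = Hom_ob[OF assms(2,3)]
  have "cmp (Sh C J) f (ide (Sh C J) X) = cmp (Sh C J) (ide (Sh C J) Y) f"
    by (simp only: category_cmp_ide[OF assms(2,3)])
  then have "(const_ob C J X, \<lambda>_. f, const_ob C J Y) \<in> ar (functor_cat (opposite simplex_cat) (Sh C J))"
    using const_ob_in_sSh[OF assms(1,2) ob(1)] const_ob_in_sSh[OF assms(1,2) ob(2)] assms(3)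
    unfolding functor_cat_ar by (simp del: Sh_simps add: sSh_def const_ob_def)
  moreover have "const_ar C J f = (const_ob C J X, \<lambda>_. f, const_ob C J Y)"
    unfolding const_ar_def HomD[OF assms(3)] ..
  ultimately show ?thesis by (simp add: sSh_Hom)
qed

context topos_point
begin

definition stalk_space :: "('o, 'a, 'v) spsh \<Rightarrow> (nat \<times> ('o \<times> 'a set \<times> 'v) set \<times> (nat \<Rightarrow> real)) set topology" where
  "stalk_space X = realization (levelwise_ob (stalk_functor C u) X)"

definition stalk_pullback where
  "stalk_pullback \<phi> = preimage_in (stalk_space (fst \<phi>)) (realization_map (levelwise_ar (stalk_functor C u) \<phi>))"

text \<open>All conditions but one are formal. The exception is that weak equivalences are inverted:
  at a point of the topos such a map is by definition a homotopy equivalence of the realized stalks,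
  and those are bijective on clopen subsets.\<close>

lemma stalk_localized_functor:
  assumes sSh: "category (sSh C J :: (('o, 'a, 'v) spsh, ('o, 'a, 'v) spsh_map) cat)"
    and Sh: "category (Sh C J :: (('o, 'a, 'v) psh, ('o, 'a, 'v) psh_map) cat)"
  shows "localized_functor (sSh C J :: (('o, 'a, 'v) spsh, ('o, 'a, 'v) spsh_map) cat)
    (simplicial_weq C J) (\<lambda>X. clopens (stalk_space X)) stalk_pullback"
proof
  note st = is_functor_stalk[OF Sh]
  let ?L = "levelwise_ob (stalk_functor C u) :: ('o, 'a, 'v) spsh \<Rightarrow> _"
  let ?l = "levelwise_ar (stalk_functor C u) :: ('o, 'a, 'v) spsh_map \<Rightarrow> _"
  have l: "?l (X, \<eta>, Y) = (?L X, \<lambda>n. on_ar (stalk_functor C u) (\<eta> n), ?L Y)" for X \<eta> Y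
    by (simp add: levelwise_ar_def)
  have ar: "?l (X, \<eta>, Y) \<in> ar (functor_cat (opposite simplex_cat) set_cat)"
    if "(X, \<eta>, Y) \<in> ar (functor_cat (opposite simplex_cat) (Sh C J))" for X \<eta> Y
    unfolding l by (rule levelwise_ar_Hom[OF st that])
  have cont: "continuous_map (stalk_space X) (stalk_space Y) (realization_map (?l (X, \<eta>, Y)))"
    if "(X, \<eta>, Y) \<in> ar (functor_cat (opposite simplex_cat) (Sh C J))" for X \<eta> Y
    unfolding stalk_space_def l by (rule continuous_map_realization[OF ar[OF that, unfolded l]])
  show "category (sSh C J :: (('o, 'a, 'v) spsh, ('o, 'a, 'v) spsh_map) cat)" by (rule sSh)
  show "stalk_pullback f U \<in> clopens (stalk_space X)"
    if "f \<in> Hom (sSh C J) X Y" "U \<in> clopens (stalk_space Y)" for f :: "('o, 'a, 'v) spsh_map" and X Y U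
    using that preimage_in_clopens[OF cont] by (auto simp: sSh_Hom stalk_pullback_def)
  show "stalk_pullback (ide (sSh C J) X) U = U"
    if X: "X \<in> ob (sSh C J)" and U: "U \<in> clopens (stalk_space X)" for X :: "('o, 'a, 'v) spsh" and U
  proof -
    let ?\<eta> = "\<lambda>n. ide (Sh C J) (on_ob X n)"
    \<comment> \<open>The objects of the simplex category are all natural numbers, so the
      extensional restriction of the components disappears.\<close>
    have eq: "ide (sSh C J) X = (X, ?\<eta>, X)"
      by (simp add: sSh_def restrict_def del: Sh_simps)
    have \<eta>: "(X, ?\<eta>, X) \<in> ar (functor_cat (opposite simplex_cat) (Sh C J))"
      using category_ide[OF sSh X] by (simp add: sSh_Hom eq del: Sh_simps)
    have X': "on_ob X n \<in> ob (Sh C J)" for n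
      using X by (simp add: sSh_def is_functor_def)
    have "realization_map (?l (X, ?\<eta>, X)) c = c" if "c \<in> topspace (stalk_space X)" for c
      unfolding l
    proof (rule realization_map_ide)
      show "c \<in> topspace (realization (?L X))" using that by (simp add: stalk_space_def)
      show "(?L X, \<lambda>n. on_ar (stalk_functor C u) (?\<eta> n), ?L X) \<in> ar (functor_cat (opposite simplex_cat) set_cat)"
        using ar[OF \<eta>] unfolding l .
      show "app (on_ar (stalk_functor C u) (?\<eta> n)) x = x" if "x \<in> on_ob (?L X) n" for n x
        using that unfolding functor_ide[OF st X'] by (intro app_ide) (simp add: levelwise_ob_def)
    qed
    then show ?thesis
      using clopens_subset_topspace[OF U] unfolding eq by (auto simp: stalk_pullback_def preimage_in_def)
  qed
  show "stalk_pullback (cmp (sSh C J) g f) U = stalk_pullback f (stalk_pullback g U)"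
    if f: "f \<in> Hom (sSh C J) X Y" and g: "g \<in> Hom (sSh C J) Y Z" and U: "U \<in> clopens (stalk_space Z)"
    for f g :: "('o, 'a, 'v) spsh_map" and X Y Z U
  proof -
    obtain \<eta> where f': "f = (X, \<eta>, Y)" and \<eta>: "(X, \<eta>, Y) \<in> ar (functor_cat (opposite simplex_cat) (Sh C J))"
      using f by (auto simp: sSh_Hom)
    obtain \<theta> where g': "g = (Y, \<theta>, Z)" and \<theta>: "(Y, \<theta>, Z) \<in> ar (functor_cat (opposite simplex_cat) (Sh C J))"
      using g by (auto simp: sSh_Hom)
    let ?\<zeta> = "\<lambda>n. cmp (Sh C J) (\<theta> n) (\<eta> n)"
    have gf: "cmp (sSh C J) (Y, \<theta>, Z) (X, \<eta>, Y) = (X, ?\<zeta>, Z)"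
      by (simp add: sSh_def restrict_def del: Sh_simps)
    have \<zeta>: "(X, ?\<zeta>, Z) \<in> ar (functor_cat (opposite simplex_cat) (Sh C J))"
      using category_cmp[OF sSh f g] by (simp add: sSh_Hom f' g' gf del: Sh_simps)
    have \<eta>n: "\<eta> n \<in> Hom (Sh C J) (on_ob X n) (on_ob Y n)"
      and \<theta>n: "\<theta> n \<in> Hom (Sh C J) (on_ob Y n) (on_ob Z n)" for n
      using \<eta> \<theta> by (simp_all add: functor_cat_ar)
    have "realization_map (?l (X, ?\<zeta>, Z)) c = realization_map (?l (Y, \<theta>, Z)) (realization_map (?l (X, \<eta>, Y)) c)"
      if "c \<in> topspace (stalk_space X)" for c
      unfolding l
    proof (rule realization_map_cmp)
      show "c \<in> topspace (realization (?L X))" using that by (simp add: stalk_space_def)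
      show "app (on_ar (stalk_functor C u) (?\<zeta> n)) x =
        app (on_ar (stalk_functor C u) (\<theta> n)) (app (on_ar (stalk_functor C u) (\<eta> n)) x)"
        if x: "x \<in> on_ob (?L X) n" for n x
        unfolding functor_cmp[OF st \<eta>n \<theta>n]
        by (rule app_cmp[OF functor_Hom[OF st \<eta>n]]) (use x in \<open>simp add: levelwise_ob_def\<close>)
    qed (use ar[OF \<eta>] ar[OF \<theta>] ar[OF \<zeta>] in \<open>simp_all only: l\<close>)
    then show ?thesis
      using continuous_map_image_subset_topspace[OF cont[OF \<eta>]]
      unfolding f' g' gf by (auto simp: stalk_pullback_def preimage_in_def simp del: Sh_simps)
  qed
  show "bij_betw (stalk_pullback w) (clopens (stalk_space Y)) (clopens (stalk_space X))"
    if w: "w \<in> simplicial_weq C J" "w \<in> Hom (sSh C J) X Y" for w :: "('o, 'a, 'v) spsh_map" and X Y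
  proof -
    obtain \<eta> where w': "w = (X, \<eta>, Y)"
      using w(2) by (auto simp: sSh_Hom)
    have "sset_weq (?l w)"
      using w(1) is_point by (simp add: simplicial_weq_def)
    then have "homotopy_equivalence (stalk_space X) (stalk_space Y) (realization_map (?l w))"
      by (simp add: sset_weq_def w' l stalk_space_def)
    from homotopy_equivalence_clopens[OF this] show ?thesis
      by (simp add: stalk_pullback_def w')
  qed
  show "simplicial_weq C J \<subseteq> ar (sSh C J :: (('o, 'a, 'v) spsh, ('o, 'a, 'v) spsh_map) cat)"
    by (auto simp: simplicial_weq_def)
qed

text \<open>Equality in the homotopy category only yields equal pullbacks of clopen subsets of the
  realized stalks. Constant simplicial sheaves have constant stalks, whose clopen subsets separate
  elements, so this recovers the stalk map in degree 0.\<close>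

lemma stalk_eq_if_to_Hs_eq:
  fixes f g :: "('o, 'a, 'v) psh_map"
  assumes sSh: "category (sSh C J :: (('o, 'a, 'v) spsh, ('o, 'a, 'v) spsh_map) cat)"
    and simplex: "category (opposite simplex_cat)"
    and Sh: "category (Sh C J :: (('o, 'a, 'v) psh, ('o, 'a, 'v) psh_map) cat)"
    and f: "f \<in> Hom (Sh C J) X Y" and g: "g \<in> Hom (Sh C J) X Y"
    and eq: "to_Hs C J (const_ar C J f) = to_Hs C J (const_ar C J g)"
    and c: "c \<in> stalk_set C u X"
  shows "app (on_ar (stalk_functor C u) f) c = app (on_ar (stalk_functor C u) g) c"
proof -
  let ?st = "stalk_functor C u :: (('o, 'a, 'v) psh, ('o, 'a, 'v) psh_map, _, _) fctr"
  note st = is_functor_stalk[OF Sh]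
  note ob = Hom_ob[OF Sh f]
  let ?X = "levelwise_ob ?st (const_ob C J X)" and ?Y = "levelwise_ob ?st (const_ob C J Y)"
  have l: "const_ar C J h = (const_ob C J X, \<lambda>_. h, const_ob C J Y)"
      "(?X, \<lambda>n. on_ar ?st h, ?Y) \<in> ar (functor_cat (opposite simplex_cat) set_cat)"
    if h: "h \<in> Hom (Sh C J) X Y" for h
  proof -
    show eq: "const_ar C J h = (const_ob C J X, \<lambda>_. h, const_ob C J Y)"
      unfolding const_ar_def HomD[OF h] ..
    have "(const_ob C J X, \<lambda>_. h, const_ob C J Y) \<in> ar (functor_cat (opposite simplex_cat) (Sh C J))"
      using const_ar_Hom[OF simplex Sh h] by (simp add: eq sSh_Hom)
    from levelwise_ar_Hom[OF st this]
    show "(?X, \<lambda>n. on_ar ?st h, ?Y) \<in> ar (functor_cat (opposite simplex_cat) set_cat)" .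
  qed
  \<comment> \<open>The stalk functor preserves the identities that serve as structure maps of the
    constant object.\<close>
  have Y: "?Y = \<lparr>on_ob = \<lambda>_. on_ob ?st Y, on_ar = \<lambda>_. ide set_cat (on_ob ?st Y)\<rparr>"
    unfolding levelwise_ob_def const_ob_def using functor_ide[OF st ob(2)] by (simp del: Sh_simps)
  interpret localized_functor "sSh C J" "simplicial_weq C J :: ('o, 'a, 'v) spsh_map set"
    "\<lambda>X. clopens (stalk_space X)" stalk_pullback
    by (rule stalk_localized_functor[OF sSh Sh])
  show ?thesis
  proof (rule constant_sset_separated[OF Y l(2)[OF f] l(2)[OF g]])
    fix U assume U: "U \<in> clopens (realization ?Y)"
    have "stalk_pullback (const_ar C J f) U = stalk_pullback (const_ar C J g) U"
      using act_eq_if_loc_ar_eq[OF eq[unfolded to_Hs_def] const_ar_Hom[OF simplex Sh f] const_ar_Hom[OF simplex Sh g]] U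
      by (simp add: stalk_space_def)
    then show "preimage_in (realization ?X) (realization_map (?X, \<lambda>n. on_ar ?st f, ?Y)) U =
      preimage_in (realization ?X) (realization_map (?X, \<lambda>n. on_ar ?st g, ?Y)) U"
      by (simp add: stalk_pullback_def l(1)[OF f] l(1)[OF g] stalk_space_def levelwise_ar_def)
  next
    show "c \<in> on_ob ?X 0" using c by (simp add: levelwise_ob_def const_ob_def stalk_functor_def)
  qed
qed

end

section \<open>Separatedness of sheaves and equalizers of sheaf maps\<close>

lemma is_sheafD:
  assumes "is_sheaf C J F" "U \<in> ob C" "S \<in> J U"
    and "\<And>f. f \<in> S \<Longrightarrow> s f \<in> on_ob F (src C f)"
    and "\<And>f g. f \<in> S \<Longrightarrow> g \<in> ar C \<Longrightarrow> tgt C g = src C f \<Longrightarrow> app (on_ar F g) (s f) = s (cmp C f g)"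
  shows "\<exists>!t. t \<in> on_ob F U \<and> (\<forall>f\<in>S. app (on_ar F f) t = s f)"
  by (rule assms(1)[unfolded is_sheaf_def, rule_format, OF assms(2,3)]) (use assms(4,5) in blast)

text \<open>Both sections amalgamate the same compatible family, the restrictions of
  \<open>s\<close>, and amalgamations are unique.\<close>

lemma sheaf_separated:
  assumes F: "is_functor (opposite C) set_cat F" "is_sheaf C J F"
    and S: "U \<in> ob C" "S \<in> J U" "sieve C U S"
    and s: "s \<in> on_ob F U" and t: "t \<in> on_ob F U"
    and eq: "\<And>f. f \<in> S \<Longrightarrow> app (on_ar F f) s = app (on_ar F f) t"
  shows "s = t"
proof -
  let ?s = "\<lambda>f. app (on_ar F f) s"
  have S': "f \<in> Hom C (src C f) U" if "f \<in> S" for f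
    using S(3) that by (auto simp: sieve_def Hom_def)
  have "app (on_ar F g) (?s f) = ?s (cmp C f g)" if "f \<in> S" "g \<in> ar C" "tgt C g = src C f" for f g
    using psh_cmp[OF F(1) S'[OF that(1)] _ s, of g "src C g"] that by (simp add: Hom_def)
  moreover have "?s f \<in> on_ob F (src C f)" if "f \<in> S" for f
    by (rule psh_in[OF F(1) S'[OF that] s])
  ultimately have "\<exists>!t. t \<in> on_ob F U \<and> (\<forall>f\<in>S. app (on_ar F f) t = ?s f)"
    by (intro is_sheafD[OF F(2) S(1,2)])
  with s t eq show ?thesis by metis
qed

lemma is_iso_set_catI:
  assumes h: "h \<in> Hom set_cat A B" and bij: "bij_betw (app h) A B"
  shows "is_iso set_cat h"
proof -
  let ?k = "(B, \<lambda>y\<in>B. inv_into A (app h) y, A)"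
  have k: "?k \<in> Hom set_cat B A"
    using bij_betw_inv_into[OF bij] by (auto simp: Hom_set_cat bij_betw_def)
  have ide: "ide set_cat S \<in> Hom set_cat S S" for S :: "'a set"
    by (auto simp: set_cat_def Hom_def)
  have "cmp set_cat ?k h = ide set_cat A"
  proof (rule set_cat_eqI[OF category_cmp[OF category_set_cat h k] ide])
    show "app (cmp set_cat ?k h) x = app (ide set_cat A) x" if x: "x \<in> A" for x
      unfolding app_cmp[OF h x] app_ide[OF x]
      using app_in[OF h x] bij_betw_inv_into_left[OF bij x] by (simp add: app_def)
  qed
  moreover have "cmp set_cat h ?k = ide set_cat B"
  proof (rule set_cat_eqI[OF category_cmp[OF category_set_cat k h] ide])
    show "app (cmp set_cat h ?k) y = app (ide set_cat B) y" if y: "y \<in> B" for y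
      unfolding app_cmp[OF k y] app_ide[OF y]
      using bij_betw_inv_into_right[OF bij y] y by (simp add: app_def)
  qed
  ultimately show ?thesis
    using HomD[OF h] k unfolding is_iso_def by auto
qed

text \<open>The maps are cut down to the subsets so that they are arrows of \<open>set_cat\<close>;
  \<open>E (tgt C g)\<close> stands in the source position because presheaves are functors on the
  opposite category.\<close>

definition equalizer where
  "equalizer C X \<phi> \<gamma> = (let E = \<lambda>U. {s \<in> on_ob X U. app (\<phi> U) s = app (\<gamma> U) s} in
     \<lparr>on_ob = E, on_ar = \<lambda>g. (E (tgt C g), \<lambda>s\<in>E (tgt C g). app (on_ar X g) s, E (src C g))\<rparr>)"

lemma is_functor_equalizer:
  assumes \<phi>: "(X, \<phi>, Y) \<in> ar (functor_cat (opposite C) set_cat)"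
    and \<gamma>: "(X, \<gamma>, Y) \<in> ar (functor_cat (opposite C) set_cat)"
  defines "E \<equiv> equalizer C X \<phi> \<gamma>"
  shows "is_functor (opposite C) set_cat E"
    and "(E, \<lambda>U\<in>ob C. (on_ob E U, \<lambda>s\<in>on_ob E U. s, on_ob X U), X) \<in> ar (functor_cat (opposite C) set_cat)"
proof -
  have X: "is_functor (opposite C) set_cat X" using \<phi> by (simp add: functor_cat_ar)
  then have C: "category C"
    using category_opposite[of "opposite C"] by (simp add: is_functor_def)
  have in_E: "s \<in> on_ob E U \<longleftrightarrow> s \<in> on_ob X U \<and> app (\<phi> U) s = app (\<gamma> U) s" for s U
    by (simp add: E_def equalizer_def Let_def)
  \<comment> \<open>Naturality of both maps preserves the defining equation under
    restriction.\<close>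
  have res: "app (on_ar X g) s \<in> on_ob E V" if g: "g \<in> Hom C V U" and s: "s \<in> on_ob E U" for g s U V
    using s psh_in[OF X g] psh_map_natural[OF \<phi> g] psh_map_natural[OF \<gamma> g] by (simp add: in_E)
  have ar: "on_ar E g = (on_ob E U, \<lambda>s\<in>on_ob E U. app (on_ar X g) s, on_ob E V)"
    if "g \<in> Hom C V U" for g U V
    using HomD[OF that] by (simp add: E_def equalizer_def Let_def)
  have Hom: "on_ar E g \<in> Hom set_cat (on_ob E U) (on_ob E V)" if g: "g \<in> Hom C V U" for g U V
    unfolding ar[OF g] Hom_set_cat using res[OF g] by simp
  have app: "app (on_ar E g) s = app (on_ar X g) s" if g: "g \<in> Hom C V U" and s: "s \<in> on_ob E U" for g s U V
    unfolding ar[OF g] using s by (simp add: app_def)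
  have ide_Hom: "ide set_cat S \<in> Hom set_cat S S" for S :: "'c set"
    by (auto simp: set_cat_def Hom_def)
  show fE: "is_functor (opposite C) set_cat E"
    unfolding is_functor_def
  proof (intro conjI ballI impI)
    show "category (opposite C)" by (rule category_opposite[OF C])
    show "category set_cat" by (rule category_set_cat)
    show "on_ob E U \<in> ob set_cat" for U by (simp add: set_cat_def)
    show "on_ar E g \<in> Hom set_cat (on_ob E (src (opposite C) g)) (on_ob E (tgt (opposite C) g))"
      if "g \<in> ar (opposite C)" for g
      using Hom[of g "src C g" "tgt C g"] that by (simp add: Hom_def[of C])
    show "on_ar E (ide (opposite C) U) = ide set_cat (on_ob E U)" if U: "U \<in> ob (opposite C)" for U
    proof (rule set_cat_eqI[OF _ ide_Hom])
      have i: "ide C U \<in> Hom C U U" using category_ide[OF C] U by simp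
      show "on_ar E (ide (opposite C) U) \<in> Hom set_cat (on_ob E U) (on_ob E U)"
        using Hom[OF i] by simp
      show "app (on_ar E (ide (opposite C) U)) s = app (ide set_cat (on_ob E U)) s" if s: "s \<in> on_ob E U" for s
        using app[OF i s] psh_ide[OF X, of U s] U s by (simp add: app_ide in_E)
    qed
    show "on_ar E (cmp (opposite C) h g) = cmp set_cat (on_ar E h) (on_ar E g)"
      if gh: "g \<in> ar (opposite C)" "h \<in> ar (opposite C)" "src (opposite C) h = tgt (opposite C) g" for g h
    proof (rule set_cat_eqI)
      have g: "g \<in> Hom C (src C g) (tgt C g)" and h: "h \<in> Hom C (src C h) (src C g)"
        using gh by (simp_all add: Hom_def)
      have c: "cmp C g h \<in> Hom C (src C h) (tgt C g)" by (rule category_cmp[OF C h g])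
      show "on_ar E (cmp (opposite C) h g) \<in> Hom set_cat (on_ob E (tgt C g)) (on_ob E (src C h))"
        using Hom[OF c] by simp
      show "cmp set_cat (on_ar E h) (on_ar E g) \<in> Hom set_cat (on_ob E (tgt C g)) (on_ob E (src C h))"
        by (rule category_cmp[OF category_set_cat Hom[OF g] Hom[OF h]])
      show "app (on_ar E (cmp (opposite C) h g)) s = app (cmp set_cat (on_ar E h) (on_ar E g)) s"
        if s: "s \<in> on_ob E (tgt C g)" for s
        unfolding app_cmp[OF Hom[OF g] s] app[OF g s] app[OF h res[OF g s]]
        using app[OF c s] psh_cmp[OF X g h, of s] s by (simp add: in_E)
    qed
  qed
  let ?i = "\<lambda>U\<in>ob C. (on_ob E U, \<lambda>s\<in>on_ob E U. s, on_ob X U)"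
  have i: "?i U \<in> Hom set_cat (on_ob E U) (on_ob X U)" "\<And>s. s \<in> on_ob E U \<Longrightarrow> app (?i U) s = s"
    if "U \<in> ob C" for U
    using that by (auto simp: Hom_set_cat in_E app_def)
  show "(E, ?i, X) \<in> ar (functor_cat (opposite C) set_cat)"
    unfolding functor_cat_ar
  proof (intro conjI ballI)
    show "?i U \<in> Hom set_cat (on_ob E U) (on_ob X U)" if "U \<in> ob (opposite C)" for U
      using i(1) that by (simp only: opposite_simps)
    show "cmp set_cat (?i (tgt (opposite C) g)) (on_ar E g) = cmp set_cat (on_ar X g) (?i (src (opposite C) g))"
      if "g \<in> ar (opposite C)" for g
    proof (rule set_cat_eqI)
      have g: "g \<in> Hom C (src C g) (tgt C g)" using that by (simp add: Hom_def)
      note ob = Hom_ob[OF C g]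
      have Xg: "on_ar X g \<in> Hom set_cat (on_ob X (tgt C g)) (on_ob X (src C g))"
        using functor_Hom[OF X, of g] g by simp
      show "cmp set_cat (?i (tgt (opposite C) g)) (on_ar E g) \<in> Hom set_cat (on_ob E (tgt C g)) (on_ob X (src C g))"
        unfolding opposite_simps by (rule category_cmp[OF category_set_cat Hom[OF g] i(1)[OF ob(1)]])
      show "cmp set_cat (on_ar X g) (?i (src (opposite C) g)) \<in> Hom set_cat (on_ob E (tgt C g)) (on_ob X (src C g))"
        unfolding opposite_simps by (rule category_cmp[OF category_set_cat i(1)[OF ob(2)] Xg])
      show "app (cmp set_cat (?i (tgt (opposite C) g)) (on_ar E g)) s =
        app (cmp set_cat (on_ar X g) (?i (src (opposite C) g))) s" if s: "s \<in> on_ob E (tgt C g)" for s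
        unfolding opposite_simps app_cmp[OF Hom[OF g] s] app_cmp[OF i(1)[OF ob(2)] s] app[OF g s]
          i(2)[OF ob(1) res[OF g s]] i(2)[OF ob(2) s] ..
    qed
  qed (use fE X in \<open>simp_all\<close>)
qed

text \<open>A compatible family in the equalizer is glued in \<open>X\<close>. The images of the
  result under \<open>\<phi>\<close> and \<open>\<gamma>\<close> agree on the covering sieve, hence
  agree, because \<open>Y\<close> is separated; so the glued section lies in the equalizer
  again.\<close>

lemma is_sheaf_equalizer:
  assumes \<phi>: "(X, \<phi>, Y) \<in> ar (functor_cat (opposite C) set_cat)"
    and \<gamma>: "(X, \<gamma>, Y) \<in> ar (functor_cat (opposite C) set_cat)"
    and X: "is_sheaf C J X" and Y: "is_sheaf C J Y"
    and sieves: "\<And>U S. U \<in> ob C \<Longrightarrow> S \<in> J U \<Longrightarrow> sieve C U S"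
    and E: "\<And>U. on_ob E U = {s \<in> on_ob X U. app (\<phi> U) s = app (\<gamma> U) s}"
    and res: "\<And>U V g s. g \<in> Hom C V U \<Longrightarrow> s \<in> on_ob E U \<Longrightarrow> app (on_ar E g) s = app (on_ar X g) s"
  shows "is_sheaf C J E"
  unfolding is_sheaf_def
proof (intro ballI allI impI)
  fix U S s assume U: "U \<in> ob C" and S: "S \<in> J U"
    and s: "(\<forall>f\<in>S. s f \<in> on_ob E (src C f)) \<and>
      (\<forall>f\<in>S. \<forall>g\<in>ar C. tgt C g = src C f \<longrightarrow> app (on_ar E g) (s f) = s (cmp C f g))"
  have S_Hom: "f \<in> Hom C (src C f) U" if "f \<in> S" for f
    using sieves[OF U S] that by (auto simp: sieve_def Hom_def)
  have fY: "is_functor (opposite C) set_cat Y" using \<phi> by (simp add: functor_cat_ar)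
  have "s f \<in> on_ob X (src C f)" if "f \<in> S" for f
    using s that by (simp add: E)
  moreover have "app (on_ar X g) (s f) = s (cmp C f g)" if "f \<in> S" "g \<in> ar C" "tgt C g = src C f" for f g
    using s that res[of g "src C g" "src C f" "s f"] by (simp add: Hom_def)
  ultimately have ex1: "\<exists>!t. t \<in> on_ob X U \<and> (\<forall>f\<in>S. app (on_ar X f) t = s f)"
    by (intro is_sheafD[OF X U S])
  then obtain t where t: "t \<in> on_ob X U" "\<And>f. f \<in> S \<Longrightarrow> app (on_ar X f) t = s f" by blast
  have "app (\<phi> U) t = app (\<gamma> U) t"
  proof (rule sheaf_separated[OF fY Y U S sieves[OF U S] psh_map_in[OF \<phi> U t(1)] psh_map_in[OF \<gamma> U t(1)]])
    fix f assume f: "f \<in> S"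
    have "app (\<phi> (src C f)) (s f) = app (\<gamma> (src C f)) (s f)" using s f by (simp add: E)
    then show "app (on_ar Y f) (app (\<phi> U) t) = app (on_ar Y f) (app (\<gamma> U) t)"
      using psh_map_natural[OF \<phi> S_Hom[OF f] t(1)] psh_map_natural[OF \<gamma> S_Hom[OF f] t(1)] t(2)[OF f] by simp
  qed
  with t(1) have tE: "t \<in> on_ob E U" by (simp add: E)
  show "\<exists>!t. t \<in> on_ob E U \<and> (\<forall>f\<in>S. app (on_ar E f) t = s f)"
  proof (rule ex1I[of _ t])
    show "t \<in> on_ob E U \<and> (\<forall>f\<in>S. app (on_ar E f) t = s f)"
      using tE t(2) res[OF S_Hom tE] by simp
    fix t' assume t': "t' \<in> on_ob E U \<and> (\<forall>f\<in>S. app (on_ar E f) t' = s f)"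
    then have "t' \<in> on_ob X U \<and> (\<forall>f\<in>S. app (on_ar X f) t' = s f)"
      using res[OF S_Hom, of _ t'] by (simp add: E)
    with ex1 t show "t' = t" by blast
  qed
qed

text \<open>
  Where \<open>f\<close> and \<open>g\<close> have the same stalks, the inclusion of their equalizer into the source is an
  isomorphism on stalks; as the stalk functors are conservative, the equalizer is everything.
\<close>

lemma enough_points_faithful:
  fixes f g :: "('o, 'a, 'v) psh_map"
  assumes points: "enough_points TYPE('v) C J"
    and sieves: "\<And>U S. U \<in> ob C \<Longrightarrow> S \<in> J U \<Longrightarrow> sieve C U S"
    and f: "f \<in> Hom (Sh C J) X Y" and g: "g \<in> Hom (Sh C J) X Y"
    and eq: "\<And>u c. is_point C J u \<Longrightarrow> c \<in> stalk_set C u X \<Longrightarrow>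
      app (on_ar (stalk_functor C u) f) c = app (on_ar (stalk_functor C u) g) c"
  shows "f = g"
proof -
  obtain \<phi> where \<phi>: "f = (X, \<phi>, Y)" "(X, \<phi>, Y) \<in> ar (functor_cat (opposite C) set_cat)"
    and X: "is_sheaf C J X" and Y: "is_sheaf C J Y"
    using f by (auto simp: Sh_Hom)
  obtain \<gamma> where \<gamma>: "g = (X, \<gamma>, Y)" "(X, \<gamma>, Y) \<in> ar (functor_cat (opposite C) set_cat)"
    using g by (auto simp: Sh_Hom)
  have fX: "is_functor (opposite C) set_cat X" and fY: "is_functor (opposite C) set_cat Y"
    using \<phi>(2) by (simp_all add: functor_cat_ar)
  then have C: "category C"
    using category_opposite[of "opposite C"] by (simp add: is_functor_def)
  define E where "E = equalizer C X \<phi> \<gamma>"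
  note fE = is_functor_equalizer(1)[OF \<phi>(2) \<gamma>(2), folded E_def]
  define i where "i = (\<lambda>U\<in>ob C. (on_ob E U, \<lambda>s\<in>on_ob E U. s, on_ob X U))"
  have i: "(E, i, X) \<in> ar (functor_cat (opposite C) set_cat)"
    unfolding i_def by (rule is_functor_equalizer(2)[OF \<phi>(2) \<gamma>(2), folded E_def])
  have in_E: "on_ob E U = {s \<in> on_ob X U. app (\<phi> U) s = app (\<gamma> U) s}" for U
    by (simp add: E_def equalizer_def Let_def)
  have app_i: "app (i U) s = s" if "U \<in> ob C" "s \<in> on_ob E U" for U s
    using that by (simp add: i_def app_def)
  have res: "app (on_ar E g) s = app (on_ar X g) s" if g: "g \<in> Hom C V U" and s: "s \<in> on_ob E U" for g s U V
    using psh_map_natural[OF i g s] Hom_ob[OF C g] s psh_in[OF fE g s] by (simp add: app_i)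
  have E: "is_sheaf C J E"
    by (rule is_sheaf_equalizer[OF \<phi>(2) \<gamma>(2) X Y sieves in_E res])
  have iso: "is_iso set_cat (on_ar (stalk_functor C u) (E, i, X))" if u: "is_point C J u" for u
  proof -
    interpret topos_point C J u by standard (rule C u)+
    show ?thesis
    proof (rule is_iso_set_catI[OF stalk_map_Hom[OF i]], unfold bij_betw_def, intro conjI)
      let ?h = "app (on_ar (stalk_functor C u) (E, i, X))"
      have h: "?h (point_germ C u E (U, x, s)) = point_germ C u X (U, x, s)" and sX: "s \<in> on_ob X U"
        if "U \<in> ob C" "x \<in> on_ob u U" "s \<in> on_ob E U" for U x s
        using stalk_map_point_germ[OF i that] app_i that by (simp_all add: in_E)
      show "inj_on ?h (stalk_set C u E)"
      proof (rule inj_onI)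
        fix c d assume cd: "c \<in> stalk_set C u E" "d \<in> stalk_set C u E" and hcd: "?h c = ?h d"
        obtain U x s where c: "c = point_germ C u E (U, x, s)" and x: "U \<in> ob C" "x \<in> on_ob u U" "s \<in> on_ob E U"
          using cd(1) by (rule stalk_setE)
        obtain V y t where d: "d = point_germ C u E (V, y, t)" and y: "V \<in> ob C" "y \<in> on_ob u V" "t \<in> on_ob E V"
          using cd(2) by (rule stalk_setE)
        have "germ_rel X (U, x, s) (V, y, t)"
          using hcd h[OF x] h[OF y] point_germ_eq[OF fX x(1,2) sX[OF x] y(1,2) sX[OF y]] by (simp add: c d)
        then obtain W w a b where w: "W \<in> ob C" "w \<in> on_ob u W" "a \<in> Hom C W U" "b \<in> Hom C W V"
          "app (on_ar u a) w = x" "app (on_ar u b) w = y" "app (on_ar X a) s = app (on_ar X b) t"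
          by (rule germ_relE)
        \<comment> \<open>Restrictions in the equalizer are those of \<open>X\<close>, so the
          witness in \<open>X\<close> is one in \<open>E\<close>.\<close>
        have "germ_rel E (U, x, s) (V, y, t)"
          by (rule germ_relI[OF w(2-6)]) (simp add: res[OF w(3) x(3)] res[OF w(4) y(3)] w(7))
        then show "c = d"
          unfolding c d point_germ_eq[OF fE x y] .
      qed
      show "?h ` stalk_set C u E = stalk_set C u X"
      proof (intro equalityI subsetI)
        fix c assume "c \<in> ?h ` stalk_set C u E"
        then show "c \<in> stalk_set C u X" using app_in[OF stalk_map_Hom[OF i]] by auto
      next
        fix c assume c_in: "c \<in> stalk_set C u X"
        then obtain U x s where c: "c = point_germ C u X (U, x, s)" and x: "U \<in> ob C" "x \<in> on_ob u U" "s \<in> on_ob X U"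
          by (rule stalk_setE)
        have "point_germ C u Y (U, x, app (\<phi> U) s) = point_germ C u Y (U, x, app (\<gamma> U) s)"
          using eq[OF u c_in] unfolding \<phi>(1) \<gamma>(1) c stalk_map_point_germ[OF \<phi>(2) x] stalk_map_point_germ[OF \<gamma>(2) x] .
        then have "germ_rel Y (U, x, app (\<phi> U) s) (U, x, app (\<gamma> U) s)"
          using point_germ_eq[OF fY x(1,2) psh_map_in[OF \<phi>(2) x(1,3)] x(1,2) psh_map_in[OF \<gamma>(2) x(1,3)]] by simp
        then obtain W w a b where w: "W \<in> ob C" "w \<in> on_ob u W" "a \<in> Hom C W U" "b \<in> Hom C W U"
          "app (on_ar u a) w = x" "app (on_ar u b) w = x"
          "app (on_ar Y a) (app (\<phi> U) s) = app (on_ar Y b) (app (\<gamma> U) s)"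
          by (rule germ_relE)
        \<comment> \<open>The witnesses \<open>a\<close> and \<open>b\<close> may be different
          arrows; they agree on \<open>w\<close>, so they become equal after some \<open>e\<close>.
          Then \<open>\<phi>\<close> and \<open>\<gamma>\<close> agree on the restriction of
          \<open>s\<close> along the common composite, which puts it in \<open>E\<close>.\<close>
        have "app (on_ar u a) w = app (on_ar u b) w" using w(5,6) by simp
        from equalized[OF w(3,4,2) this]
        obtain V v e where v: "V \<in> ob C" "v \<in> on_ob u V" "e \<in> Hom C V W" "app (on_ar u e) v = w" "cmp C a e = cmp C b e" .
        let ?l = "cmp C a e"
        have l: "?l \<in> Hom C V U" by (rule category_cmp[OF C v(3) w(3)])
        have lv: "app (on_ar u ?l) v = x"
          using set_functor_cmp[OF functor_u v(3) w(3) v(2)] v(4) w(5) by simp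
        note \<phi>s = psh_map_in[OF \<phi>(2) x(1,3)] and \<gamma>s = psh_map_in[OF \<gamma>(2) x(1,3)]
        have "app (on_ar Y ?l) (app (\<phi> U) s) = app (on_ar Y ?l) (app (\<gamma> U) s)"
          using psh_cmp[OF fY w(3) v(3) \<phi>s] psh_cmp[OF fY w(4) v(3) \<gamma>s] w(7) v(5) by simp
        then have lE: "app (on_ar X ?l) s \<in> on_ob E V"
          using psh_map_natural[OF \<phi>(2) l x(3)] psh_map_natural[OF \<gamma>(2) l x(3)] psh_in[OF fX l x(3)]
          by (simp add: in_E)
        have "germ_rel X (V, v, app (on_ar X ?l) s) (U, x, s)"
          using set_functor_ide[OF functor_u v(1,2)] psh_ide[OF fX v(1) psh_in[OF fX l x(3)]]
          by (intro germ_relI[OF v(2) category_ide[OF C v(1)] l _ lv]) simp_all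
        then have "?h (point_germ C u E (V, v, app (on_ar X ?l) s)) = c"
          unfolding h[OF v(1,2) lE] c point_germ_eq[OF fX v(1,2) psh_in[OF fX l x(3)] x] .
        moreover have "point_germ C u E (V, v, app (on_ar X ?l) s) \<in> stalk_set C u E"
          using v(1,2) lE unfolding stalk_set_def by blast
        ultimately show "c \<in> ?h ` stalk_set C u E" by blast
      qed
    qed
  qed
  have "(E, i, X) \<in> ar (Sh C J)" using i E X by (simp add: Sh_ar)
  then have "is_iso (Sh C J) (E, i, X)"
    using points iso unfolding enough_points_def by blast
  \<comment> \<open>A right inverse suffices: it writes every section of \<open>X\<close> as the
    image of a section of \<open>E\<close>.\<close>
  then obtain j where j: "j \<in> Hom (Sh C J) X E" "cmp (Sh C J) (E, i, X) j = ide (Sh C J) X"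
    unfolding is_iso_def by auto
  obtain k where k: "j = (X, k, E)" "(X, k, E) \<in> ar (functor_cat (opposite C) set_cat)"
    using j(1) by (auto simp: Sh_Hom)
  have all: "s \<in> on_ob E U" if U: "U \<in> ob C" and s: "s \<in> on_ob X U" for U s
  proof -
    have kU: "k U \<in> Hom set_cat (on_ob X U) (on_ob E U)"
      using k(2) U by (simp add: functor_cat_ar)
    have "cmp set_cat (i U) (k U) = ide set_cat (on_ob X U)"
      using j(2) U unfolding k(1) by (auto dest!: fun_cong[where x = U])
    then have "app (i U) (app (k U) s) = s"
      using app_cmp[OF kU s, of "i U"] app_ide[OF s] by simp
    then show ?thesis
      using app_i[OF U app_in[OF kU s]] app_in[OF kU s] by simp
  qed
  have "\<phi> = \<gamma>"
    by (rule ntrans_eqI[OF \<phi>(2) \<gamma>(2)]) (use all in \<open>simp add: in_E\<close>)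
  then show ?thesis by (simp add: \<phi>(1) \<gamma>(1))
qed

section \<open>Points from codirected systems of objects\<close>

text \<open>The colimit of the functors represented by the objects of the system is a point of the topos.\<close>

locale codirected_system =
  fixes C :: "('o, 'a) cat" and R :: "'a set"
  assumes catC: "category C"
    and R_ar: "R \<subseteq> ar C"
    and R_nonempty: "R \<noteq> {}"
    and R_ide: "a \<in> R \<Longrightarrow> ide C (src C a) \<in> R" "a \<in> R \<Longrightarrow> ide C (tgt C a) \<in> R"
    and R_cmp: "a \<in> R \<Longrightarrow> b \<in> R \<Longrightarrow> src C a = tgt C b \<Longrightarrow> cmp C a b \<in> R"
    and R_unique: "a \<in> R \<Longrightarrow> b \<in> R \<Longrightarrow> src C a = src C b \<Longrightarrow> tgt C a = tgt C b \<Longrightarrow> a = b"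
    and R_directed: "a \<in> R \<Longrightarrow> b \<in> R \<Longrightarrow>
      \<exists>c\<in>R. \<exists>d\<in>R. src C c = src C d \<and> tgt C c = tgt C a \<and> tgt C d = tgt C b"
begin

text \<open>Targets suffice: by \<open>R_ide\<close>, the source of an arrow of the system is also
  the target of an identity in it.\<close>

definition system_ob :: "'o set" where
  "system_ob = tgt C ` R"

definition same_germ :: "'a \<Rightarrow> 'a \<Rightarrow> bool" where
  "same_germ \<phi> \<psi> \<longleftrightarrow> (\<exists>a\<in>R. \<exists>b\<in>R. src C a = src C b \<and> tgt C a = src C \<phi> \<and> tgt C b = src C \<psi> \<and>
     cmp C \<phi> a = cmp C \<psi> b)"

text \<open>Germs are equivalence classes, hence sets of arrows, which is the form that the elements
  of the values of a \<open>site_point\<close> must have.\<close>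

definition germ_of :: "'a \<Rightarrow> 'a set" where
  "germ_of \<phi> = {\<psi> \<in> ar C. src C \<psi> \<in> system_ob \<and> tgt C \<psi> = tgt C \<phi> \<and> same_germ \<phi> \<psi>}"

definition germ_functor :: "('o, 'a) site_point" where
  "germ_functor =
     (let G = \<lambda>V. {germ_of \<phi> | \<phi> N. N \<in> system_ob \<and> \<phi> \<in> Hom C N V} in
     \<lparr>on_ob = G, on_ar = (\<lambda>f. (G (src C f), \<lambda>c\<in>G (src C f). \<Union>\<phi>\<in>c. germ_of (cmp C f \<phi>), G (tgt C f)))\<rparr>)"

lemma R_Hom: "a \<in> R \<Longrightarrow> a \<in> Hom C (src C a) (tgt C a)"
  using R_ar by (auto simp: Hom_def)

lemma src_in_system: "a \<in> R \<Longrightarrow> src C a \<in> system_ob"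
  unfolding system_ob_def
  using R_ide(1)[of a] HomD(3)[OF category_ide[OF catC], of "src C a"] R_Hom Hom_ob[OF catC]
  by (metis imageI)

lemma system_ide: "N \<in> system_ob \<Longrightarrow> ide C N \<in> R"
  using R_ide(2) by (auto simp: system_ob_def)

lemma system_ob_ob: "N \<in> system_ob \<Longrightarrow> N \<in> ob C"
  using Hom_ob(2)[OF catC R_Hom] by (auto simp: system_ob_def)

lemma system_directed:
  assumes "N \<in> system_ob" "M \<in> system_ob"
  obtains K c d where "K \<in> system_ob" "c \<in> R" "d \<in> R" "c \<in> Hom C K N" "d \<in> Hom C K M"
proof -
  obtain a b where ab: "a \<in> R" "b \<in> R" "tgt C a = N" "tgt C b = M"
    using assms by (auto simp: system_ob_def)
  then obtain c d where "c \<in> R" "d \<in> R" "src C c = src C d" "tgt C c = N" "tgt C d = M"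
    using R_directed by metis
  with R_Hom[of c] R_Hom[of d] src_in_system[of c] show thesis
    by (intro that[of "src C c" c d]) simp_all
qed

lemma R_cmp_Hom:
  assumes "a \<in> R" "a \<in> Hom C N M" "b \<in> R" "b \<in> Hom C K N"
  shows "cmp C a b \<in> R" "cmp C a b \<in> Hom C K M"
  using assms R_cmp category_cmp[OF catC] by (auto simp: Hom_def)

lemma R_unique_Hom: "a \<in> R \<Longrightarrow> b \<in> R \<Longrightarrow> a \<in> Hom C N M \<Longrightarrow> b \<in> Hom C N M \<Longrightarrow> a = b"
  using R_unique by (simp add: Hom_def)

lemma same_germI:
  "a \<in> R \<Longrightarrow> b \<in> R \<Longrightarrow> a \<in> Hom C K N \<Longrightarrow> b \<in> Hom C K M \<Longrightarrow> \<phi> \<in> Hom C N V \<Longrightarrow> \<psi> \<in> Hom C M V' \<Longrightarrow>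
    cmp C \<phi> a = cmp C \<psi> b \<Longrightarrow> same_germ \<phi> \<psi>"
  unfolding same_germ_def by (rule bexI[of _ a], rule bexI[of _ b]) (simp_all add: Hom_def)

lemma same_germE:
  assumes "same_germ \<phi> \<psi>" "\<phi> \<in> Hom C N V" "\<psi> \<in> Hom C M V'"
  obtains K a b where "K \<in> system_ob" "a \<in> R" "b \<in> R" "a \<in> Hom C K N" "b \<in> Hom C K M" "cmp C \<phi> a = cmp C \<psi> b"
proof -
  obtain a b where ab: "a \<in> R" "b \<in> R" "src C a = src C b" "tgt C a = src C \<phi>" "tgt C b = src C \<psi>"
    "cmp C \<phi> a = cmp C \<psi> b"
    using assms(1) by (auto simp: same_germ_def)
  with R_Hom[of a] R_Hom[of b] src_in_system[of a] HomD[OF assms(2)] HomD[OF assms(3)] show thesis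
    by (intro that[of "src C a" a b]) simp_all
qed

lemma same_germ_refl:
  assumes "\<phi> \<in> Hom C N V" "N \<in> system_ob"
  shows "same_germ \<phi> \<phi>"
  using category_ide[OF catC system_ob_ob[OF assms(2)]]
  by (intro same_germI[OF system_ide[OF assms(2)] system_ide[OF assms(2)] _ _ assms(1) assms(1) refl])

lemma same_germ_sym: "same_germ \<phi> \<psi> \<Longrightarrow> same_germ \<psi> \<phi>"
  unfolding same_germ_def by metis

text \<open>Over a common refinement \<open>P\<close> the two arrows to the middle object
  \<open>M\<close> are equal, because the system has at most one arrow between two objects; this
  takes the place of the equalizing step in \<open>germ_rel_trans\<close>.\<close>

lemma same_germ_trans:
  assumes \<phi>: "\<phi> \<in> Hom C N V" and \<psi>: "\<psi> \<in> Hom C M V" and \<xi>: "\<xi> \<in> Hom C L V"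
    and "same_germ \<phi> \<psi>" "same_germ \<psi> \<xi>"
  shows "same_germ \<phi> \<xi>"
proof -
  obtain K a b where a: "K \<in> system_ob" "a \<in> R" "b \<in> R" "a \<in> Hom C K N" "b \<in> Hom C K M" "cmp C \<phi> a = cmp C \<psi> b"
    using same_germE[OF assms(4) \<phi> \<psi>] .
  obtain K' c d where c: "K' \<in> system_ob" "c \<in> R" "d \<in> R" "c \<in> Hom C K' M" "d \<in> Hom C K' L" "cmp C \<psi> c = cmp C \<xi> d"
    using same_germE[OF assms(5) \<psi> \<xi>] .
  obtain P p q where p: "P \<in> system_ob" "p \<in> R" "q \<in> R" "p \<in> Hom C P K" "q \<in> Hom C P K'"
    using system_directed[OF a(1) c(1)] .
  note ap = R_cmp_Hom[OF a(2,4) p(2,4)] and bp = R_cmp_Hom[OF a(3,5) p(2,4)]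
    and cq = R_cmp_Hom[OF c(2,4) p(3,5)] and dq = R_cmp_Hom[OF c(3,5) p(3,5)]
  have "cmp C \<phi> (cmp C a p) = cmp C \<psi> (cmp C b p)"
    by (simp add: category_assoc[OF catC p(4) a(4) \<phi>] category_assoc[OF catC p(4) a(5) \<psi>] a(6))
  also have "cmp C b p = cmp C c q"
    by (rule R_unique_Hom[OF bp(1) cq(1) bp(2) cq(2)])
  also have "cmp C \<psi> (cmp C c q) = cmp C \<xi> (cmp C d q)"
    by (simp add: category_assoc[OF catC p(5) c(4) \<psi>] category_assoc[OF catC p(5) c(5) \<xi>] c(6))
  finally show ?thesis
    by (rule same_germI[OF ap(1) dq(1) ap(2) dq(2) \<phi> \<xi>])
qed

lemma germ_of_eq:
  assumes \<phi>: "\<phi> \<in> Hom C N V" "N \<in> system_ob" and \<psi>: "\<psi> \<in> Hom C M V" "M \<in> system_ob"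
  shows "germ_of \<phi> = germ_of \<psi> \<longleftrightarrow> same_germ \<phi> \<psi>"
proof
  assume "germ_of \<phi> = germ_of \<psi>"
  moreover have "\<psi> \<in> germ_of \<psi>"
    using same_germ_refl[OF \<psi>] HomD[OF \<psi>(1)] \<psi>(2) by (simp add: germ_of_def)
  ultimately have "\<psi> \<in> germ_of \<phi>" by simp
  then show "same_germ \<phi> \<psi>" by (simp add: germ_of_def)
next
  assume eq: "same_germ \<phi> \<psi>"
  have "same_germ \<phi> \<xi> \<longleftrightarrow> same_germ \<psi> \<xi>" if "\<xi> \<in> ar C" "tgt C \<xi> = V" for \<xi>
    using same_germ_trans[OF \<phi>(1) \<psi>(1) _ eq, of \<xi> "src C \<xi>"]
      same_germ_trans[OF \<psi>(1) \<phi>(1) _ same_germ_sym[OF eq], of \<xi> "src C \<xi>"] that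
    by (auto simp: Hom_def)
  then show "germ_of \<phi> = germ_of \<psi>"
    using HomD[OF \<phi>(1)] HomD[OF \<psi>(1)] by (auto simp: germ_of_def)
qed

lemma germ_ofI: "\<phi> \<in> Hom C N V \<Longrightarrow> N \<in> system_ob \<Longrightarrow> germ_of \<phi> \<in> on_ob germ_functor V"
  by (auto simp: germ_functor_def Let_def)

lemma germ_ofE:
  assumes "c \<in> on_ob germ_functor V"
  obtains \<phi> N where "c = germ_of \<phi>" "N \<in> system_ob" "\<phi> \<in> Hom C N V"
  using assms by (auto simp: germ_functor_def Let_def)

text \<open>The union over representatives collapses, since composing with \<open>f\<close> keeps
  the witnesses of \<open>same_germ\<close>.\<close>

lemma app_germ_functor:
  assumes f: "f \<in> Hom C V V'" and \<phi>: "\<phi> \<in> Hom C N V" "N \<in> system_ob"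
  shows "app (on_ar germ_functor f) (germ_of \<phi>) = germ_of (cmp C f \<phi>)"
proof -
  have "app (on_ar germ_functor f) (germ_of \<phi>) = (\<Union>\<psi>\<in>germ_of \<phi>. germ_of (cmp C f \<psi>))"
    using germ_ofI[OF \<phi>] HomD[OF f] by (simp add: germ_functor_def Let_def app_def)
  also have "\<dots> = germ_of (cmp C f \<phi>)"
  proof (rule UN_constant_eq)
    show "\<phi> \<in> germ_of \<phi>"
      using same_germ_refl[OF \<phi>] HomD[OF \<phi>(1)] \<phi>(2) by (simp add: germ_of_def)
    show "\<forall>\<psi>\<in>germ_of \<phi>. germ_of (cmp C f \<psi>) = germ_of (cmp C f \<phi>)"
    proof
      fix \<psi> assume "\<psi> \<in> germ_of \<phi>"
      then have \<psi>: "\<psi> \<in> Hom C (src C \<psi>) V" "src C \<psi> \<in> system_ob" and eq: "same_germ \<psi> \<phi>"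
        using HomD[OF \<phi>(1)] same_germ_sym by (auto simp: germ_of_def Hom_def)
      obtain K a b where a: "a \<in> R" "b \<in> R" "a \<in> Hom C K (src C \<psi>)" "b \<in> Hom C K N" "cmp C \<psi> a = cmp C \<phi> b"
        using same_germE[OF eq \<psi>(1) \<phi>(1)] .
      note f\<psi> = category_cmp[OF catC \<psi>(1) f] and f\<phi> = category_cmp[OF catC \<phi>(1) f]
      have "same_germ (cmp C f \<psi>) (cmp C f \<phi>)"
        by (rule same_germI[OF a(1-4) f\<psi> f\<phi>])
          (simp add: category_assoc[OF catC a(3) \<psi>(1) f, symmetric]
            category_assoc[OF catC a(4) \<phi>(1) f, symmetric] a(5))
      then show "germ_of (cmp C f \<psi>) = germ_of (cmp C f \<phi>)"
        by (simp add: germ_of_eq[OF f\<psi> \<psi>(2) f\<phi> \<phi>(2)])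
    qed
  qed
  finally show ?thesis .
qed

lemma germ_functor_Hom:
  assumes f: "f \<in> Hom C V V'"
  shows "on_ar germ_functor f \<in> Hom set_cat (on_ob germ_functor V) (on_ob germ_functor V')"
proof -
  have "app (on_ar germ_functor f) c \<in> on_ob germ_functor V'" if c: "c \<in> on_ob germ_functor V" for c
  proof -
    obtain \<phi> N where \<phi>: "c = germ_of \<phi>" "N \<in> system_ob" "\<phi> \<in> Hom C N V"
      using c by (rule germ_ofE)
    show ?thesis
      unfolding \<phi>(1) app_germ_functor[OF f \<phi>(3,2)] by (rule germ_ofI[OF category_cmp[OF catC \<phi>(3) f] \<phi>(2)])
  qed
  then show ?thesis
    using HomD[OF f] by (simp add: germ_functor_def Let_def Hom_set_cat app_def)
qed

lemma is_functor_germ_functor: "is_functor C set_cat germ_functor"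
  unfolding is_functor_def
proof (intro conjI ballI impI)
  show "category C" by (rule catC)
  show "category set_cat" by (rule category_set_cat)
  show "on_ob germ_functor V \<in> ob set_cat" for V by (simp add: set_cat_def)
  show "on_ar germ_functor f \<in> Hom set_cat (on_ob germ_functor (src C f)) (on_ob germ_functor (tgt C f))"
    if "f \<in> ar C" for f
    using germ_functor_Hom[of f "src C f" "tgt C f"] that by (simp add: Hom_def[of C])
  show "on_ar germ_functor (ide C V) = ide set_cat (on_ob germ_functor V)" if V: "V \<in> ob C" for V
  proof (rule set_cat_eqI[OF germ_functor_Hom[OF category_ide[OF catC V]]])
    show "ide set_cat (on_ob germ_functor V) \<in> Hom set_cat (on_ob germ_functor V) (on_ob germ_functor V)"
      by (rule category_ide[OF category_set_cat]) (simp add: set_cat_def)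
    fix c assume c: "c \<in> on_ob germ_functor V"
    then obtain \<phi> N where \<phi>: "c = germ_of \<phi>" "N \<in> system_ob" "\<phi> \<in> Hom C N V"
      by (rule germ_ofE)
    show "app (on_ar germ_functor (ide C V)) c = app (ide set_cat (on_ob germ_functor V)) c"
      unfolding app_ide[OF c]
      unfolding \<phi>(1) app_germ_functor[OF category_ide[OF catC V] \<phi>(3,2)] category_cmp_ide[OF catC \<phi>(3)] ..
  qed
  show "on_ar germ_functor (cmp C g f) = cmp set_cat (on_ar germ_functor g) (on_ar germ_functor f)"
    if fg: "f \<in> ar C" "g \<in> ar C" "src C g = tgt C f" for f g
  proof -
    have f: "f \<in> Hom C (src C f) (tgt C f)" and g: "g \<in> Hom C (tgt C f) (tgt C g)"
      using fg by (simp_all add: Hom_def)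
    note gf = category_cmp[OF catC f g]
    show ?thesis
    proof (rule set_cat_eqI[OF germ_functor_Hom[OF gf]
          category_cmp[OF category_set_cat germ_functor_Hom[OF f] germ_functor_Hom[OF g]]])
      fix c assume c: "c \<in> on_ob germ_functor (src C f)"
      then obtain \<phi> N where \<phi>: "c = germ_of \<phi>" "N \<in> system_ob" "\<phi> \<in> Hom C N (src C f)"
        by (rule germ_ofE)
      show "app (on_ar germ_functor (cmp C g f)) c = app (cmp set_cat (on_ar germ_functor g) (on_ar germ_functor f)) c"
        unfolding app_cmp[OF germ_functor_Hom[OF f] c]
        unfolding \<phi>(1) app_germ_functor[OF gf \<phi>(3,2)] app_germ_functor[OF f \<phi>(3,2)]
          app_germ_functor[OF g category_cmp[OF catC \<phi>(3) f] \<phi>(2)] category_assoc[OF catC \<phi>(3) f g] ..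
    qed
  qed
qed

lemma germ_of_restrict:
  assumes \<phi>: "\<phi> \<in> Hom C N V" and a: "a \<in> R" "a \<in> Hom C K N"
  shows "germ_of (cmp C \<phi> a) = germ_of \<phi>"
proof -
  have K: "K \<in> system_ob" and N: "N \<in> system_ob"
    using src_in_system[OF a(1)] a HomD[OF a(2)] by (auto simp: system_ob_def)
  note \<phi>a = category_cmp[OF catC a(2) \<phi>] and i = category_ide[OF catC system_ob_ob[OF K]]
  have "same_germ (cmp C \<phi> a) \<phi>"
    by (rule same_germI[OF system_ide[OF K] a(1) i a(2) \<phi>a \<phi>]) (rule category_cmp_ide(1)[OF catC \<phi>a])
  then show ?thesis
    by (simp add: germ_of_eq[OF \<phi>a K \<phi> N])
qed

text \<open>Every germ is the image of the canonical element \<open>germ_of (ide C K)\<close> under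
  an arrow out of a member \<open>K\<close>, and \<open>K\<close> can be replaced by a smaller
  member. This supplies the element asked for in the axioms of a point.\<close>

lemma app_germ_functor_ide:
  assumes \<phi>: "\<phi> \<in> Hom C N V" and a: "a \<in> R" "a \<in> Hom C K N"
  shows "app (on_ar germ_functor (cmp C \<phi> a)) (germ_of (ide C K)) = germ_of \<phi>"
    and "germ_of (ide C K) \<in> on_ob germ_functor K"
proof -
  have K: "K \<in> system_ob" using src_in_system[OF a(1)] HomD[OF a(2)] by simp
  note i = category_ide[OF catC system_ob_ob[OF K]] and \<phi>a = category_cmp[OF catC a(2) \<phi>]
  show "app (on_ar germ_functor (cmp C \<phi> a)) (germ_of (ide C K)) = germ_of \<phi>"
    unfolding app_germ_functor[OF \<phi>a i K] category_cmp_ide(1)[OF catC \<phi>a]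
    by (rule germ_of_restrict[OF \<phi> a])
  show "germ_of (ide C K) \<in> on_ob germ_functor K" by (rule germ_ofI[OF i K])
qed

text \<open>Flatness comes from the system being directed with at most one arrow between two
  objects. Only the covering axiom depends on the topology; it follows from the assumption that an
  arrow out of a member lies in the sieve after restriction to a smaller member.\<close>

lemma is_point_germ_functor:
  assumes covers: "\<And>N U S \<phi>. N \<in> system_ob \<Longrightarrow> U \<in> ob C \<Longrightarrow> S \<in> J U \<Longrightarrow> \<phi> \<in> Hom C N U \<Longrightarrow>
      \<exists>a\<in>R. tgt C a = N \<and> cmp C \<phi> a \<in> S"
  shows "is_point C J germ_functor"
  unfolding is_point_def
proof (intro conjI ballI impI)
  show "is_functor C set_cat germ_functor" by (rule is_functor_germ_functor)
  obtain a where a: "a \<in> R" using R_nonempty by blast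
  then show "\<exists>U\<in>ob C. on_ob germ_functor U \<noteq> {}"
    using germ_ofI[OF R_Hom[OF a] src_in_system[OF a]] Hom_ob(2)[OF catC R_Hom[OF a]] by blast
next
  fix U V x y assume "x \<in> on_ob germ_functor U" "y \<in> on_ob germ_functor V"
  then obtain \<phi> N \<psi> M where \<phi>: "x = germ_of \<phi>" "N \<in> system_ob" "\<phi> \<in> Hom C N U"
    and \<psi>: "y = germ_of \<psi>" "M \<in> system_ob" "\<psi> \<in> Hom C M V"
    by (metis germ_ofE)
  obtain K c d where c: "K \<in> system_ob" "c \<in> R" "d \<in> R" "c \<in> Hom C K N" "d \<in> Hom C K M"
    using system_directed[OF \<phi>(2) \<psi>(2)] .
  note \<phi>c = category_cmp[OF catC c(4) \<phi>(3)] and \<psi>d = category_cmp[OF catC c(5) \<psi>(3)]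
  note app_germ_functor_ide[OF \<phi>(3) c(2,4)]
  moreover note app_germ_functor_ide(1)[OF \<psi>(3) c(3,5)]
  ultimately show "\<exists>W\<in>ob C. \<exists>w\<in>on_ob germ_functor W. \<exists>f\<in>Hom C W U. \<exists>g\<in>Hom C W V.
      app (on_ar germ_functor f) w = x \<and> app (on_ar germ_functor g) w = y"
    unfolding \<phi>(1) \<psi>(1) using system_ob_ob[OF c(1)] \<phi>c \<psi>d by blast
next
  fix U V f g x
  assume f: "f \<in> Hom C U V" and g: "g \<in> Hom C U V" and x: "x \<in> on_ob germ_functor U"
    and eq: "app (on_ar germ_functor f) x = app (on_ar germ_functor g) x"
  obtain \<phi> N where \<phi>: "x = germ_of \<phi>" "N \<in> system_ob" "\<phi> \<in> Hom C N U"
    using x by (rule germ_ofE)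
  note f\<phi> = category_cmp[OF catC \<phi>(3) f] and g\<phi> = category_cmp[OF catC \<phi>(3) g]
  have "same_germ (cmp C f \<phi>) (cmp C g \<phi>)"
    using eq unfolding \<phi>(1) app_germ_functor[OF f \<phi>(3,2)] app_germ_functor[OF g \<phi>(3,2)]
      germ_of_eq[OF f\<phi> \<phi>(2) g\<phi> \<phi>(2)] .
  from same_germE[OF this f\<phi> g\<phi>]
  obtain K a b where a: "K \<in> system_ob" "a \<in> R" "b \<in> R" "a \<in> Hom C K N" "b \<in> Hom C K N"
    "cmp C (cmp C f \<phi>) a = cmp C (cmp C g \<phi>) b" .
  \<comment> \<open>Both are arrows of the system from \<open>K\<close> to \<open>N\<close>, so
    \<open>a(6)\<close> says that \<open>f\<close> and \<open>g\<close> agree after one and the same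
    arrow, \<open>\<phi>\<close> restricted along \<open>a\<close>.\<close>
  have "b = a" by (rule R_unique_Hom[OF a(3,2,5,4)])
  note \<phi>a = category_cmp[OF catC a(4) \<phi>(3)]
  note app_germ_functor_ide[OF \<phi>(3) a(2,4)]
  moreover have "cmp C f (cmp C \<phi> a) = cmp C g (cmp C \<phi> a)"
    using a(6) unfolding \<open>b = a\<close> category_assoc[OF catC a(4) \<phi>(3) f] category_assoc[OF catC a(4) \<phi>(3) g] .
  ultimately show "\<exists>W\<in>ob C. \<exists>w\<in>on_ob germ_functor W. \<exists>h\<in>Hom C W U.
      app (on_ar germ_functor h) w = x \<and> cmp C f h = cmp C g h"
    unfolding \<phi>(1) using system_ob_ob[OF a(1)] \<phi>a by blast
next
  fix U S x assume U: "U \<in> ob C" and S: "S \<in> J U" and x: "x \<in> on_ob germ_functor U"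
  obtain \<phi> N where \<phi>: "x = germ_of \<phi>" "N \<in> system_ob" "\<phi> \<in> Hom C N U"
    using x by (rule germ_ofE)
  obtain a where a: "a \<in> R" "tgt C a = N" "cmp C \<phi> a \<in> S"
    using covers[OF \<phi>(2) U S \<phi>(3)] by blast
  then have a': "a \<in> Hom C (src C a) N" using R_Hom by blast
  then show "\<exists>f\<in>S. \<exists>y\<in>on_ob germ_functor (src C f). app (on_ar germ_functor f) y = x"
    unfolding \<phi>(1) using a(3) app_germ_functor_ide[OF \<phi>(3) a(1) a'] HomD(2)[OF category_cmp[OF catC a' \<phi>(3)]]
    by (intro bexI[of _ "cmp C \<phi> a"] bexI[of _ "germ_of (ide C (src C a))"]) simp_all
qed

text \<open>A witness for the equal germs consists of arrows \<open>h\<close>, \<open>k\<close> from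
  an object \<open>W\<close> that may lie outside the system. But the element \<open>w\<close> is
  the germ of some \<open>\<phi>\<close> out of a member, and \<open>h\<close> and \<open>k\<close>
  send it to the germ of the identity of \<open>M\<close>. So after \<open>\<phi>\<close> and a
  restriction both become arrows of the system, and over a common refinement they coincide.\<close>

lemma point_germ_functor_separates:
  assumes point: "is_point C J germ_functor" and F: "is_functor (opposite C) set_cat F"
    and M: "M \<in> system_ob" and s: "s \<in> on_ob F M" and t: "t \<in> on_ob F M"
    and eq: "point_germ C germ_functor F (M, germ_of (ide C M), s) = point_germ C germ_functor F (M, germ_of (ide C M), t)"
  shows "\<exists>a\<in>R. tgt C a = M \<and> app (on_ar F a) s = app (on_ar F a) t"
proof -
  interpret topos_point C J germ_functor by standard (rule catC point)+
  note Mo = system_ob_ob[OF M]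
  note i = category_ide[OF catC Mo]
  note iM = germ_ofI[OF i M]
  have "germ_rel F (M, germ_of (ide C M), s) (M, germ_of (ide C M), t)"
    using eq point_germ_eq[OF F Mo iM s Mo iM t] by simp
  then obtain W w h k where w: "W \<in> ob C" "w \<in> on_ob germ_functor W" "h \<in> Hom C W M" "k \<in> Hom C W M"
    "app (on_ar germ_functor h) w = germ_of (ide C M)" "app (on_ar germ_functor k) w = germ_of (ide C M)"
    "app (on_ar F h) s = app (on_ar F k) t"
    by (rule germ_relE)
  obtain \<phi> N where \<phi>: "w = germ_of \<phi>" "N \<in> system_ob" "\<phi> \<in> Hom C N W"
    using w(2) by (rule germ_ofE)
  have ex: "\<exists>K a b. K \<in> system_ob \<and> a \<in> R \<and> b \<in> R \<and> a \<in> Hom C K N \<and> b \<in> Hom C K M \<and> cmp C (cmp C l \<phi>) a = b"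
    if l: "l \<in> Hom C W M" "app (on_ar germ_functor l) w = germ_of (ide C M)" for l
  proof -
    note l\<phi> = category_cmp[OF catC \<phi>(3) l(1)]
    have "same_germ (cmp C l \<phi>) (ide C M)"
      using l(2) unfolding \<phi>(1) app_germ_functor[OF l(1) \<phi>(3,2)] germ_of_eq[OF l\<phi> \<phi>(2) i M] .
    from same_germE[OF this l\<phi> i] obtain K a b where a: "K \<in> system_ob" "a \<in> R" "b \<in> R" "a \<in> Hom C K N"
      "b \<in> Hom C K M" "cmp C (cmp C l \<phi>) a = cmp C (ide C M) b" .
    then show ?thesis using category_cmp_ide(2)[OF catC a(5)] by auto
  qed
  obtain K a b where a: "K \<in> system_ob" "a \<in> R" "b \<in> R" "a \<in> Hom C K N" "b \<in> Hom C K M" "cmp C (cmp C h \<phi>) a = b"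
    using ex[OF w(3,5)] by blast
  obtain K' a' b' where a': "K' \<in> system_ob" "a' \<in> R" "b' \<in> R" "a' \<in> Hom C K' N" "b' \<in> Hom C K' M"
    "cmp C (cmp C k \<phi>) a' = b'"
    using ex[OF w(4,6)] by blast
  obtain P p q where p: "P \<in> system_ob" "p \<in> R" "q \<in> R" "p \<in> Hom C P K" "q \<in> Hom C P K'"
    using system_directed[OF a(1) a'(1)] .
  note bp = R_cmp_Hom[OF a(3,5) p(2,4)] and bq = R_cmp_Hom[OF a'(3,5) p(3,5)]
    and ap = R_cmp_Hom[OF a(2,4) p(2,4)] and aq = R_cmp_Hom[OF a'(2,4) p(3,5)]
  \<comment> \<open>Equality of the arrows to \<open>M\<close> makes \<open>s\<close> and
    \<open>t\<close> be restricted along one arrow; equality of those to \<open>N\<close> lets the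
    two restrictions be compared through \<open>\<phi>\<close>.\<close>
  have bpq: "cmp C b p = cmp C b' q" by (rule R_unique_Hom[OF bp(1) bq(1) bp(2) bq(2)])
  have apq: "cmp C a p = cmp C a' q" by (rule R_unique_Hom[OF ap(1) aq(1) ap(2) aq(2)])
  note fcmp = psh_cmp[OF F]
  have res: "app (on_ar F (cmp C (cmp C (cmp C l \<phi>) d) r)) s = app (on_ar F (cmp C d r)) (app (on_ar F \<phi>) (app (on_ar F l) s))"
    if "l \<in> Hom C W M" "d \<in> Hom C L N" "r \<in> Hom C P L" "s \<in> on_ob F M" for l d r s L
  proof -
    note l\<phi> = category_cmp[OF catC \<phi>(3) that(1)]
    show ?thesis
      unfolding category_assoc[OF catC that(3,2) l\<phi>, symmetric]
        fcmp[OF l\<phi> category_cmp[OF catC that(3,2)] that(4)] fcmp[OF that(1) \<phi>(3) that(4)] ..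
  qed
  have "app (on_ar F (cmp C b p)) s = app (on_ar F (cmp C b' q)) t"
    using res[OF w(3) a(4) p(4) s] res[OF w(4) a'(4) p(5) t] by (simp add: a(6) a'(6) w(7) apq)
  then show ?thesis
    using bp HomD[OF bp(2)] unfolding bpq by auto
qed

end

section \<open>Open subspaces of locally ringed spaces\<close>

text \<open>An isomorphism matches ideals and their inclusions, so an ideal \<open>J\<close> between
  the preimage and the whole ring is moved to \<open>R\<close> along the inverse, where
  \<open>I\<close> is maximal.\<close>

lemma maximalideal_vimage_iso:
  assumes R: "ring R" and S: "ring S" and k: "k \<in> ring_iso S R" and I: "maximalideal I R"
  shows "maximalideal {y \<in> carrier S. k y \<in> I} S"
proof (rule maximalidealI)
  define h where "h = inv_into (carrier S) k"
  have h: "h \<in> ring_iso R S"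
    unfolding h_def by (rule ring_iso_set_sym[OF S k])
  note bij = ring_iso_memE(5)[OF k]
  have hk: "h (k y) = y" if "y \<in> carrier S" for y
    unfolding h_def by (rule bij_betw_inv_into_left[OF bij that])
  have kh: "k (h x) = x" if "x \<in> carrier R" for x
    unfolding h_def by (rule bij_betw_inv_into_right[OF bij that])
  have k': "ring_hom_ring S R k" and h': "ring_hom_ring R S h"
    using R S h k by (auto simp: ring_iso_def intro: ring_hom_ringI2)
  have I_ideal: "ideal I R" using I by (rule maximalideal.axioms(1))
  show "ideal {y \<in> carrier S. k y \<in> I} S"
    by (rule ring_hom_ring.ideal_vimage[OF k' I_ideal])
  have I_carrier: "I \<subseteq> carrier R"
    by (rule additive_subgroup.a_subset[OF ideal.axioms(1)[OF I_ideal]])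
  then obtain r where r: "r \<in> carrier R" "r \<notin> I"
    using maximalideal.I_notcarr[OF I] by blast
  then have "h r \<in> carrier S" "h r \<notin> {y \<in> carrier S. k y \<in> I}"
    using ring_iso_memE(1)[OF h] by (auto simp: kh)
  then show "carrier S \<noteq> {y \<in> carrier S. k y \<in> I}" by blast
  fix J assume J: "ideal J S" "{y \<in> carrier S. k y \<in> I} \<subseteq> J" "J \<subseteq> carrier S"
  have "{x \<in> carrier R. h x \<in> J} = I \<or> {x \<in> carrier R. h x \<in> J} = carrier R"
  proof (rule maximalideal.I_maximal[OF I ring_hom_ring.ideal_vimage[OF h' J(1)]])
    show "I \<subseteq> {x \<in> carrier R. h x \<in> J}"
      using J(2) I_carrier ring_iso_memE(1)[OF h] kh by (auto simp: subset_iff)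
  qed blast
  moreover have "y \<in> J \<longleftrightarrow> k y \<in> {x \<in> carrier R. h x \<in> J}" if "y \<in> carrier S" for y
    using that hk ring_iso_memE(1)[OF k] by auto
  ultimately show "J = {y \<in> carrier S. k y \<in> I} \<or> J = carrier S"
    using J(3) ring_iso_memE(1)[OF k] by (auto simp: subset_iff)
qed

text \<open>Pulling back along the inverse of \<open>k\<close> gives a maximal ideal of
  \<open>S\<close>; pulling back along \<open>k\<close> shows that there is only one.\<close>

lemma local_ring_iso:
  assumes R: "local_ring R" and k: "k \<in> ring_iso R S" and S: "cring S"
  shows "local_ring S"
  unfolding local_ring_def
proof (intro conjI)
  show "cring S" by (rule S)
  have R': "ring R" and S': "ring S"
    using R S by (auto simp: local_ring_def cring_def)
  obtain I where I: "maximalideal I R" "\<And>I'. maximalideal I' R \<Longrightarrow> I' = I"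
    using R by (auto simp: local_ring_def)
  let ?h = "inv_into (carrier R) k"
  show "\<exists>!J. maximalideal J S"
  proof (rule ex_ex1I)
    show "\<exists>J. maximalideal J S"
      using maximalideal_vimage_iso[OF R' S' ring_iso_set_sym[OF R' k] I(1)] by blast
    fix J J' assume J: "maximalideal J S" "maximalideal J' S"
    then have "{x \<in> carrier R. k x \<in> J} = {x \<in> carrier R. k x \<in> J'}"
      using maximalideal_vimage_iso[OF S' R' k] I(2) by metis
    moreover have "J \<subseteq> carrier S" "J' \<subseteq> carrier S"
      using J by (auto dest!: maximalideal.axioms(1) ideal.axioms(1) additive_subgroup.a_subset)
    moreover have "k ` {x \<in> carrier R. k x \<in> K} = K" if "K \<subseteq> carrier S" for K
      using ring_iso_memE(5)[OF k] that by (auto simp: bij_betw_def)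
    ultimately show "J = J'" by metis
  qed
qed

lemma ring_iso_Units:
  assumes h: "h \<in> ring_iso A B" and d: "d \<in> Units A"
  shows "h d \<in> Units B"
proof -
  obtain e where e: "d \<in> carrier A" "e \<in> carrier A" "e \<otimes>\<^bsub>A\<^esub> d = \<one>\<^bsub>A\<^esub>" "d \<otimes>\<^bsub>A\<^esub> e = \<one>\<^bsub>A\<^esub>"
    using d by (auto simp: Units_def)
  have "h e \<otimes>\<^bsub>B\<^esub> h d = \<one>\<^bsub>B\<^esub>" "h d \<otimes>\<^bsub>B\<^esub> h e = \<one>\<^bsub>B\<^esub>"
    using ring_iso_memE(2)[OF h e(1,2)] ring_iso_memE(2)[OF h e(2,1)] ring_iso_memE(4)[OF h] e(3,4) by simp_all
  with ring_iso_memE(1)[OF h e(1)] ring_iso_memE(1)[OF h e(2)] show ?thesis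
    unfolding Units_def by blast
qed

lemma Units_ring_iso:
  assumes R: "ring R" and k: "k \<in> ring_iso R S" and c: "c \<in> carrier R"
  shows "k c \<in> Units S \<longleftrightarrow> c \<in> Units R"
proof -
  let ?h = "inv_into (carrier R) k"
  have "?h (k c) = c"
    by (rule bij_betw_inv_into_left[OF ring_iso_memE(5)[OF k] c])
  then show ?thesis
    using ring_iso_Units[OF k, of c] ring_iso_Units[OF ring_iso_set_sym[OF R k], of "k c"] by auto
qed

section \<open>Germs and stalks of ringed spaces\<close>

abbreviation open_in :: "('x, 'r) rspace \<Rightarrow> 'x set \<Rightarrow> bool" where
  "open_in X U \<equiv> openin (top_of X) U"

lemma
  assumes "ringed_space X" "open_in X U"
  shows ringed_space_cring: "cring (sect X U)"
    and ringed_space_id: "s \<in> carrier (sect X U) \<Longrightarrow> rst X U U s = s"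
    and ringed_space_hom: "open_in X V \<Longrightarrow> V \<subseteq> U \<Longrightarrow> rst X U V \<in> ring_hom (sect X U) (sect X V)"
    and ringed_space_trans: "open_in X V \<Longrightarrow> open_in X W \<Longrightarrow> W \<subseteq> V \<Longrightarrow> V \<subseteq> U \<Longrightarrow>
      s \<in> carrier (sect X U) \<Longrightarrow> rst X V W (rst X U V s) = rst X U W s"
proof -
  have 1: "\<forall>U. open_in X U \<longrightarrow> cring (sect X U) \<and> (\<forall>s\<in>carrier (sect X U). rst X U U s = s)"
    and 2: "\<forall>U V. open_in X U \<and> open_in X V \<and> V \<subseteq> U \<longrightarrow>
        rst X U V \<in> ring_hom (sect X U) (sect X V)"
    and 3: "\<forall>U V W. open_in X U \<and> open_in X V \<and> open_in X W \<and> W \<subseteq> V \<and> V \<subseteq> U \<longrightarrow>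
        (\<forall>s\<in>carrier (sect X U). rst X V W (rst X U V s) = rst X U W s)"
    using assms(1) unfolding ringed_space_def by - (elim conjE, assumption)+
  show "cring (sect X U)" and "s \<in> carrier (sect X U) \<Longrightarrow> rst X U U s = s"
    using 1 assms(2) by blast+
  show "open_in X V \<Longrightarrow> V \<subseteq> U \<Longrightarrow> rst X U V \<in> ring_hom (sect X U) (sect X V)"
    using 2 assms(2) by blast
  show "open_in X V \<Longrightarrow> open_in X W \<Longrightarrow> W \<subseteq> V \<Longrightarrow> V \<subseteq> U \<Longrightarrow>
      s \<in> carrier (sect X U) \<Longrightarrow> rst X V W (rst X U V s) = rst X U W s"
    using 3 assms(2) by blast
qed

lemma ringed_space_rst_in:
  "ringed_space X \<Longrightarrow> open_in X U \<Longrightarrow> open_in X V \<Longrightarrow> V \<subseteq> U \<Longrightarrow>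
    s \<in> carrier (sect X U) \<Longrightarrow> rst X U V s \<in> carrier (sect X V)"
  by (rule ring_hom_closed[OF ringed_space_hom])

lemma open_sub_simps [simp]:
  "top_of (open_sub X U) = subtopology (top_of X) U" "sect (open_sub X U) = sect X" "rst (open_sub X U) = rst X"
  by (simp_all add: open_sub_def)

lemma topspace_open_sub: "open_in X U \<Longrightarrow> topspace (subtopology (top_of X) U) = U"
  by (auto dest: openin_subset)

lemma open_sub_open_sub: "V \<subseteq> U \<Longrightarrow> open_sub (open_sub X U) V = open_sub X V"
  by (simp add: open_sub_def subtopology_subtopology Int_absorb1)

lemma ringed_space_open_sub:
  assumes X: "ringed_space X" and U: "open_in X U"
  shows "ringed_space (open_sub X U)"
proof -
  have glue: "\<forall>\<U> s. (\<forall>U\<in>\<U>. open_in X U \<and> s U \<in> carrier (sect X U)) \<and>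
        (\<forall>U\<in>\<U>. \<forall>V\<in>\<U>. rst X U (U \<inter> V) (s U) = rst X V (U \<inter> V) (s V)) \<longrightarrow>
        (\<exists>!t. t \<in> carrier (sect X (\<Union>\<U>)) \<and> (\<forall>U\<in>\<U>. rst X (\<Union>\<U>) U t = s U))"
    using X unfolding ringed_space_def by (elim conjE)
  show ?thesis
    unfolding ringed_space_def open_sub_simps openin_open_subtopology[OF U]
  proof (intro conjI allI impI)
    fix \<U> s
    assume "(\<forall>V\<in>\<U>. (open_in X V \<and> V \<subseteq> U) \<and> s V \<in> carrier (sect X V)) \<and>
      (\<forall>U\<in>\<U>. \<forall>V\<in>\<U>. rst X U (U \<inter> V) (s U) = rst X V (U \<inter> V) (s V))"
    then show "\<exists>!t. t \<in> carrier (sect X (\<Union>\<U>)) \<and> (\<forall>U\<in>\<U>. rst X (\<Union>\<U>) U t = s U)"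
      by (intro glue[rule_format]) blast
  qed (use X in \<open>auto intro: ringed_space_cring ringed_space_id ringed_space_hom ringed_space_trans\<close>)
qed

lemma germ_self:
  assumes "open_in X V" "x \<in> V" "s \<in> carrier (sect X V)"
  shows "(V, s) \<in> germ X x V s"
  using assms by (auto simp: germ_def)

text \<open>A germ is the set of all its representatives, so equality makes the second section a
  representative of the first germ, with a witness. Conversely, witnesses can be intersected, which
  carries representatives of one germ over to the other.\<close>

lemma germ_eq:
  assumes X: "ringed_space X"
    and V: "open_in X V" "x \<in> V" "s \<in> carrier (sect X V)"
    and W: "open_in X W" "x \<in> W" "t \<in> carrier (sect X W)"
  shows "germ X x V s = germ X x W t \<longleftrightarrow>
    (\<exists>Z. open_in X Z \<and> x \<in> Z \<and> Z \<subseteq> V \<inter> W \<and> rst X V Z s = rst X W Z t)"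
proof
  assume "germ X x V s = germ X x W t"
  then have "(W, t) \<in> germ X x V s" using germ_self[OF W] by simp
  then show "\<exists>Z. open_in X Z \<and> x \<in> Z \<and> Z \<subseteq> V \<inter> W \<and> rst X V Z s = rst X W Z t"
    by (simp add: germ_def)
next
  have sub: "germ X x V s \<subseteq> germ X x W t"
    if V: "open_in X V" "x \<in> V" "s \<in> carrier (sect X V)"
      and W: "open_in X W" "x \<in> W" "t \<in> carrier (sect X W)"
      and Z: "open_in X Z" "x \<in> Z" "Z \<subseteq> V \<inter> W" "rst X V Z s = rst X W Z t" for V W Z s t
  proof
    fix c assume "c \<in> germ X x V s"
    then obtain V' s' Z' where c: "c = (V', s')" "open_in X V'" "x \<in> V'" "s' \<in> carrier (sect X V')"
      and Z': "open_in X Z'" "x \<in> Z'" "Z' \<subseteq> V \<inter> V'" "rst X V Z' s = rst X V' Z' s'"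
      by (auto simp: germ_def)
    have o: "open_in X (Z \<inter> Z')" using Z(1) Z'(1) by (rule openin_Int)
    have "rst X W (Z \<inter> Z') t = rst X Z (Z \<inter> Z') (rst X W Z t)"
      using ringed_space_trans[OF X W(1) Z(1) o _ _ W(3)] Z(3) by simp
    also have "\<dots> = rst X V (Z \<inter> Z') s"
      using ringed_space_trans[OF X V(1) Z(1) o _ _ V(3)] Z(3) unfolding Z(4)[symmetric] by simp
    also have "\<dots> = rst X Z' (Z \<inter> Z') (rst X V Z' s)"
      using ringed_space_trans[OF X V(1) Z'(1) o _ _ V(3)] Z'(3) by simp
    also have "\<dots> = rst X V' (Z \<inter> Z') s'"
      using ringed_space_trans[OF X c(2) Z'(1) o _ _ c(4)] Z'(3) unfolding Z'(4) by simp
    finally show "c \<in> germ X x W t"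
      using c o Z Z' by (auto simp: germ_def)
  qed
  assume "\<exists>Z. open_in X Z \<and> x \<in> Z \<and> Z \<subseteq> V \<inter> W \<and> rst X V Z s = rst X W Z t"
  then obtain Z where Z: "open_in X Z" "x \<in> Z" "Z \<subseteq> V \<inter> W" "rst X V Z s = rst X W Z t" by blast
  show "germ X x V s = germ X x W t"
    using sub[OF V W Z] sub[OF W V Z(1,2)] Z(3,4) by (simp add: Int_commute)
qed

lemma germ_rst:
  assumes X: "ringed_space X" and V: "open_in X V" "x \<in> W" "s \<in> carrier (sect X V)"
    and W: "open_in X W" "W \<subseteq> V"
  shows "germ X x W (rst X V W s) = germ X x V s"
proof -
  have x: "x \<in> V" using V(2) W(2) by blast
  note r = ringed_space_rst_in[OF X V(1) W V(3)]
  show ?thesis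
    unfolding germ_eq[OF X W(1) V(2) r V(1) x V(3)]
    using V(2) W ringed_space_id[OF X W(1) r] by (intro exI[of _ W]) simp
qed

text \<open>Sums and products of germs are defined by the same formula, so both are treated at once
  as operations on sections that commute with restriction.\<close>

definition section_operation :: "('x, 'r) rspace \<Rightarrow> ('x set \<Rightarrow> 'r \<Rightarrow> 'r \<Rightarrow> 'r) \<Rightarrow> bool" where
  "section_operation X f \<longleftrightarrow>
     (\<forall>V s t. open_in X V \<and> s \<in> carrier (sect X V) \<and> t \<in> carrier (sect X V) \<longrightarrow>
        f V s t \<in> carrier (sect X V) \<and>
        (\<forall>W. open_in X W \<and> W \<subseteq> V \<longrightarrow> rst X V W (f V s t) = f W (rst X V W s) (rst X V W t)))"

lemma
  assumes "section_operation X f" "open_in X V" "s \<in> carrier (sect X V)" "t \<in> carrier (sect X V)"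
  shows section_operation_in: "f V s t \<in> carrier (sect X V)"
    and section_operation_rst: "open_in X W \<Longrightarrow> W \<subseteq> V \<Longrightarrow>
      rst X V W (f V s t) = f W (rst X V W s) (rst X V W t)"
  using assms unfolding section_operation_def by blast+

lemma
  assumes X: "ringed_space X"
  shows section_operation_mult: "section_operation X (\<lambda>V. mult (sect X V))"
    and section_operation_add: "section_operation X (\<lambda>V. add (sect X V))"
  unfolding section_operation_def
  by (auto intro: cring.cring_simprules(1,5) ringed_space_cring[OF X]
      ring_hom_mult[OF ringed_space_hom[OF X]] ring_hom_add[OF ringed_space_hom[OF X]])

text \<open>Changing the representatives changes the result only outside the intersection of the two
  witnesses, so all pairs give the same germ and the double union collapses.\<close>

lemma germ_op:
  assumes X: "ringed_space X"
    and f: "section_operation X f"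
    and V: "open_in X V" "x \<in> V" "s \<in> carrier (sect X V)"
    and W: "open_in X W" "x \<in> W" "t \<in> carrier (sect X W)"
  shows "(\<Union>(V, s)\<in>germ X x V s. \<Union>(W, t)\<in>germ X x W t.
      germ X x (V \<inter> W) (f (V \<inter> W) (rst X V (V \<inter> W) s) (rst X W (V \<inter> W) t))) =
    germ X x (V \<inter> W) (f (V \<inter> W) (rst X V (V \<inter> W) s) (rst X W (V \<inter> W) t))"
proof -
  let ?g = "\<lambda>V s W t. germ X x (V \<inter> W) (f (V \<inter> W) (rst X V (V \<inter> W) s) (rst X W (V \<inter> W) t))"
  have eq: "?g V' s' W' t' = ?g V s W t" if st': "(V', s') \<in> germ X x V s" "(W', t') \<in> germ X x W t" for V' s' W' t'
  proof -
    obtain Z1 where V': "open_in X V'" "x \<in> V'" "s' \<in> carrier (sect X V')"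
      and Z1: "open_in X Z1" "x \<in> Z1" "Z1 \<subseteq> V \<inter> V'" "rst X V Z1 s = rst X V' Z1 s'"
      using st'(1) by (auto simp: germ_def)
    obtain Z2 where W': "open_in X W'" "x \<in> W'" "t' \<in> carrier (sect X W')"
      and Z2: "open_in X Z2" "x \<in> Z2" "Z2 \<subseteq> W \<inter> W'" "rst X W Z2 t = rst X W' Z2 t'"
      using st'(2) by (auto simp: germ_def)
    let ?Z = "Z1 \<inter> Z2"
    have Z: "open_in X ?Z" using Z1(1) Z2(1) by (rule openin_Int)
    have VW: "open_in X (V \<inter> W)" "open_in X (V' \<inter> W')"
      using V(1) W(1) V'(1) W'(1) by (auto intro: openin_Int)
    have res: "rst X (A \<inter> B) ?Z (f (A \<inter> B) (rst X A (A \<inter> B) a) (rst X B (A \<inter> B) b)) =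
        f ?Z (rst X Z1 ?Z (rst X A Z1 a)) (rst X Z2 ?Z (rst X B Z2 b))"
      and mem: "f (A \<inter> B) (rst X A (A \<inter> B) a) (rst X B (A \<inter> B) b) \<in> carrier (sect X (A \<inter> B))"
      if A: "open_in X A" "a \<in> carrier (sect X A)" "Z1 \<subseteq> A"
        and B: "open_in X B" "b \<in> carrier (sect X B)" "Z2 \<subseteq> B" for A B a b
    proof -
      have AB: "open_in X (A \<inter> B)" using A(1) B(1) by (rule openin_Int)
      have a: "rst X A (A \<inter> B) a \<in> carrier (sect X (A \<inter> B))" and b: "rst X B (A \<inter> B) b \<in> carrier (sect X (A \<inter> B))"
        using ringed_space_rst_in[OF X _ AB] A B by auto
      then show "f (A \<inter> B) (rst X A (A \<inter> B) a) (rst X B (A \<inter> B) b) \<in> carrier (sect X (A \<inter> B))"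
        by (rule section_operation_in[OF f AB])
      have "rst X (A \<inter> B) ?Z (rst X A (A \<inter> B) a) = rst X Z1 ?Z (rst X A Z1 a)"
        using ringed_space_trans[OF X A(1) AB Z _ _ A(2)] ringed_space_trans[OF X A(1) Z1(1) Z _ A(3) A(2)] A B by auto
      moreover have "rst X (A \<inter> B) ?Z (rst X B (A \<inter> B) b) = rst X Z2 ?Z (rst X B Z2 b)"
        using ringed_space_trans[OF X B(1) AB Z _ _ B(2)] ringed_space_trans[OF X B(1) Z2(1) Z _ B(3) B(2)] A B by auto
      ultimately show "rst X (A \<inter> B) ?Z (f (A \<inter> B) (rst X A (A \<inter> B) a) (rst X B (A \<inter> B) b)) =
        f ?Z (rst X Z1 ?Z (rst X A Z1 a)) (rst X Z2 ?Z (rst X B Z2 b))"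
        using section_operation_rst[OF f AB a b Z] A B by auto
    qed
    have sub: "Z1 \<subseteq> V" "Z1 \<subseteq> V'" "Z2 \<subseteq> W" "Z2 \<subseteq> W'" using Z1(3) Z2(3) by auto
    have x: "x \<in> V \<inter> W" "x \<in> V' \<inter> W'" "x \<in> ?Z" using V V' W W' Z1 Z2 by auto
    show ?thesis
      unfolding germ_eq[OF X VW(2) x(2) mem[OF V'(1,3) sub(2) W'(1,3) sub(4)] VW(1) x(1) mem[OF V(1,3) sub(1) W(1,3) sub(3)]]
      using Z x sub res[OF V'(1,3) sub(2) W'(1,3) sub(4)] res[OF V(1,3) sub(1) W(1,3) sub(3)] Z1(4) Z2(4)
      by (intro exI[of _ ?Z]) auto
  qed
  have inner: "(\<Union>(W', t')\<in>germ X x W t. ?g V' s' W' t') = ?g V s W t" if "(V', s') \<in> germ X x V s" for V' s'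
  proof -
    have "(\<Union>(W', t')\<in>germ X x W t. ?g V' s' W' t') = (case (W, t) of (W', t') \<Rightarrow> ?g V s W' t')"
      by (rule UN_constant_eq[OF germ_self[OF W]]) (clarsimp simp: eq[OF that])
    then show ?thesis by simp
  qed
  have "(\<Union>(V', s')\<in>germ X x V s. \<Union>(W', t')\<in>germ X x W t. ?g V' s' W' t') =
    (case (V, s) of (V', s') \<Rightarrow> ?g V' s' W t)"
    by (rule UN_constant_eq[OF germ_self[OF V]]) (clarsimp simp: inner)
  then show ?thesis by simp
qed

lemma stalk_mult:
  assumes X: "ringed_space X"
    and V: "open_in X V" "x \<in> V" "s \<in> carrier (sect X V)"
    and W: "open_in X W" "x \<in> W" "t \<in> carrier (sect X W)"
  shows "germ X x V s \<otimes>\<^bsub>stalk X x\<^esub> germ X x W t =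
    germ X x (V \<inter> W) (rst X V (V \<inter> W) s \<otimes>\<^bsub>sect X (V \<inter> W)\<^esub> rst X W (V \<inter> W) t)"
proof -
  have "(\<Union>(V, s)\<in>germ X x V s. \<Union>(W, t)\<in>germ X x W t.
      germ X x (V \<inter> W) (rst X V (V \<inter> W) s \<otimes>\<^bsub>sect X (V \<inter> W)\<^esub> rst X W (V \<inter> W) t)) =
    germ X x (V \<inter> W) (rst X V (V \<inter> W) s \<otimes>\<^bsub>sect X (V \<inter> W)\<^esub> rst X W (V \<inter> W) t)"
    by (rule germ_op[OF X section_operation_mult[OF X] V W])
  then show ?thesis by (simp add: stalk_def)
qed

lemma stalk_add:
  assumes X: "ringed_space X"
    and V: "open_in X V" "x \<in> V" "s \<in> carrier (sect X V)"
    and W: "open_in X W" "x \<in> W" "t \<in> carrier (sect X W)"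
  shows "germ X x V s \<oplus>\<^bsub>stalk X x\<^esub> germ X x W t =
    germ X x (V \<inter> W) (rst X V (V \<inter> W) s \<oplus>\<^bsub>sect X (V \<inter> W)\<^esub> rst X W (V \<inter> W) t)"
proof -
  have "(\<Union>(V, s)\<in>germ X x V s. \<Union>(W, t)\<in>germ X x W t.
      germ X x (V \<inter> W) (rst X V (V \<inter> W) s \<oplus>\<^bsub>sect X (V \<inter> W)\<^esub> rst X W (V \<inter> W) t)) =
    germ X x (V \<inter> W) (rst X V (V \<inter> W) s \<oplus>\<^bsub>sect X (V \<inter> W)\<^esub> rst X W (V \<inter> W) t)"
    by (rule germ_op[OF X section_operation_add[OF X] V W])
  then show ?thesis by (simp add: stalk_def)
qed

text \<open>A germ of the open subspace has representatives inside \<open>U\<close> only, so the two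
  stalks at a point are different sets; discarding the other representatives identifies
  them.\<close>

definition restrict_germ :: "'x set \<Rightarrow> ('x set \<times> 'r) set \<Rightarrow> ('x set \<times> 'r) set" where
  "restrict_germ U c = {(V, t) \<in> c. V \<subseteq> U}"

lemma restrict_germ:
  assumes X: "ringed_space X" and U: "open_in X U" "x \<in> U"
    and V: "open_in X V" "s \<in> carrier (sect X V)"
  shows "restrict_germ U (germ X x V s) = germ (open_sub X U) x (V \<inter> U) (rst X V (V \<inter> U) s)"
proof -
  have VU: "open_in X (V \<inter> U)" using V(1) U(1) by (rule openin_Int)
  have "rst X (V \<inter> U) Z (rst X V (V \<inter> U) s) = rst X V Z s" if "open_in X Z" "Z \<subseteq> V \<inter> U" for Z
    using ringed_space_trans[OF X V(1) VU that(1) that(2) _ V(2)] by simp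
  then have "(\<exists>Z. open_in X Z \<and> x \<in> Z \<and> Z \<subseteq> V \<inter> W \<and> rst X V Z s = rst X W Z t) \<longleftrightarrow>
    (\<exists>Z. (open_in X Z \<and> Z \<subseteq> U) \<and> x \<in> Z \<and> Z \<subseteq> V \<inter> U \<inter> W \<and>
      rst X (V \<inter> U) Z (rst X V (V \<inter> U) s) = rst X W Z t)"
    if "W \<subseteq> U" for W t
    using that by (intro iff_exI) auto
  then show ?thesis
    unfolding germ_def restrict_germ_def open_sub_simps openin_open_subtopology[OF U(1)] by auto
qed

lemma stalkE:
  assumes "c \<in> carrier (stalk X x)"
  obtains V s where "c = germ X x V s" "open_in X V" "x \<in> V" "s \<in> carrier (sect X V)"
  using assms by (auto simp: stalk_def)

lemma stalkI:
  "open_in X V \<Longrightarrow> x \<in> V \<Longrightarrow> s \<in> carrier (sect X V) \<Longrightarrow> germ X x V s \<in> carrier (stalk X x)"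
  by (auto simp: stalk_def)

text \<open>A germ at a point of \<open>U\<close> is determined by its representatives inside
  \<open>U\<close>, which gives injectivity; a representative in the subspace is also one in
  \<open>X\<close>, which gives surjectivity. Zero is stated separately because
  \<open>ring_iso\<close> speaks of sums, products and one.\<close>

lemma restrict_germ_iso:
  assumes X: "ringed_space X" and U: "open_in X U" "x \<in> U"
  shows "restrict_germ U \<in> ring_iso (stalk X x) (stalk (open_sub X U) x)"
    and "restrict_germ U \<zero>\<^bsub>stalk X x\<^esub> = \<zero>\<^bsub>stalk (open_sub X U) x\<^esub>"
proof -
  note X' = ringed_space_open_sub[OF X U(1)]
  note restrict = restrict_germ[OF X U]
  have VU: "open_in X (V \<inter> U)" "open_in (open_sub X U) (V \<inter> U)"
      "rst X V (V \<inter> U) s \<in> carrier (sect X (V \<inter> U))"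
    if "open_in X V" "s \<in> carrier (sect X V)" for V s
    using openin_Int[OF that(1) U(1)] ringed_space_rst_in[OF X that(1) _ _ that(2), of "V \<inter> U"]
    by (simp_all add: openin_open_subtopology[OF U(1)])
  have top: "open_in X (topspace (top_of X))" "topspace (top_of X) \<inter> U = U"
    using U(1) by (auto dest: openin_subset)
  have op: "restrict_germ U (germ X x (V \<inter> W) (f (V \<inter> W) (rst X V (V \<inter> W) s) (rst X W (V \<inter> W) t))) =
    germ (open_sub X U) x (V \<inter> U \<inter> (W \<inter> U)) (f (V \<inter> U \<inter> (W \<inter> U))
      (rst X (V \<inter> U) (V \<inter> U \<inter> (W \<inter> U)) (rst X V (V \<inter> U) s))
      (rst X (W \<inter> U) (V \<inter> U \<inter> (W \<inter> U)) (rst X W (W \<inter> U) t)))"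
    if f: "section_operation X f"
      and V: "open_in X V" "s \<in> carrier (sect X V)"
      and W: "open_in X W" "t \<in> carrier (sect X W)" for f V W s t
  proof -
    have VW: "open_in X (V \<inter> W)" using V(1) W(1) by (rule openin_Int)
    let ?Z = "V \<inter> W \<inter> U"
    have Z: "open_in X ?Z" using VW U(1) by (rule openin_Int)
    have eq: "V \<inter> U \<inter> (W \<inter> U) = ?Z" and sub: "?Z \<subseteq> V \<inter> W" "?Z \<subseteq> V \<inter> U" "?Z \<subseteq> W \<inter> U" by blast+
    have s: "rst X V (V \<inter> W) s \<in> carrier (sect X (V \<inter> W))" and t: "rst X W (V \<inter> W) t \<in> carrier (sect X (V \<inter> W))"
      using ringed_space_rst_in[OF X V(1) VW _ V(2)] ringed_space_rst_in[OF X W(1) VW _ W(2)] by auto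
    have "rst X (V \<inter> W) ?Z (rst X V (V \<inter> W) s) = rst X (V \<inter> U) ?Z (rst X V (V \<inter> U) s)"
      using ringed_space_trans[OF X V(1) VW Z sub(1) Int_lower1 V(2)]
        ringed_space_trans[OF X V(1) VU(1)[OF V] Z sub(2) Int_lower1 V(2)] by simp
    moreover have "rst X (V \<inter> W) ?Z (rst X W (V \<inter> W) t) = rst X (W \<inter> U) ?Z (rst X W (W \<inter> U) t)"
      using ringed_space_trans[OF X W(1) VW Z sub(1) Int_lower2 W(2)]
        ringed_space_trans[OF X W(1) VU(1)[OF W] Z sub(3) Int_lower1 W(2)] by simp
    ultimately show ?thesis
      unfolding restrict[OF VW section_operation_in[OF f VW s t]] section_operation_rst[OF f VW s t Z Int_lower1] eq by simp
  qed
  have zero: "rst X V W \<zero>\<^bsub>sect X V\<^esub> = \<zero>\<^bsub>sect X W\<^esub>"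
    if "open_in X V" "open_in X W" "W \<subseteq> V" for V W
    using ring_hom_zero[OF ringed_space_hom[OF X that]] ringed_space_cring[OF X that(1)]
      ringed_space_cring[OF X that(2)] by (simp add: cring_def)
  show "restrict_germ U \<in> ring_iso (stalk X x) (stalk (open_sub X U) x)"
  proof (rule ring_iso_memI)
    show in_stalk: "restrict_germ U c \<in> carrier (stalk (open_sub X U) x)" if c: "c \<in> carrier (stalk X x)" for c
    proof -
      obtain V s where V: "c = germ X x V s" "open_in X V" "x \<in> V" "s \<in> carrier (sect X V)"
        using c by (rule stalkE)
      show ?thesis
        unfolding V(1) restrict[OF V(2,4)] using VU[OF V(2,4)] V(3) U(2) by (intro stalkI) simp_all
    qed
    show "restrict_germ U (c \<otimes>\<^bsub>stalk X x\<^esub> d) = restrict_germ U c \<otimes>\<^bsub>stalk (open_sub X U) x\<^esub> restrict_germ U d"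
      and "restrict_germ U (c \<oplus>\<^bsub>stalk X x\<^esub> d) = restrict_germ U c \<oplus>\<^bsub>stalk (open_sub X U) x\<^esub> restrict_germ U d"
      if c: "c \<in> carrier (stalk X x)" and d: "d \<in> carrier (stalk X x)" for c d
    proof -
      obtain V s where V: "c = germ X x V s" "open_in X V" "x \<in> V" "s \<in> carrier (sect X V)"
        using c by (rule stalkE)
      obtain W t where W: "d = germ X x W t" "open_in X W" "x \<in> W" "t \<in> carrier (sect X W)"
        using d by (rule stalkE)
      have x: "x \<in> V \<inter> U" "x \<in> W \<inter> U" using V(3) W(3) U(2) by auto
      note V' = VU[OF V(2,4)] and W' = VU[OF W(2,4)]
      have V'': "rst X V (V \<inter> U) s \<in> carrier (sect (open_sub X U) (V \<inter> U))"
        and W'': "rst X W (W \<inter> U) t \<in> carrier (sect (open_sub X U) (W \<inter> U))"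
        using V'(3) W'(3) by simp_all
      show "restrict_germ U (c \<otimes>\<^bsub>stalk X x\<^esub> d) = restrict_germ U c \<otimes>\<^bsub>stalk (open_sub X U) x\<^esub> restrict_germ U d"
        unfolding V(1) W(1) restrict[OF V(2,4)] restrict[OF W(2,4)] stalk_mult[OF X V(2-4) W(2-4)]
          stalk_mult[OF X' V'(2) x(1) V'' W'(2) x(2) W''] open_sub_simps
        by (rule op[OF section_operation_mult[OF X] V(2,4) W(2,4)])
      show "restrict_germ U (c \<oplus>\<^bsub>stalk X x\<^esub> d) = restrict_germ U c \<oplus>\<^bsub>stalk (open_sub X U) x\<^esub> restrict_germ U d"
        unfolding V(1) W(1) restrict[OF V(2,4)] restrict[OF W(2,4)] stalk_add[OF X V(2-4) W(2-4)]
          stalk_add[OF X' V'(2) x(1) V'' W'(2) x(2) W''] open_sub_simps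
        by (rule op[OF section_operation_add[OF X] V(2,4) W(2,4)])
    qed
    show "restrict_germ U \<one>\<^bsub>stalk X x\<^esub> = \<one>\<^bsub>stalk (open_sub X U) x\<^esub>"
      using restrict[OF top(1) cring.cring_simprules(6)[OF ringed_space_cring[OF X top(1)]]]
        ring_hom_one[OF ringed_space_hom[OF X top(1) U(1)]] top(2)
      by (simp add: stalk_def topspace_open_sub[OF U(1)] openin_subset[OF U(1)] del: topspace_subtopology)
    show "bij_betw (restrict_germ U) (carrier (stalk X x)) (carrier (stalk (open_sub X U) x))"
      unfolding bij_betw_def
    proof
      show "inj_on (restrict_germ U) (carrier (stalk X x))"
      proof (rule inj_onI)
        fix c d assume c: "c \<in> carrier (stalk X x)" and d: "d \<in> carrier (stalk X x)"
          and eq: "restrict_germ U c = restrict_germ U d"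
        obtain V s where V: "c = germ X x V s" "open_in X V" "x \<in> V" "s \<in> carrier (sect X V)"
          using c by (rule stalkE)
        obtain W t where W: "d = germ X x W t" "open_in X W" "x \<in> W" "t \<in> carrier (sect X W)"
          using d by (rule stalkE)
        have x: "x \<in> V \<inter> U" "x \<in> W \<inter> U" using V(3) W(3) U(2) by auto
        have "(W \<inter> U, rst X W (W \<inter> U) t) \<in> restrict_germ U d"
          unfolding W(1) restrict_germ_def
          using germ_rst[OF X W(2) x(2) W(4) VU(1)[OF W(2,4)]] germ_self[OF VU(1)[OF W(2,4)] x(2) VU(3)[OF W(2,4)]]
          by simp
        then have "(W \<inter> U, rst X W (W \<inter> U) t) \<in> germ X x V s"
          unfolding eq[symmetric] V(1) by (simp add: restrict_germ_def)
        then have "germ X x V s = germ X x (W \<inter> U) (rst X W (W \<inter> U) t)"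
          using germ_eq[OF X V(2-4) VU(1)[OF W(2,4)] x(2) VU(3)[OF W(2,4)]] by (simp add: germ_def[of X x V s])
        then show "c = d"
          unfolding V(1) W(1) germ_rst[OF X W(2) x(2) W(4) VU(1)[OF W(2,4)] Int_lower1] .
      qed
      show "restrict_germ U ` carrier (stalk X x) = carrier (stalk (open_sub X U) x)"
      proof (intro equalityI subsetI)
        fix c assume "c \<in> restrict_germ U ` carrier (stalk X x)"
        then show "c \<in> carrier (stalk (open_sub X U) x)" using in_stalk by blast
      next
        fix c assume "c \<in> carrier (stalk (open_sub X U) x)"
        then obtain V s where V: "c = germ (open_sub X U) x V s" "open_in X V" "V \<subseteq> U" "x \<in> V"
            "s \<in> carrier (sect X V)"
          by (elim stalkE) (auto simp: openin_open_subtopology[OF U(1)])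
        have "restrict_germ U (germ X x V s) = c"
          using V(3) ringed_space_id[OF X V(2,5)] by (simp add: restrict[OF V(2,5)] V(1) Int_absorb2)
        then show "c \<in> restrict_germ U ` carrier (stalk X x)"
          using stalkI[OF V(2,4,5)] by blast
      qed
    qed
  qed
  show "restrict_germ U \<zero>\<^bsub>stalk X x\<^esub> = \<zero>\<^bsub>stalk (open_sub X U) x\<^esub>"
    using restrict[OF top(1) cring.cring_simprules(2)[OF ringed_space_cring[OF X top(1)]]]
      zero[OF top(1) U(1)] top(2) openin_subset[OF U(1)]
    by (simp add: stalk_def topspace_open_sub[OF U(1)] del: topspace_subtopology)
qed

lemma lrs_ringed_space: "lrs X \<Longrightarrow> ringed_space X"
  by (simp add: lrs_def)

lemma lrs_stalk_cring: "lrs X \<Longrightarrow> open_in X U \<Longrightarrow> x \<in> U \<Longrightarrow> local_ring (stalk X x)"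
  using openin_subset by (fastforce simp: lrs_def)

lemma lrs_open_sub:
  assumes X: "lrs X" and U: "open_in X U"
  shows "lrs (open_sub X U)"
proof -
  note X' = lrs_ringed_space[OF X]
  have "local_ring (stalk (open_sub X U) x)" if x: "x \<in> U" for x
  proof (rule local_ring_iso)
    show R: "local_ring (stalk X x)" by (rule lrs_stalk_cring[OF X U x])
    show iso: "restrict_germ U \<in> ring_iso (stalk X x) (stalk (open_sub X U) x)"
      by (rule restrict_germ_iso(1)[OF X' U x])
    \<comment> \<open>Transport along the isomorphism gives a ring whose zero is the image of zero;
      the separate fact about zero shows that it is the stalk itself.\<close>
    have "cring ((stalk (open_sub X U) x)\<lparr>ring.zero := restrict_germ U \<zero>\<^bsub>stalk X x\<^esub>\<rparr>)"
      using cring.ring_iso_imp_img_cring[OF _ iso] R by (simp add: local_ring_def)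
    then show "cring (stalk (open_sub X U) x)"
      unfolding restrict_germ_iso(2)[OF X' U x] by simp
  qed
  then show ?thesis
    using ringed_space_open_sub[OF X' U] by (simp add: lrs_def topspace_open_sub[OF U] del: topspace_subtopology)
qed

section \<open>Restriction of morphisms to open subspaces\<close>

definition ringed_map :: "('x, 'r) rspace \<Rightarrow> ('y, 's) rspace \<Rightarrow> ('x, 'r, 'y, 's) rmap \<Rightarrow> bool" where
  "ringed_map X Y = (\<lambda>(f, h). ringed_space X \<and> ringed_space Y \<and>
     (\<forall>V. open_in Y V \<longrightarrow> open_in X (preim X f V) \<and>
        h V \<in> ring_hom (sect Y V) (sect X (preim X f V))) \<and>
     (\<forall>V W. open_in Y V \<and> open_in Y W \<and> W \<subseteq> V \<longrightarrow>
        (\<forall>s\<in>carrier (sect Y V). h W (rst Y V W s) = rst X (preim X f V) (preim X f W) (h V s))))"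

text \<open>Separates \<open>ringed_map\<close>, which is enough to compute with germs, from
  extensionality, continuity and locality.\<close>

lemma lrs_map_iff:
  "lrs_map X Y (f, h) \<longleftrightarrow> lrs X \<and> lrs Y \<and> ringed_map X Y (f, h) \<and>
     f \<in> extensional (topspace (top_of X)) \<and> continuous_map (top_of X) (top_of Y) f \<and>
     (\<forall>V. if open_in Y V then h V \<in> extensional (carrier (sect Y V)) else h V = undefined) \<and>
     (\<forall>x\<in>topspace (top_of X). \<forall>c\<in>carrier (stalk Y (f x)).
        stalk_map X (f, h) x c \<in> Units (stalk X x) \<longrightarrow> c \<in> Units (stalk Y (f x)))" (is "?L \<longleftrightarrow> ?R")
proof
  assume L: ?L
  then have cont: "continuous_map (top_of X) (top_of Y) f" by (simp add: lrs_map_def)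
  have "open_in X (preim X f V)" if "open_in Y V" for V
    using openin_continuous_map_preimage[OF cont that] by (simp add: preim_def)
  with L show ?R
    by (auto simp: lrs_map_def ringed_map_def lrs_def split: if_splits)
next
  assume ?R
  then show ?L
    by (auto simp: lrs_map_def ringed_map_def split: if_splits)
qed

lemma
  assumes "ringed_map X Y (f, h)" "open_in Y V"
  shows ringed_map_open: "open_in X (preim X f V)"
    and ringed_map_hom: "h V \<in> ring_hom (sect Y V) (sect X (preim X f V))"
    and ringed_map_rst: "open_in Y W \<Longrightarrow> W \<subseteq> V \<Longrightarrow> s \<in> carrier (sect Y V) \<Longrightarrow>
      h W (rst Y V W s) = rst X (preim X f V) (preim X f W) (h V s)"
  using assms by (auto simp: ringed_map_def)

lemma ringed_map_in:
  "ringed_map X Y (f, h) \<Longrightarrow> open_in Y V \<Longrightarrow> s \<in> carrier (sect Y V) \<Longrightarrow>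
    h V s \<in> carrier (sect X (preim X f V))"
  by (rule ring_hom_closed[OF ringed_map_hom])

text \<open>Compatibility with restriction carries a witness for two representatives to its
  preimage, so the union over representatives collapses.\<close>

lemma stalk_map_germ:
  assumes fh: "ringed_map X Y (f, h)" and x: "x \<in> topspace (top_of X)"
    and W: "open_in Y W" "f x \<in> W" "s \<in> carrier (sect Y W)"
  shows "stalk_map X (f, h) x (germ Y (f x) W s) = germ X x (preim X f W) (h W s)"
proof -
  have X: "ringed_space X" and Y: "ringed_space Y" using fh by (auto simp: ringed_map_def)
  have "stalk_map X (f, h) x (germ Y (f x) W s) =
    (\<Union>(V, t)\<in>germ Y (f x) W s. germ X x (preim X f V) (h V t))"
    by (simp add: stalk_map_def)
  also have "\<dots> = (case (W, s) of (V, t) \<Rightarrow> germ X x (preim X f V) (h V t))"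
  proof (rule UN_constant_eq[OF germ_self[OF W]], intro ballI)
    fix c assume "c \<in> germ Y (f x) W s"
    then obtain V t Z where c: "c = (V, t)" and V: "open_in Y V" "f x \<in> V" "t \<in> carrier (sect Y V)"
      and Z: "open_in Y Z" "f x \<in> Z" "Z \<subseteq> W" "Z \<subseteq> V" "rst Y W Z s = rst Y V Z t"
      by (auto simp: germ_def)
    have p: "x \<in> preim X f W" "x \<in> preim X f V" "x \<in> preim X f Z" "preim X f Z \<subseteq> preim X f V \<inter> preim X f W"
      using x W V Z by (auto simp: preim_def)
    have "rst X (preim X f V) (preim X f Z) (h V t) = rst X (preim X f W) (preim X f Z) (h W s)"
      using ringed_map_rst[OF fh W(1) Z(1,3) W(3)] ringed_map_rst[OF fh V(1) Z(1,4) V(3)] Z(5) by simp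
    then have "germ X x (preim X f V) (h V t) = germ X x (preim X f W) (h W s)"
      using germ_eq[OF X ringed_map_open[OF fh V(1)] p(2) ringed_map_in[OF fh V(1,3)]
          ringed_map_open[OF fh W(1)] p(1) ringed_map_in[OF fh W(1,3)]]
        ringed_map_open[OF fh Z(1)] p(3,4) by blast
    then show "(case c of (V, t) \<Rightarrow> germ X x (preim X f V) (h V t)) =
      (case (W, s) of (V, t) \<Rightarrow> germ X x (preim X f V) (h V t))" by (simp add: c)
  qed
  finally show ?thesis by simp
qed

text \<open>The section maps stay the same, because sections of an open subspace are sections of the
  whole space; on sets that are not open subsets of \<open>V\<close> they are reset to
  \<open>undefined\<close>, as \<open>lrs_map\<close> demands.\<close>

definition restrict_rmap :: "('x, 'r) rspace \<Rightarrow> ('y, 's) rspace \<Rightarrow> 'y set \<Rightarrow> ('x, 'r, 'y, 's) rmap \<Rightarrow> ('x, 'r, 'y, 's) rmap" where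
  "restrict_rmap X Y V = (\<lambda>(f, h). (restrict f (preim X f V),
     \<lambda>W. if open_in Y W \<and> W \<subseteq> V then h W else undefined))"

lemma preim_restrict:
  assumes "open_in X (preim X f V)" "W \<subseteq> V"
  shows "preim (open_sub X (preim X f V)) (restrict f (preim X f V)) W = preim X f W"
  using assms(2) unfolding preim_def[of "open_sub _ _"] open_sub_simps topspace_open_sub[OF assms(1)]
  by (auto simp: preim_def)

text \<open>Locality is the condition that is not formal. Germs of the subspaces are lifted to the
  whole spaces through \<open>restrict_germ\<close>, which preserves and reflects units, and there
  the locality of the given morphism applies.\<close>

lemma lrs_map_restrict:
  assumes \<phi>: "lrs_map X Y (f, h)" and V: "open_in Y V"
  shows "lrs_map (open_sub X (preim X f V)) (open_sub Y V) (restrict_rmap X Y V (f, h))"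
proof -
  have fh: "ringed_map X Y (f, h)" and X: "lrs X" and Y: "lrs Y"
    and cont: "continuous_map (top_of X) (top_of Y) f"
    using \<phi> by (simp_all add: lrs_map_iff)
  let ?U = "preim X f V"
  let ?X = "open_sub X ?U" and ?Y = "open_sub Y V"
  let ?f = "restrict f ?U" and ?h = "\<lambda>W. if open_in Y W \<and> W \<subseteq> V then h W else undefined"
  have U: "open_in X ?U" by (rule ringed_map_open[OF fh V])
  note top = topspace_open_sub[OF U] and openU = openin_open_subtopology[OF U] and openV = openin_open_subtopology[OF V]
  have mono: "preim X f W \<subseteq> preim X f W'" if "W \<subseteq> W'" for W W'
    using that by (auto simp: preim_def)
  have rm: "ringed_map ?X ?Y (?f, ?h)"
    unfolding ringed_map_def open_sub_simps prod.case
  proof (intro conjI allI impI ballI)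
    show "ringed_space ?X" "ringed_space ?Y"
      using lrs_open_sub[OF X U] lrs_open_sub[OF Y V] by (simp_all add: lrs_def)
    fix W assume W: "openin (subtopology (top_of Y) V) W"
    then show "openin (subtopology (top_of X) ?U) (preim ?X ?f W)"
      using ringed_map_open[OF fh, of W] mono[of W V] by (simp add: openV openU preim_restrict[OF U])
    show "?h W \<in> ring_hom (sect Y W) (sect X (preim ?X ?f W))"
      using W ringed_map_hom[OF fh, of W] by (simp add: openV preim_restrict[OF U])
  next
    fix W W' s assume "openin (subtopology (top_of Y) V) W \<and> openin (subtopology (top_of Y) V) W' \<and> W' \<subseteq> W"
      and "s \<in> carrier (sect Y W)"
    then show "?h W' (rst Y W W' s) = rst X (preim ?X ?f W) (preim ?X ?f W') (?h W s)"
      using ringed_map_rst[OF fh, of W W' s] by (simp add: openV preim_restrict[OF U])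
  qed
  have local: "c \<in> Units (stalk ?Y (?f x))"
    if x: "x \<in> ?U" and c: "c \<in> carrier (stalk ?Y (?f x))" and unit: "stalk_map ?X (?f, ?h) x c \<in> Units (stalk ?X x)" for x c
  proof -
    have x': "x \<in> topspace (top_of X)" "f x \<in> V" using x by (auto simp: preim_def)
    have fx: "?f x = f x" using x by simp
    obtain W s where c': "c = germ ?Y (?f x) W s" and W': "open_in ?Y W" "?f x \<in> W" "s \<in> carrier (sect ?Y W)"
      using c by (rule stalkE)
    have W: "open_in Y W" "W \<subseteq> V" "f x \<in> W" "s \<in> carrier (sect Y W)"
      using W' fx by (simp_all add: openV)
    have W_V: "W \<inter> V = W" using W(2) by blast
    \<comment> \<open>The same germ, taken in the whole space \<open>Y\<close>.\<close>
    let ?d = "germ Y (f x) W s"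
    have c_d: "restrict_germ V ?d = c"
      unfolding restrict_germ[OF lrs_ringed_space[OF Y] V x'(2) W(1,4)] W_V
        ringed_space_id[OF lrs_ringed_space[OF Y] W(1,4)] c' fx ..
    have d: "?d \<in> carrier (stalk Y (f x))" by (rule stalkI[OF W(1,3,4)])
    have P: "open_in X (preim X f W)" "preim X f W \<inter> ?U = preim X f W" "x \<in> preim X f W"
      using ringed_map_open[OF fh W(1)] mono[OF W(2)] x' W(3) by (auto simp: preim_def)
    note hWs = ringed_map_in[OF fh W(1,4)]
    have xtop: "x \<in> topspace (top_of ?X)" using x by (simp add: top del: topspace_subtopology)
    have "stalk_map ?X (?f, ?h) x c = germ ?X x (preim X f W) (h W s)"
      unfolding c' stalk_map_germ[OF rm xtop W'] using W by (simp add: preim_restrict[OF U W(2)])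
    also have "\<dots> = restrict_germ ?U (germ X x (preim X f W) (h W s))"
      unfolding restrict_germ[OF lrs_ringed_space[OF X] U x P(1) hWs] P(2)
        ringed_space_id[OF lrs_ringed_space[OF X] P(1) hWs] ..
    finally have "stalk_map ?X (?f, ?h) x c = restrict_germ ?U (germ X x (preim X f W) (h W s))" .
    moreover have "germ X x (preim X f W) (h W s) \<in> carrier (stalk X x)"
      by (rule stalkI[OF P(1,3) hWs])
    moreover have "ring (stalk X x)" "ring (stalk Y (f x))"
      using lrs_stalk_cring[OF X U x] lrs_stalk_cring[OF Y V x'(2)] by (simp_all add: local_ring_def cring_def)
    ultimately have "germ X x (preim X f W) (h W s) \<in> Units (stalk X x)"
      using unit Units_ring_iso[OF _ restrict_germ_iso(1)[OF lrs_ringed_space[OF X] U x]] by simp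
    then have "stalk_map X (f, h) x ?d \<in> Units (stalk X x)"
      by (simp add: stalk_map_germ[OF fh x'(1) W(1,3,4)])
    then have "?d \<in> Units (stalk Y (f x))"
      using \<phi> x'(1) d by (simp add: lrs_map_iff)
    then have "restrict_germ V ?d \<in> Units (stalk ?Y (f x))"
      by (rule ring_iso_Units[OF restrict_germ_iso(1)[OF lrs_ringed_space[OF Y] V x'(2)]])
    with c_d fx show ?thesis by simp
  qed
  have "continuous_map (subtopology (top_of X) ?U) (subtopology (top_of Y) V) ?f"
  proof -
    have "continuous_map (subtopology (top_of X) ?U) (subtopology (top_of Y) V) f"
      using cont by (auto simp: continuous_map_in_subtopology continuous_map_from_subtopology preim_def)
    then show ?thesis
      by (rule continuous_map_eq) (simp add: top del: topspace_subtopology)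
  qed
  then show ?thesis
    using lrs_open_sub[OF X U] lrs_open_sub[OF Y V] rm local \<phi>
    unfolding restrict_rmap_def prod.case lrs_map_iff open_sub_simps top openV by auto
qed

lemma preim_open_incl:
  assumes "open_in X U" "V \<subseteq> topspace (top_of X)"
  shows "preim (open_sub X U) (\<lambda>x\<in>U. x) V = V \<inter> U"
  unfolding preim_def open_sub_simps topspace_open_sub[OF assms(1)] by auto

text \<open>On stalks the inclusion is \<open>restrict_germ\<close>, an isomorphism, so it reflects
  units.\<close>

lemma lrs_map_open_incl:
  assumes X: "lrs X" and U: "open_in X U"
  shows "lrs_map (open_sub X U) X (open_incl X U)"
proof -
  let ?X = "open_sub X U" and ?f = "\<lambda>x\<in>U. x"
  let ?h = "\<lambda>V. if open_in X V then \<lambda>s\<in>carrier (sect X V). rst X V (V \<inter> U) s else undefined"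
  note rs = lrs_ringed_space[OF X]
  note top = topspace_open_sub[OF U] and openU = openin_open_subtopology[OF U]
  have p: "preim ?X ?f V = V \<inter> U" if "open_in X V" for V
    by (rule preim_open_incl[OF U openin_subset[OF that]])
  have VU: "open_in X (V \<inter> U)" if "open_in X V" for V
    using that U by (rule openin_Int)
  have rm: "ringed_map ?X X (?f, ?h)"
    unfolding ringed_map_def open_sub_simps prod.case
  proof (intro conjI allI impI ballI)
    show "ringed_space ?X" by (rule ringed_space_open_sub[OF rs U])
    show "ringed_space X" by (rule rs)
    fix V assume V: "open_in X V"
    show "openin (subtopology (top_of X) U) (preim ?X ?f V)"
      using VU[OF V] by (simp add: p[OF V] openU)
    have "ring (sect X V)" using ringed_space_cring[OF rs V] by (simp add: cring_def)
    from ring.ring_hom_restrict[OF this ringed_space_hom[OF rs V VU[OF V] Int_lower1],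
        of "restrict (rst X V (V \<inter> U)) (carrier (sect X V))"]
    show "?h V \<in> ring_hom (sect X V) (sect X (preim ?X ?f V))"
      unfolding p[OF V]
      using V by simp
  next
    fix V W s assume VW: "open_in X V \<and> open_in X W \<and> W \<subseteq> V" and s: "s \<in> carrier (sect X V)"
    then have V: "open_in X V" and W: "open_in X W" and WV: "W \<subseteq> V" by auto
    have "W \<inter> U \<subseteq> V \<inter> U" using WV by blast
    then show "?h W (rst X V W s) = rst X (preim ?X ?f V) (preim ?X ?f W) (?h V s)"
      using V W s ringed_space_rst_in[OF rs V W WV s] ringed_space_trans[OF rs V W VU[OF W] Int_lower1 WV s]
        ringed_space_trans[OF rs V VU[OF V] VU[OF W] _ Int_lower1 s]
      by (simp add: p)
  qed
  have local: "c \<in> Units (stalk X (?f x))"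
    if x: "x \<in> U" and c: "c \<in> carrier (stalk X (?f x))" and unit: "stalk_map ?X (?f, ?h) x c \<in> Units (stalk ?X x)" for x c
  proof -
    have fx: "?f x = x" using x by simp
    have c0: "c \<in> carrier (stalk X x)" using c fx by simp
    obtain V s where c': "c = germ X (?f x) V s" and V: "open_in X V" "?f x \<in> V" "s \<in> carrier (sect X V)"
      using c by (rule stalkE)
    have xtop: "x \<in> topspace (top_of ?X)" using x by (simp add: top del: topspace_subtopology)
    have "stalk_map ?X (?f, ?h) x c = restrict_germ U (germ X x V s)"
      unfolding c' stalk_map_germ[OF rm xtop V] restrict_germ[OF rs U x V(1,3)] p[OF V(1)] using V by simp
    then have "restrict_germ U c \<in> Units (stalk ?X x)" using unit c' fx by simp
    moreover have "ring (stalk X x)"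
      using lrs_stalk_cring[OF X U x] by (simp add: local_ring_def cring_def)
    ultimately show ?thesis
      using Units_ring_iso[OF _ restrict_germ_iso(1)[OF rs U x] c0] fx by simp
  qed
  have "continuous_map (subtopology (top_of X) U) (top_of X) ?f"
    by (rule continuous_map_eq[OF continuous_map_from_subtopology[OF continuous_map_id]])
      (simp add: top del: topspace_subtopology)
  then show ?thesis
    using lrs_open_sub[OF X U] X rm local
    unfolding open_incl_def lrs_map_iff open_sub_simps top by auto
qed

text \<open>Makes identity arrows literally inclusions, so that they belong to the system of
  neighbourhoods of a point.\<close>

lemma open_incl_topspace:
  assumes "ringed_space X"
  shows "open_incl X (topspace (top_of X)) = rmap_id X"
proof -
  have "(\<lambda>s\<in>carrier (sect X V). rst X V (V \<inter> topspace (top_of X)) s) = (\<lambda>s\<in>carrier (sect X V). s)"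
    if "open_in X V" for V
    using ringed_space_id[OF assms that] openin_subset[OF that]
    by (intro restrict_ext) (simp add: Int_absorb2)
  then show ?thesis by (auto simp: open_incl_def rmap_id_def)
qed

lemma open_incl_comp:
  assumes X: "ringed_space X" and U: "open_in X U" and V: "open_in X V" "V \<subseteq> U"
  shows "rmap_comp (open_sub X V) (open_sub X U) X (open_incl X U) (open_incl (open_sub X U) V) = open_incl X V"
proof -
  let ?f = "\<lambda>x\<in>U. x"
  have "(\<lambda>s\<in>carrier (sect X W). (\<lambda>s\<in>carrier (sect X (W \<inter> U)). rst X (W \<inter> U) (W \<inter> U \<inter> V) s) (rst X W (W \<inter> U) s)) =
    (\<lambda>s\<in>carrier (sect X W). rst X W (W \<inter> V) s)" if W: "open_in X W" for W
  proof (rule restrict_ext)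
    fix s assume s: "s \<in> carrier (sect X W)"
    have WU: "open_in X (W \<inter> U)" and WV: "open_in X (W \<inter> V)"
      using W U V(1) by (auto intro: openin_Int)
    have eq: "W \<inter> U \<inter> V = W \<inter> V" and sub: "W \<inter> V \<subseteq> W \<inter> U" using V(2) by auto
    show "(\<lambda>s\<in>carrier (sect X (W \<inter> U)). rst X (W \<inter> U) (W \<inter> U \<inter> V) s) (rst X W (W \<inter> U) s) = rst X W (W \<inter> V) s"
      unfolding eq using ringed_space_rst_in[OF X W WU Int_lower1 s] ringed_space_trans[OF X W WU WV sub Int_lower1 s]
      by simp
  qed
  moreover have "preim (open_sub X U) ?f W = W \<inter> U" if "open_in X W" for W
    by (rule preim_open_incl[OF U openin_subset[OF that]])
  moreover have "open_in X (W \<inter> U)" if "open_in X W" for W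
    using that U by (rule openin_Int)
  moreover have "(\<lambda>x\<in>V. ?f ((\<lambda>x\<in>V. x) x)) = (\<lambda>x\<in>V. x)"
    using V(2) by (intro restrict_ext) auto
  ultimately show ?thesis
    unfolding rmap_comp_def open_incl_def prod.case open_sub_simps topspace_open_sub[OF V(1)]
      openin_open_subtopology[OF U]
    by (auto intro!: ext cong: restrict_cong)
qed

text \<open>The commuting square of a morphism and its restriction over \<open>V\<close>. It serves
  to factor a morphism, restricted to the preimage of a covering open set, through the covering
  inclusion.\<close>

lemma restrict_rmap_incl:
  assumes \<phi>: "lrs_map X Y (f, h)" and V: "open_in Y V"
  shows "rmap_comp (open_sub X (preim X f V)) X Y (f, h) (open_incl X (preim X f V)) =
    rmap_comp (open_sub X (preim X f V)) (open_sub Y V) Y (open_incl Y V) (restrict_rmap X Y V (f, h))"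
proof -
  let ?U = "preim X f V"
  have fh: "ringed_map X Y (f, h)" using \<phi> by (simp add: lrs_map_iff)
  have U: "open_in X ?U" by (rule ringed_map_open[OF fh V])
  have "(\<lambda>s\<in>carrier (sect Y W). (\<lambda>s\<in>carrier (sect X (preim X f W)). rst X (preim X f W) (preim X f W \<inter> ?U) s) (h W s)) =
    (\<lambda>s\<in>carrier (sect Y W). h (W \<inter> V) ((\<lambda>s\<in>carrier (sect Y W). rst Y W (W \<inter> V) s) s))"
    if W: "open_in Y W" for W
  proof (rule restrict_ext)
    fix s assume s: "s \<in> carrier (sect Y W)"
    have WV: "open_in Y (W \<inter> V)" using W V by (rule openin_Int)
    have "preim X f (W \<inter> V) = preim X f W \<inter> ?U" by (auto simp: preim_def)
    then show "(\<lambda>s\<in>carrier (sect X (preim X f W)). rst X (preim X f W) (preim X f W \<inter> ?U) s) (h W s) =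
      h (W \<inter> V) ((\<lambda>s\<in>carrier (sect Y W). rst Y W (W \<inter> V) s) s)"
      using ringed_map_rst[OF fh W WV Int_lower1 s] ringed_map_in[OF fh W s] s by simp
  qed
  moreover have "preim (open_sub Y V) (\<lambda>x\<in>V. x) W = W \<inter> V" if "open_in Y W" for W
    by (rule preim_open_incl[OF V openin_subset[OF that]])
  moreover have "open_in Y (W \<inter> V)" if "open_in Y W" for W
    using that V by (rule openin_Int)
  moreover have "open_in X (preim X f W)" if "open_in Y W" for W
    by (rule ringed_map_open[OF fh that])
  moreover have "(\<lambda>x\<in>?U. f ((\<lambda>x\<in>?U. x) x)) = (\<lambda>x\<in>?U. (\<lambda>x\<in>V. x) (restrict f ?U x))"
    by (intro restrict_ext) (simp add: preim_def)
  ultimately show ?thesis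
    unfolding rmap_comp_def open_incl_def restrict_rmap_def prod.case open_sub_simps topspace_open_sub[OF U]
    by (auto intro!: ext cong: restrict_cong)
qed

text \<open>Serves to shrink charts; \<open>preim Y g U\<close> is the image of \<open>U\<close>
  under \<open>f\<close>. The equations between morphisms are read as equations for points and for
  sections, which then hold on the smaller sets as well.\<close>

lemma lrs_inverse_restrict:
  assumes inv: "lrs_inverse X Y (f, h) (g, k)" and U: "open_in X U"
  shows "lrs_inverse (open_sub X U) (open_sub Y (preim Y g U))
    (restrict_rmap X Y (preim Y g U) (f, h)) (restrict_rmap Y X U (g, k))"
    and "preim X f (preim Y g U) = U"
proof -
  let ?V = "preim Y g U"
  have \<phi>: "lrs_map X Y (f, h)" and \<psi>: "lrs_map Y X (g, k)"
    and gf: "rmap_comp X Y X (g, k) (f, h) = rmap_id X" and fg: "rmap_comp Y X Y (f, h) (g, k) = rmap_id Y"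
    using inv by (simp_all add: lrs_inverse_def)
  have fh: "ringed_map X Y (f, h)" and gk: "ringed_map Y X (g, k)"
    using \<phi> \<psi> by (simp_all add: lrs_map_iff)
  have f_in: "f x \<in> topspace (top_of Y)" if "x \<in> topspace (top_of X)" for x
    using \<phi> that by (auto simp: lrs_map_iff continuous_map_def)
  have gf_pt: "g (f x) = x" if "x \<in> topspace (top_of X)" for x
    using fun_cong[OF arg_cong[OF gf, of fst], of x] that by (simp add: rmap_comp_def rmap_id_def)
  have fg_pt: "f (g y) = y" if "y \<in> topspace (top_of Y)" for y
    using fun_cong[OF arg_cong[OF fg, of fst], of y] that by (simp add: rmap_comp_def rmap_id_def)
  have gf_sect: "h (preim Y g W) (k W s) = s" if "open_in X W" "s \<in> carrier (sect X W)" for W s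
    using fun_cong[OF fun_cong[OF arg_cong[OF gf, of snd], of W], of s] that by (simp add: rmap_comp_def rmap_id_def)
  have fg_sect: "k (preim X f W) (h W s) = s" if "open_in Y W" "s \<in> carrier (sect Y W)" for W s
    using fun_cong[OF fun_cong[OF arg_cong[OF fg, of snd], of W], of s] that by (simp add: rmap_comp_def rmap_id_def)
  have U_sub: "U \<subseteq> topspace (top_of X)" by (rule openin_subset[OF U])
  show eq: "preim X f ?V = U"
    using gf_pt f_in U_sub by (auto simp: preim_def)
  have V: "open_in Y ?V" by (rule ringed_map_open[OF gk U])
  note topU = topspace_open_sub[OF U] and topV = topspace_open_sub[OF V]
  note openU = openin_open_subtopology[OF U] and openV = openin_open_subtopology[OF V]
  have UV: "f x \<in> ?V" if "x \<in> U" for x using that eq by (auto simp: preim_def)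
  have VU: "g y \<in> U" if "y \<in> ?V" for y using that by (auto simp: preim_def)
  have V_sub: "?V \<subseteq> topspace (top_of Y)" by (rule openin_subset[OF V])
  have p: "preim (open_sub Y ?V) (restrict g ?V) W = preim Y g W" "open_in Y (preim Y g W)" "preim Y g W \<subseteq> ?V"
    if "open_in X W" "W \<subseteq> U" for W
    using preim_restrict[OF V that(2)] ringed_map_open[OF gk that(1)] that(2) by (auto simp: preim_def)
  have q: "preim (open_sub X U) (restrict f U) W = preim X f W" "open_in X (preim X f W)" "preim X f W \<subseteq> U"
    if "open_in Y W" "W \<subseteq> ?V" for W
    using preim_restrict[of X f ?V W] U that(2) ringed_map_open[OF fh that(1)] unfolding eq
    using eq by (auto simp: preim_def)
  show "lrs_inverse (open_sub X U) (open_sub Y ?V) (restrict_rmap X Y ?V (f, h)) (restrict_rmap Y X U (g, k))"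
    unfolding lrs_inverse_def
  proof (intro conjI)
    show "lrs_map (open_sub X U) (open_sub Y ?V) (restrict_rmap X Y ?V (f, h))"
      using lrs_map_restrict[OF \<phi> V] unfolding eq .
    show "lrs_map (open_sub Y ?V) (open_sub X U) (restrict_rmap Y X U (g, k))"
      by (rule lrs_map_restrict[OF \<psi> U])
    show "rmap_comp (open_sub X U) (open_sub Y ?V) (open_sub X U) (restrict_rmap Y X U (g, k)) (restrict_rmap X Y ?V (f, h)) =
      rmap_id (open_sub X U)"
      unfolding rmap_comp_def rmap_id_def restrict_rmap_def prod.case eq open_sub_simps topU openU
      using UV U_sub gf_pt gf_sect p by (auto intro!: ext simp: subset_iff)
    show "rmap_comp (open_sub Y ?V) (open_sub X U) (open_sub Y ?V) (restrict_rmap X Y ?V (f, h)) (restrict_rmap Y X U (g, k)) =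
      rmap_id (open_sub Y ?V)"
      unfolding rmap_comp_def rmap_id_def restrict_rmap_def prod.case eq open_sub_simps topV openV
      using VU V_sub fg_pt fg_sect q by (auto intro!: ext simp: subset_iff)
  qed
qed

section \<open>Points of the site of complex spaces\<close>

lemma complex_spaceE:
  assumes "complex_space M"
  obtains Z c where "M = (Z, CAlg c)" "lrs Z" "Hausdorff_space (top_of Z)"
    "c \<in> ring_hom complex_ring (sect Z (topspace (top_of Z)))"
    "\<And>z. c z \<in> carrier (sect Z (topspace (top_of Z)))"
proof -
  obtain Z c where "M = (Z, CAlg c)" "lrs Z" "Hausdorff_space (top_of Z)"
    and c: "c \<in> ring_hom complex_ring (sect Z (topspace (top_of Z)))"
    using assms unfolding complex_space_def by blast
  moreover have "c z \<in> carrier (sect Z (topspace (top_of Z)))" for z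
    using ring_hom_closed[OF c, of z] by (simp add: complex_ring_def)
  ultimately show thesis by (rule that)
qed

lemma fst_open_sub_space [simp]: "fst (open_sub_space M U) = open_sub (fst M) U"
  by (simp add: open_sub_space_def)

lemma open_sub_space_CAlg:
  "open_sub_space (Z, CAlg c) U = (open_sub Z U, CAlg (\<lambda>z. rst Z (topspace (top_of Z)) U (c z)))"
  by (simp add: open_sub_space_def)

text \<open>Holds as an equation, not just up to isomorphism: that makes inclusions of nested
  neighbourhoods composable in the site.\<close>

lemma open_sub_space_open_sub_space:
  assumes M: "complex_space M" and U: "open_in (fst M) U" and V: "open_in (fst M) V" "V \<subseteq> U"
  shows "open_sub_space (open_sub_space M U) V = open_sub_space M V"
proof -
  obtain Z c where Z: "M = (Z, CAlg c)" "lrs Z" "\<And>z. c z \<in> carrier (sect Z (topspace (top_of Z)))"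
    by (rule complex_spaceE[OF M]) (blast intro: that)
  have U': "open_in Z U" and V': "open_in Z V" using U V Z(1) by simp_all
  have "rst Z U V (rst Z (topspace (top_of Z)) U (c z)) = rst Z (topspace (top_of Z)) V (c z)" for z
    by (rule ringed_space_trans[OF lrs_ringed_space[OF Z(2)] openin_topspace U' V' V(2) openin_subset[OF U'] Z(3)])
  then show ?thesis
    unfolding Z(1) open_sub_space_CAlg open_sub_open_sub[OF V(2)] open_sub_simps topspace_open_sub[OF U'] by simp
qed

lemma open_sub_space_topspace:
  assumes M: "complex_space M"
  shows "open_sub_space M (topspace (top_of (fst M))) = M"
proof -
  obtain Z c where Z: "M = (Z, CAlg c)" "lrs Z" "\<And>z. c z \<in> carrier (sect Z (topspace (top_of Z)))"
    by (rule complex_spaceE[OF M]) (blast intro: that)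
  have "open_sub Z (topspace (top_of Z)) = Z"
    by (simp add: open_sub_def subtopology_topspace)
  then show ?thesis
    unfolding Z(1) using ringed_space_id[OF lrs_ringed_space[OF Z(2)] openin_topspace Z(3)]
    by (simp add: open_sub_space_CAlg)
qed

text \<open>An open set is recovered as the underlying set of its subspace. So objects determine
  neighbourhoods, and there is at most one inclusion from one object to another.\<close>

lemma open_sub_space_inj:
  assumes "open_in (fst M) U" "open_in (fst M) V" "open_sub_space M U = open_sub_space M V"
  shows "U = V"
  using arg_cong[OF assms(3), of "\<lambda>M. topspace (top_of (fst M))"]
  unfolding fst_open_sub_space open_sub_simps topspace_open_sub[OF assms(1)] topspace_open_sub[OF assms(2)] .

section \<open>Open subspaces of complex spaces\<close>

lemma holo_subset:
  "holo n D f \<Longrightarrow> openin (Cn n) D' \<Longrightarrow> D' \<subseteq> D \<Longrightarrow> holo n D' f"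
  using continuous_map_from_subtopology_mono by (fastforce simp: holo_def)

text \<open>The equations \<open>F\<close> stay the same and only the ambient domain shrinks; the
  section rings of a local model depend on \<open>n\<close> and \<open>F\<close> but not on
  \<open>D\<close>.\<close>

lemma open_sub_local_model:
  "open_sub (local_model n D F) (zero_locus D F \<inter> T) = local_model n (D \<inter> T) F"
proof -
  have "zero_locus D F \<inter> T = zero_locus (D \<inter> T) F" "zero_locus D F \<inter> zero_locus (D \<inter> T) F = zero_locus (D \<inter> T) F"
    by (auto simp: zero_locus_def)
  then show ?thesis by (simp add: open_sub_def local_model_def subtopology_subtopology)
qed

text \<open>The work is in the charts. A chart on \<open>U\<close> is cut down to the intersection
  of \<open>U\<close> and \<open>N\<close>. The matching open subset of the model is its trace on an
  open set \<open>T\<close> of complex \<open>n\<close>-space, so it is the local model over the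
  intersection of \<open>D\<close> and \<open>T\<close> with the same equations.\<close>

lemma complex_space_open_sub:
  assumes M: "complex_space M" and N: "open_in (fst M) N"
  shows "complex_space (open_sub_space M N)"
proof -
  obtain Z c where Z: "M = (Z, CAlg c)" "lrs Z" "Hausdorff_space (top_of Z)"
    and c: "c \<in> ring_hom complex_ring (sect Z (topspace (top_of Z)))" "\<And>z. c z \<in> carrier (sect Z (topspace (top_of Z)))"
    by (rule complex_spaceE[OF M]) (blast intro: that)
  note rs = lrs_ringed_space[OF Z(2)]
  have N': "open_in Z N" using N Z(1) by simp
  note topN = topspace_open_sub[OF N'] and openN = openin_open_subtopology[OF N']
  let ?top = "topspace (top_of Z)"
  let ?c = "\<lambda>U z. rst Z ?top U (c z)"
  have charts: "\<exists>U n D F. open_in Z U \<and> x \<in> U \<and>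
        openin (Cn n) D \<and> finite F \<and> (\<forall>f\<in>F. holo n D f) \<and>
        calg_iso (open_sub Z U) (?c U) (local_model n D F) (holo_const n F (zero_locus D F))" if "x \<in> ?top" for x
    using M that unfolding Z(1) complex_space_def by blast
  have "\<exists>U n D F. open_in (open_sub Z N) U \<and> x \<in> U \<and>
        openin (Cn n) D \<and> finite F \<and> (\<forall>f\<in>F. holo n D f) \<and>
        calg_iso (open_sub (open_sub Z N) U) (\<lambda>z. rst (open_sub Z N) (topspace (top_of (open_sub Z N))) U (?c N z))
          (local_model n D F) (holo_const n F (zero_locus D F))" if x: "x \<in> N" for x
  proof -
    have "x \<in> ?top" using x openin_subset[OF N'] by blast
    from charts[OF this] obtain U n D F where U: "open_in Z U" "x \<in> U"
      and D: "openin (Cn n) D" "finite F" "\<forall>f\<in>F. holo n D f"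
      and iso: "calg_iso (open_sub Z U) (?c U) (local_model n D F) (holo_const n F (zero_locus D F))"
      by (elim exE conjE) (rule that)
    let ?A = "open_sub Z U" and ?L = "local_model n D F"
    obtain f h g k where inv: "lrs_inverse ?A ?L (f, h) (g, k)"
      and compat: "calg_compatible ?L (?c U) (holo_const n F (zero_locus D F)) (f, h)"
      using iso unfolding calg_iso_def by (elim exE conjE) (metis surj_pair that)
    let ?W = "U \<inter> N"
    have W: "open_in Z ?W" using U(1) N' by (rule openin_Int)
    have W': "open_in ?A ?W" using W by (simp add: openin_open_subtopology[OF U(1)])
    let ?V = "preim ?L g ?W"
    note inv' = lrs_inverse_restrict[OF inv W']
    have fh: "ringed_map ?A ?L (f, h)" and gk: "ringed_map ?L ?A (g, k)"
      using inv by (simp_all add: lrs_inverse_def lrs_map_iff)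
    have V: "open_in ?L ?V" by (rule ringed_map_open[OF gk W'])
    have "openin (subtopology (Cn n) (zero_locus D F)) ?V" using V by (simp add: local_model_def)
    then obtain T where T: "openin (Cn n) T" "?V = zero_locus D F \<inter> T"
      by (auto simp: openin_subtopology Int_commute)
    have D': "openin (Cn n) (D \<inter> T)" using D(1) T(1) by (rule openin_Int)
    have L': "open_sub ?L ?V = local_model n (D \<inter> T) F"
      unfolding T(2) by (rule open_sub_local_model)
    have V_zero: "?V = zero_locus (D \<inter> T) F" unfolding T(2) by (auto simp: zero_locus_def)
    have topL: "topspace (top_of ?L) = zero_locus D F"
      using openin_subset[OF D(1)] by (auto simp: local_model_def zero_locus_def)
    \<comment> \<open>Constants are global sections of the model, so the compatibility of the chart
      with restriction applies to them and carries the algebra structure to the smaller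
      chart.\<close>
    have const_in: "holo_const n F (zero_locus D F) z \<in> carrier (sect ?L (zero_locus D F))" for z
    proof -
      have "holo n (topspace (Cn n)) (\<lambda>_. z)" by (simp add: holo_def)
      then show ?thesis
        using openin_subset[OF D(1)] by (fastforce simp: local_model_def holo_const_def zero_locus_def)
    qed
    have "calg_compatible (open_sub ?L ?V) (?c ?W) (holo_const n F (zero_locus (D \<inter> T) F)) (restrict_rmap ?A ?L ?V (f, h))"
      unfolding calg_compatible_def
    proof
      fix z
      have "topspace (top_of (open_sub ?L ?V)) = ?V" using topspace_open_sub[OF V] by simp
      then have "snd (restrict_rmap ?A ?L ?V (f, h)) (topspace (top_of (open_sub ?L ?V))) (holo_const n F (zero_locus (D \<inter> T) F) z) =
        h ?V (holo_const n F ?V z)"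
        using V by (simp add: restrict_rmap_def V_zero)
      also have "holo_const n F ?V z = rst ?L (zero_locus D F) ?V (holo_const n F (zero_locus D F) z)"
        unfolding T(2) by (auto simp: local_model_def holo_const_def intro!: ext)
      also have "h ?V \<dots> = rst ?A (preim ?A f (zero_locus D F)) (preim ?A f ?V) (h (zero_locus D F) (holo_const n F (zero_locus D F) z))"
        using ringed_map_rst[OF fh _ V _ const_in, of z] openin_topspace[of "top_of ?L"] topL T(2) by auto
      also have "h (zero_locus D F) (holo_const n F (zero_locus D F) z) = ?c U z"
        using compat by (simp add: calg_compatible_def topL)
      also have "preim ?A f (zero_locus D F) = U"
      proof -
        have "continuous_map (top_of ?A) (top_of ?L) f" using inv by (simp add: lrs_inverse_def lrs_map_iff)
        then have "f y \<in> zero_locus D F" if "y \<in> topspace (top_of ?A)" for y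
          using that topL by (auto simp: continuous_map_def)
        then have "preim ?A f (zero_locus D F) = topspace (top_of ?A)" by (auto simp: preim_def)
        then show ?thesis using topspace_open_sub[OF U(1)] by simp
      qed
      also have "preim ?A f ?V = ?W" by (rule inv'(2))
      also have "rst ?A U ?W (?c U z) = ?c ?W z"
        using ringed_space_trans[OF rs openin_topspace U(1) W Int_lower1 openin_subset[OF U(1)] c(2)] by simp
      finally show "snd (restrict_rmap ?A ?L ?V (f, h)) (topspace (top_of (open_sub ?L ?V))) (holo_const n F (zero_locus (D \<inter> T) F) z) = ?c ?W z" .
    qed
    then have "calg_iso (open_sub Z ?W) (?c ?W) (local_model n (D \<inter> T) F) (holo_const n F (zero_locus (D \<inter> T) F))"
      using inv'(1) unfolding calg_iso_def L' open_sub_open_sub[OF Int_lower1] by blast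
    moreover have "rst (open_sub Z N) (topspace (top_of (open_sub Z N))) ?W (?c N z) = ?c ?W z" for z
      using ringed_space_trans[OF rs openin_topspace N' W Int_lower2 openin_subset[OF N'] c(2)] topN by simp
    moreover have "open_in (open_sub Z N) ?W" using W by (simp add: openN)
    moreover have "x \<in> ?W" using x U(2) by blast
    ultimately show ?thesis
      using D(2,3) D' holo_subset[OF _ D' Int_lower1]
      by (intro exI[of _ ?W] exI[of _ n] exI[of _ "D \<inter> T"] exI[of _ F])
        (simp add: open_sub_open_sub[OF Int_lower2])
  qed
  moreover have "(\<lambda>z. ?c N z) \<in> ring_hom complex_ring (sect Z N)"
    using ring_hom_trans[OF c(1) ringed_space_hom[OF rs openin_topspace N' openin_subset[OF N']]] by (simp add: o_def)
  moreover have "Hausdorff_space (subtopology (top_of Z) N)" by (rule Hausdorff_space_subtopology[OF Z(3)])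
  ultimately show ?thesis
    using lrs_open_sub[OF Z(2) N'] topN
    unfolding complex_space_def Z(1) open_sub_space_CAlg by (simp del: topspace_subtopology)
qed

lemma space_cat_simps [simp]:
  "ob (space_cat P) = {X. P X}" "src (space_cat P) \<phi> = fst \<phi>" "tgt (space_cat P) \<phi> = snd (snd \<phi>)"
  "ide (space_cat P) X = (X, rmap_id (fst X), X)"
  "cmp (space_cat P) \<psi> \<phi> =
    (fst \<phi>, rmap_comp (fst (fst \<phi>)) (fst (snd (snd \<phi>))) (fst (snd (snd \<psi>))) (fst (snd \<psi>)) (fst (snd \<phi>)), snd (snd \<psi>))"
  "(X, \<theta>, Y) \<in> ar (space_cat P) \<longleftrightarrow> P X \<and> P Y \<and> lrs_map (fst X) (fst Y) \<theta> \<and> struc_compatible X Y \<theta>"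
  by (auto simp: space_cat_def split: prod.splits)

lemma open_incl_ar:
  assumes M: "complex_space M" and U: "open_in (fst M) U"
  shows "(open_sub_space M U, open_incl (fst M) U, M) \<in> ar (space_cat complex_space)"
proof -
  obtain Z c where Z: "M = (Z, CAlg c)" "lrs Z" "\<And>z. c z \<in> carrier (sect Z (topspace (top_of Z)))"
    by (rule complex_spaceE[OF M]) (blast intro: that)
  have U': "open_in Z U" using U Z(1) by simp
  have "calg_compatible Z (\<lambda>z. rst Z (topspace (top_of Z)) U (c z)) c (open_incl Z U)"
    using Z(3) openin_subset[OF U'] by (simp add: calg_compatible_def open_incl_def Int_absorb1)
  then show ?thesis
    using M complex_space_open_sub[OF M U] lrs_map_open_incl[OF Z(2) U']
    by (simp add: Z(1) struc_compatible_def open_sub_space_CAlg)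
qed

text \<open>Both subspaces carry the restricted constants, and the morphism commutes with
  restriction.\<close>

lemma restrict_rmap_ar:
  assumes \<phi>: "(M, (f, h), N) \<in> ar (space_cat complex_space)" and V: "open_in (fst N) V"
  shows "(open_sub_space M (preim (fst M) f V), restrict_rmap (fst M) (fst N) V (f, h), open_sub_space N V)
    \<in> ar (space_cat complex_space)"
proof -
  have M: "complex_space M" and N: "complex_space N" and fh: "lrs_map (fst M) (fst N) (f, h)"
    and compat: "struc_compatible M N (f, h)"
    using \<phi> by simp_all
  obtain X c where X: "M = (X, CAlg c)" "lrs X" "\<And>z. c z \<in> carrier (sect X (topspace (top_of X)))"
    by (rule complex_spaceE[OF M]) (blast intro: that)
  obtain Y d where Y: "N = (Y, CAlg d)" "lrs Y" "\<And>z. d z \<in> carrier (sect Y (topspace (top_of Y)))"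
    by (rule complex_spaceE[OF N]) (blast intro: that)
  have V': "open_in Y V" using V Y(1) by simp
  have fh': "ringed_map X Y (f, h)" and cont: "continuous_map (top_of X) (top_of Y) f"
    using fh X(1) Y(1) by (simp_all add: lrs_map_iff)
  let ?U = "preim X f V"
  have U: "open_in X ?U" by (rule ringed_map_open[OF fh' V'])
  have top: "preim X f (topspace (top_of Y)) = topspace (top_of X)"
    using cont by (auto simp: preim_def continuous_map_def)
  have "h V (rst Y (topspace (top_of Y)) V (d z)) = rst X (topspace (top_of X)) ?U (c z)" for z
    using ringed_map_rst[OF fh' openin_topspace V' openin_subset[OF V'] Y(3)] compat
    by (simp add: X(1) Y(1) struc_compatible_def calg_compatible_def top)
  then have "calg_compatible (open_sub Y V) (\<lambda>z. rst X (topspace (top_of X)) ?U (c z))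
      (\<lambda>z. rst Y (topspace (top_of Y)) V (d z)) (restrict_rmap X Y V (f, h))"
    using V' unfolding calg_compatible_def open_sub_simps topspace_open_sub[OF V'] by (simp add: restrict_rmap_def)
  then show ?thesis
    using complex_space_open_sub[OF M, of ?U] complex_space_open_sub[OF N V] U lrs_map_restrict[OF _ V', of X f h] fh
    by (simp add: X(1) Y(1) struc_compatible_def open_sub_space_CAlg)
qed

section \<open>Neighbourhoods of a point of a complex space\<close>

type_synonym ('x, 'r, 'y, 's) space_cat = "(('x, 'r, 'y, 's) space, ('x, 'r, 'y, 's) space_map) cat"

text \<open>The colimit over these arrows consists of germs at \<open>p\<close> of morphisms out of
  neighbourhoods in \<open>M\<close>. Each inclusion is formed inside the subspace on
  \<open>U\<close>, since that is its target in the site.\<close>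

definition neighborhood_inclusions ::
    "('x, 'r, 'y, 's) space \<Rightarrow> 'x \<Rightarrow> ('x, 'r, 'y, 's) space_map set" where
  "neighborhood_inclusions M p = {(open_sub_space M V, open_incl (open_sub (fst M) U) V, open_sub_space M U) | U V.
     open_in (fst M) U \<and> open_in (fst M) V \<and> p \<in> V \<and> V \<subseteq> U}"

lemma neighborhood_inclusion_ar:
  assumes M: "complex_space M" and U: "open_in (fst M) U" and V: "open_in (fst M) V" "V \<subseteq> U"
  shows "(open_sub_space M V, open_incl (open_sub (fst M) U) V, open_sub_space M U) \<in> ar (space_cat complex_space)"
proof -
  have "open_in (fst (open_sub_space M U)) V"
    using V by (simp add: openin_open_subtopology[OF U])
  from open_incl_ar[OF complex_space_open_sub[OF M U] this] show ?thesis
    by (simp add: open_sub_space_open_sub_space[OF M U V])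
qed

text \<open>Identities and composites are again inclusions on the nose, the two objects of an arrow
  determine the open sets and hence the arrow, and the intersection of two neighbourhoods refines
  both.\<close>

lemma codirected_neighborhoods:
  fixes M :: "('x, 'r, 'y, 's) space"
  assumes C: "category (space_cat complex_space :: ('x, 'r, 'y, 's) space_cat)"
    and M: "complex_space M" and p: "p \<in> topspace (top_of (fst M))"
  shows "codirected_system (space_cat complex_space) (neighborhood_inclusions M p)"
proof
  let ?C = "space_cat complex_space :: ('x, 'r, 'y, 's) space_cat"
  let ?Z = "fst M"
  let ?incl = "\<lambda>V U. (open_sub_space M V, open_incl (open_sub ?Z U) V, open_sub_space M U)"
  have RE: "\<exists>U V. a = ?incl V U \<and> open_in ?Z U \<and> open_in ?Z V \<and> p \<in> V \<and> V \<subseteq> U"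
    if "a \<in> neighborhood_inclusions M p" for a
    using that by (simp add: neighborhood_inclusions_def)
  have RI: "?incl V U \<in> neighborhood_inclusions M p"
    if "open_in ?Z U" "open_in ?Z V" "p \<in> V" "V \<subseteq> U" for U V
    using that unfolding neighborhood_inclusions_def by blast
  have rs: "ringed_space ?Z"
    using M by (rule complex_spaceE) (simp add: lrs_ringed_space)
  have ide: "ide ?C (open_sub_space M U) = ?incl U U" if U: "open_in ?Z U" for U
    using open_incl_topspace[OF ringed_space_open_sub[OF rs U]] topspace_open_sub[OF U] by simp
  show "category ?C" by (rule C)
  show "neighborhood_inclusions M p \<subseteq> ar ?C"
    using neighborhood_inclusion_ar[OF M] RE by (metis subsetI)
  show "neighborhood_inclusions M p \<noteq> {}"
    using RI[OF openin_topspace openin_topspace p] by blast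
  show "ide ?C (src ?C a) \<in> neighborhood_inclusions M p" "ide ?C (tgt ?C a) \<in> neighborhood_inclusions M p"
    if a: "a \<in> neighborhood_inclusions M p" for a
  proof -
    obtain U V where "a = ?incl V U" "open_in ?Z U" "open_in ?Z V" "p \<in> V" "V \<subseteq> U"
      using RE[OF a] by blast
    then show "ide ?C (src ?C a) \<in> neighborhood_inclusions M p" "ide ?C (tgt ?C a) \<in> neighborhood_inclusions M p"
      using RI[of V V] RI[of U U] ide[of U] ide[of V] by auto
  qed
  show "cmp ?C a b \<in> neighborhood_inclusions M p"
    if a: "a \<in> neighborhood_inclusions M p" and b: "b \<in> neighborhood_inclusions M p" and eq: "src ?C a = tgt ?C b" for a b
  proof -
    obtain U V where 1: "a = ?incl V U" "open_in ?Z U" "open_in ?Z V" "p \<in> V" "V \<subseteq> U"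
      using RE[OF a] by blast
    obtain V' W where 2: "b = ?incl W V'" "open_in ?Z V'" "open_in ?Z W" "p \<in> W" "W \<subseteq> V'"
      using RE[OF b] by blast
    have "V' = V" using eq open_sub_space_inj[OF 1(3) 2(2)] 1(1) 2(1) by simp
    have o: "open_in (open_sub ?Z U) V" "open_in (open_sub ?Z U) W"
      using 1 2 \<open>V' = V\<close> by (auto simp: openin_open_subtopology[OF 1(2)])
    have WU: "W \<subseteq> U" and WV: "W \<subseteq> V" using 1(5) 2(5) \<open>V' = V\<close> by auto
    have "cmp ?C a b = ?incl W U"
      using open_incl_comp[OF ringed_space_open_sub[OF rs 1(2)] o WV]
      by (simp add: 1(1) 2(1) \<open>V' = V\<close> open_sub_open_sub[OF 1(5)] open_sub_open_sub[OF WU])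
    with RI[OF 1(2) 2(3,4) WU] show ?thesis by (simp only:)
  qed
  show "a = b"
    if a: "a \<in> neighborhood_inclusions M p" and b: "b \<in> neighborhood_inclusions M p"
      and eq: "src ?C a = src ?C b" "tgt ?C a = tgt ?C b" for a b
  proof -
    obtain U V where 1: "a = ?incl V U" "open_in ?Z U" "open_in ?Z V"
      using RE[OF a] by blast
    obtain U' V' where 2: "b = ?incl V' U'" "open_in ?Z U'" "open_in ?Z V'"
      using RE[OF b] by blast
    have "V = V'" "U = U'"
      using eq open_sub_space_inj[OF 1(3) 2(3)] open_sub_space_inj[OF 1(2) 2(2)] 1(1) 2(1) by simp_all
    then show ?thesis by (simp add: 1(1) 2(1))
  qed
  show "\<exists>c\<in>neighborhood_inclusions M p. \<exists>d\<in>neighborhood_inclusions M p.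
      src ?C c = src ?C d \<and> tgt ?C c = tgt ?C a \<and> tgt ?C d = tgt ?C b"
    if a: "a \<in> neighborhood_inclusions M p" and b: "b \<in> neighborhood_inclusions M p" for a b
  proof -
    obtain U V where 1: "a = ?incl V U" "open_in ?Z U" "open_in ?Z V" "p \<in> V" "V \<subseteq> U"
      using RE[OF a] by blast
    obtain U' V' where 2: "b = ?incl V' U'" "open_in ?Z U'" "open_in ?Z V'" "p \<in> V'" "V' \<subseteq> U'"
      using RE[OF b] by blast
    have W: "open_in ?Z (V \<inter> V')" "p \<in> V \<inter> V'" "V \<inter> V' \<subseteq> U" "V \<inter> V' \<subseteq> U'"
      using 1 2 by auto
    show ?thesis
      using RI[OF 1(2) W(1-3)] RI[OF 2(2) W(1,2,4)]
      by (intro bexI[of _ "?incl (V \<inter> V') U"] bexI[of _ "?incl (V \<inter> V') U'"]) (simp_all add: 1(1) 2(1))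
  qed
qed

text \<open>For an arrow from a neighbourhood of \<open>p\<close> to a covered space, some open set
  \<open>V\<close> of the covering contains the image of \<open>p\<close>. Its preimage is a smaller
  neighbourhood, on which the arrow factors through the inclusion of \<open>V\<close> and so lies in
  the sieve.\<close>

lemma is_point_neighborhood_germs:
  fixes M :: "('x, 'r, 'y, 's) space"
  assumes C: "category (space_cat complex_space :: ('x, 'r, 'y, 's) space_cat)"
    and M: "complex_space M" and p: "p \<in> topspace (top_of (fst M))"
  defines "R \<equiv> neighborhood_inclusions M p"
  shows "is_point (space_cat complex_space) (strong_topology (space_cat complex_space))
    (codirected_system.germ_functor (space_cat complex_space) R)"
proof -
  let ?C = "space_cat complex_space :: ('x, 'r, 'y, 's) space_cat"
  interpret codirected_system ?C R
    unfolding R_def by (rule codirected_neighborhoods[OF C M p])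
  show ?thesis
  proof (rule is_point_germ_functor)
    fix N U S \<phi>
    assume N: "N \<in> system_ob" and S: "S \<in> strong_topology ?C U" and \<phi>: "\<phi> \<in> Hom ?C N U"
    obtain b where b: "b \<in> R" "N = tgt ?C b"
      using N unfolding system_ob_def by blast
    then obtain G where G: "N = open_sub_space M G" "open_in (fst M) G" "p \<in> G"
      by (auto simp: R_def neighborhood_inclusions_def)
    obtain f h where fh: "\<phi> = (N, (f, h), U)"
      using HomD[OF \<phi>] by (cases \<phi>) auto
    have ar: "(N, (f, h), U) \<in> ar ?C" using HomD(1)[OF \<phi>] fh by simp
    then have U: "complex_space U" and lrs: "lrs_map (fst N) (fst U) (f, h)" by simp_all
    have topN: "topspace (top_of (fst N)) = G" using topspace_open_sub[OF G(2)] G(1) by simp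
    have "f p \<in> topspace (top_of (fst U))"
      using lrs topN G(3) by (auto simp: lrs_map_iff continuous_map_def)
    then obtain V where V: "open_in (fst U) V" "f p \<in> V" "(open_sub_space U V, open_incl (fst U) V, U) \<in> S"
      using S unfolding strong_topology_def by blast
    let ?W = "preim (fst N) f V"
    have "ringed_map (fst N) (fst U) (f, h)" using lrs by (simp add: lrs_map_iff)
    then have "open_in (fst N) ?W" by (rule ringed_map_open[OF _ V(1)])
    then have W: "open_in (fst M) ?W" "?W \<subseteq> G"
      by (simp_all add: G(1) openin_open_subtopology[OF G(2)])
    have pW: "p \<in> ?W" using V(2) G(3) topN by (simp add: preim_def)
    let ?a = "(open_sub_space M ?W, open_incl (open_sub (fst M) G) ?W, N)"
    have NW: "open_sub_space N ?W = open_sub_space M ?W"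
      unfolding G(1) by (rule open_sub_space_open_sub_space[OF M G(2) W[unfolded G(1)]])
    have a: "?a \<in> R"
      unfolding R_def neighborhood_inclusions_def using G W pW by blast
    let ?\<psi> = "(open_sub_space M ?W, restrict_rmap (fst N) (fst U) V (f, h), open_sub_space U V)"
    have \<psi>: "?\<psi> \<in> ar ?C"
      using restrict_rmap_ar[OF ar V(1)] by (simp only: NW)
    have "fst (open_sub_space M ?W) = open_sub (fst N) ?W"
      using NW fst_open_sub_space[of N ?W] by simp
    then have "cmp ?C \<phi> ?a = cmp ?C (open_sub_space U V, open_incl (fst U) V, U) ?\<psi>"
      using restrict_rmap_incl[OF lrs V(1)] by (simp add: fh G(1))
    also have "\<dots> \<in> S"
    proof -
      have "sieve ?C U S" using S unfolding strong_topology_def by blast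
      then have "\<forall>f\<in>S. \<forall>g\<in>ar ?C. tgt ?C g = src ?C f \<longrightarrow> cmp ?C f g \<in> S"
        unfolding sieve_def by (elim conjE)
      from this[rule_format, OF V(3) \<psi>] show ?thesis by simp
    qed
    finally show "\<exists>a\<in>R. tgt ?C a = N \<and> cmp ?C \<phi> a \<in> S"
      using a by (intro bexI[of _ ?a]) simp_all
  qed
qed

text \<open>The arrows along which \<open>s\<close> and \<open>t\<close> have the same restriction
  form a sieve. Equal germs at \<open>p\<close> put the inclusion of a neighbourhood of
  \<open>p\<close> into it, so the sieve covers in the strong topology and separatedness
  applies.\<close>

lemma complex_sheaf_separated:
  fixes F :: "(('x, 'r, 'y, 's) space, ('x, 'r, 'y, 's) space_map, 'v) psh"
  defines "C \<equiv> space_cat complex_space :: ('x, 'r, 'y, 's) space_cat"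
  defines "J \<equiv> strong_topology C"
  assumes C: "category C" and F: "is_functor (opposite C) set_cat F" "is_sheaf C J F"
    and M: "M \<in> ob C" and s: "s \<in> on_ob F M" and t: "t \<in> on_ob F M"
    and eq: "\<And>u x. is_point C J u \<Longrightarrow> x \<in> on_ob u M \<Longrightarrow> point_germ C u F (M, x, s) = point_germ C u F (M, x, t)"
  shows "s = t"
proof -
  have M': "complex_space M" using M by (simp add: C_def)
  let ?S = "{g \<in> ar C. tgt C g = M \<and> app (on_ar F g) s = app (on_ar F g) t}"
  have sieve: "sieve C M ?S"
    unfolding sieve_def
  proof (intro conjI ballI impI)
    fix f g assume f: "f \<in> ?S" and g: "g \<in> ar C" "tgt C g = src C f"
    then have f': "f \<in> Hom C (src C f) M" and g': "g \<in> Hom C (src C g) (src C f)" by (simp_all add: Hom_def)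
    from category_cmp[OF C g' f'] show "cmp C f g \<in> ?S"
      using f psh_cmp[OF F(1) f' g' s] psh_cmp[OF F(1) f' g' t] by (simp add: Hom_def)
  qed blast
  have local: "\<exists>U. open_in (fst M) U \<and> p \<in> U \<and> (open_sub_space M U, open_incl (fst M) U, M) \<in> ?S"
    if p: "p \<in> topspace (top_of (fst M))" for p
  proof -
    let ?R = "neighborhood_inclusions M p"
    interpret codirected_system C ?R
      unfolding C_def by (rule codirected_neighborhoods[OF C[unfolded C_def] M' p])
    have point: "is_point C J germ_functor"
      using is_point_neighborhood_germs[OF C[unfolded C_def] M' p] by (simp add: C_def J_def)
    \<comment> \<open>The subspace on the whole underlying set is literally \<open>M\<close>, which
      makes \<open>M\<close> a member of the system; the germ of its identity is the element at
      which germs are compared.\<close>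
    let ?top = "topspace (top_of (fst M))"
    have "(open_sub_space M ?top, open_incl (open_sub (fst M) ?top) ?top, open_sub_space M ?top) \<in> ?R"
      unfolding neighborhood_inclusions_def using p openin_topspace by blast
    then have "tgt C (open_sub_space M ?top, open_incl (open_sub (fst M) ?top) ?top, open_sub_space M ?top) \<in> system_ob"
      unfolding system_ob_def by (rule imageI)
    then have Mo: "M \<in> system_ob"
      by (simp add: C_def open_sub_space_topspace[OF M'])
    obtain a where a: "a \<in> ?R" "tgt C a = M" "app (on_ar F a) s = app (on_ar F a) t"
      using point_germ_functor_separates[OF point F(1) Mo s t
          eq[OF point germ_ofI[OF category_ide[OF C M] Mo]]] by blast
    obtain U V where UV: "a = (open_sub_space M V, open_incl (open_sub (fst M) U) V, open_sub_space M U)"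
      "open_in (fst M) U" "open_in (fst M) V" "p \<in> V" "V \<subseteq> U"
      using a(1) by (auto simp: neighborhood_inclusions_def)
    \<comment> \<open>\<open>strong_topology\<close> asks for inclusions into \<open>M\<close>
      itself, while \<open>a\<close> is an inclusion into the subspace on \<open>U\<close>; the two
      targets are equal, hence so are the inclusions.\<close>
    have MU: "open_sub_space M U = M" using a(2) UV(1) by (simp add: C_def)
    then have "open_sub (fst M) U = fst M" using fst_open_sub_space[of M U] by simp
    with UV(1) MU have "a = (open_sub_space M V, open_incl (fst M) V, M)" by simp
    moreover have "a \<in> ar C" using a(1) R_ar by blast
    ultimately show ?thesis using a UV(3,4) by blast
  qed
  have "?S \<in> J M"
    unfolding J_def strong_topology_def using sieve local by blast
  then show ?thesis
    by (rule sheaf_separated[OF F M _ sieve s t]) blast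
qed

text \<open>The stalk map sends the germ of a section to the germ of its image. So equal stalk maps
  give sections of \<open>Y\<close> with equal germs at all points, and these coincide.\<close>

lemma complex_points_faithful:
  fixes f g :: "(('x, 'r, 'y, 's) space, ('x, 'r, 'y, 's) space_map, 'v) psh_map"
  defines "C \<equiv> space_cat complex_space :: ('x, 'r, 'y, 's) space_cat"
  defines "J \<equiv> strong_topology C"
  assumes f: "f \<in> Hom (Sh C J) X Y" and g: "g \<in> Hom (Sh C J) X Y"
    and eq: "\<And>u c. is_point C J u \<Longrightarrow> c \<in> stalk_set C u X \<Longrightarrow>
      app (on_ar (stalk_functor C u) f) c = app (on_ar (stalk_functor C u) g) c"
  shows "f = g"
proof -
  obtain \<phi> where \<phi>: "f = (X, \<phi>, Y)" "(X, \<phi>, Y) \<in> ar (functor_cat (opposite C) set_cat)"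
    and Y: "is_sheaf C J Y"
    using f by (auto simp: Sh_Hom)
  obtain \<gamma> where \<gamma>: "g = (X, \<gamma>, Y)" "(X, \<gamma>, Y) \<in> ar (functor_cat (opposite C) set_cat)"
    using g by (auto simp: Sh_Hom)
  have fY: "is_functor (opposite C) set_cat Y" using \<phi>(2) by (simp add: functor_cat_ar)
  then have C: "category C"
    using category_opposite[of "opposite C"] by (simp add: is_functor_def)
  have "app (\<phi> U) s = app (\<gamma> U) s" if U: "U \<in> ob C" and s: "s \<in> on_ob X U" for U s
  proof (rule complex_sheaf_separated[OF C[unfolded C_def] fY[unfolded C_def] Y[unfolded J_def C_def] U[unfolded C_def]
        psh_map_in[OF \<phi>(2) U s] psh_map_in[OF \<gamma>(2) U s], folded C_def, folded J_def])
    fix u x assume u: "is_point C J u" and x: "x \<in> on_ob u U"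
    interpret topos_point C J u by standard (rule C u)+
    have "point_germ C u X (U, x, s) \<in> stalk_set C u X"
      unfolding stalk_set_def using U x s by blast
    from eq[OF u this] show "point_germ C u Y (U, x, app (\<phi> U) s) = point_germ C u Y (U, x, app (\<gamma> U) s)"
      unfolding \<phi>(1) \<gamma>(1) stalk_map_point_germ[OF \<phi>(2) U x s] stalk_map_point_germ[OF \<gamma>(2) U x s] .
  qed
  then have "\<phi> = \<gamma>"
    by (intro ntrans_eqI[OF \<phi>(2) \<gamma>(2)]) simp
  then show ?thesis by (simp add: \<phi>(1) \<gamma>(1))
qed

lemma loc_ar_Hom:
  assumes "category C" "f \<in> Hom C X Y"
  shows "loc_ar C W f \<in> Hom (localization C W) X Y"
proof -
  have "zigzag C W (src C f) [Fwd f] (tgt C f)"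
    using HomD[OF assms(2)] Hom_ob[OF assms] by (intro zigzag.intros) auto
  then show ?thesis
    using HomD[OF assms(2)] by (intro HomI) (auto simp: localization_def loc_ar_def)
qed

text \<open>The triangle is formed in \<open>Hs\<close>, since \<open>f'\<close> is a morphism
  there. Strictness is therefore expressed by saying that its composite comes from a sheaf map and
  that \<open>f\<close> is the only sheaf map from which it comes.\<close>

theorem corollary2p1:
  fixes B :: "('y, 's) rspace"
    and C :: "(('x, 'r, 'y, 's) space, ('x, 'r, 'y, 's) space_map) cat"
    and J :: "('x, 'r, 'y, 's) space \<Rightarrow> ('x, 'r, 'y, 's) space_map set set"
    and A :: "('x, 'r, 'y, 's) space"
    and X Y :: "(('x, 'r, 'y, 's) space, ('x, 'r, 'y, 's) space_map, 'v) psh"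
    and f :: "(('x, 'r, 'y, 's) space, ('x, 'r, 'y, 's) space_map, 'v) psh_map"
  assumes site: "complex_site C J A \<or> algebraic_site B C J A \<and> enough_points TYPE('v) C J"
    and resolution: "hyperbolic_resolution C J A Ip r"
    and X: "X \<in> ob (Sh C J)"
    and Y: "Y \<in> ob (Sh C J)" "hyperbolic C J A (const_ob C J Y)"
    and f: "f \<in> Hom (Sh C J) X Y"
  shows "(\<exists>!f'. f' \<in> Hom (Hs C J) (on_ob Ip (const_ob C J X)) (const_ob C J Y) \<and>
            cmp (Hs C J) f' (to_Hs C J (r (const_ob C J X))) = to_Hs C J (const_ar C J f)) \<and>
    (\<forall>f' \<in> Hom (Hs C J) (on_ob Ip (const_ob C J X)) (const_ob C J Y).
       cmp (Hs C J) f' (to_Hs C J (r (const_ob C J X))) = to_Hs C J (const_ar C J f) \<longrightarrow>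
         (\<exists>g \<in> Hom (Sh C J) X Y.
            cmp (Hs C J) f' (to_Hs C J (r (const_ob C J X))) = to_Hs C J (const_ar C J g)) \<and>
         (\<forall>g \<in> Hom (Sh C J) X Y.
            cmp (Hs C J) f' (to_Hs C J (r (const_ob C J X))) = to_Hs C J (const_ar C J g) \<longrightarrow>
            g = f))"
proof -
  \<comment> \<open>A hypothesis about a functor brings the category axioms of its source and target
    with it.\<close>
  have sSh: "category (sSh C J :: ((('x, 'r, 'y, 's) space, ('x, 'r, 'y, 's) space_map, 'v) spsh, _) cat)"
    using resolution by (simp add: hyperbolic_resolution_def is_functor_def)
  have "is_functor (opposite simplex_cat) (Sh C J) (const_ob C J Y)"
    using Y(2) by (simp add: hyperbolic_def sSh_def)
  then have simplex: "category (opposite simplex_cat)"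
    and Sh: "category (Sh C J :: ((('x, 'r, 'y, 's) space, ('x, 'r, 'y, 's) space_map, 'v) psh, _) cat)"
    by (simp_all add: is_functor_def)
  have "is_functor (opposite C) set_cat X" using X by simp
  then have C: "category C"
    using category_opposite[of "opposite C"] by (simp add: is_functor_def)
  let ?X = "const_ob C J X" and ?Y = "const_ob C J Y"
  let ?r = "\<lambda>g. cmp (Hs C J) g (to_Hs C J (r ?X))"
  have X': "?X \<in> ob (sSh C J)" by (rule const_ob_in_sSh[OF simplex Sh X])
  \<comment> \<open>The source of strictness: equality in \<open>Hs\<close> becomes equality of
    stalk maps, and then points are used in the way that suits the site.\<close>
  have faithful: "g = f" if g: "g \<in> Hom (Sh C J) X Y" and eq: "to_Hs C J (const_ar C J f) = to_Hs C J (const_ar C J g)" for g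
  proof -
    have stalks: "app (on_ar (stalk_functor C u) g) c = app (on_ar (stalk_functor C u) f) c"
      if u: "is_point C J u" and c: "c \<in> stalk_set C u X" for u c
    proof -
      interpret topos_point C J u by standard (rule C u)+
      show ?thesis by (rule stalk_eq_if_to_Hs_eq[OF sSh simplex Sh g f eq[symmetric] c])
    qed
    show "g = f"
      using site
    proof
      assume "complex_site C J A"
      then have CJ: "C = space_cat complex_space" "J = strong_topology (space_cat complex_space)"
        by (auto simp: complex_site_def)
      show ?thesis
        by (rule complex_points_faithful[OF g[unfolded CJ] f[unfolded CJ] stalks[unfolded CJ]])
    next
      assume alg: "algebraic_site B C J A \<and> enough_points TYPE('v) C J"
      then have "grothendieck_topology C J" unfolding algebraic_site_def by (elim conjE)
      then have "sieve C U S" if "U \<in> ob C" "S \<in> J U" for U S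
        using that unfolding grothendieck_topology_def by blast
      then show ?thesis
        by (rule enough_points_faithful[OF conjunct2[OF alg] _ g f stalks])
    qed
  qed
  have "(id_functor, r, Ip) \<in> ar (functor_cat (sSh C J) (sSh C J))" and r: "affine_weq C J A (r ?X)"
    using resolution X' by (simp_all add: hyperbolic_resolution_def)
  then have "r ?X \<in> Hom (sSh C J) ?X (on_ob Ip ?X)"
    using X' by (simp add: functor_cat_ar id_functor_def)
  \<comment> \<open>\<open>Y\<close> is hyperbolic, so it is one of the objects against which the
    affine weak equivalence \<open>r\<close> is tested.\<close>
  then have bij: "bij_betw ?r (Hom (Hs C J) (on_ob Ip ?X) ?Y) (Hom (Hs C J) ?X ?Y)"
    using r Y(2) by (simp add: affine_weq_def Hom_def[of "sSh C J"])
  have fHs: "to_Hs C J (const_ar C J f) \<in> Hom (Hs C J) ?X ?Y"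
    unfolding to_Hs_def Hs_def by (rule loc_ar_Hom[OF sSh const_ar_Hom[OF simplex Sh f]])
  show ?thesis
  proof (intro conjI ballI impI)
    obtain h where h: "h \<in> Hom (Hs C J) (on_ob Ip ?X) ?Y" "?r h = to_Hs C J (const_ar C J f)"
      using bij_betw_imp_surj_on[OF bij] fHs by (metis (no_types, lifting) imageE)
    show "\<exists>!f'. f' \<in> Hom (Hs C J) (on_ob Ip ?X) ?Y \<and> ?r f' = to_Hs C J (const_ar C J f)"
    proof (rule ex1I[of _ h])
      show "h' = h" if "h' \<in> Hom (Hs C J) (on_ob Ip ?X) ?Y \<and> ?r h' = to_Hs C J (const_ar C J f)" for h'
        by (rule inj_onD[OF bij_betw_imp_inj_on[OF bij] trans[OF conjunct2[OF that] h(2)[symmetric]] conjunct1[OF that] h(1)])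
    qed (use h in simp)
  next
    fix f' assume eq: "?r f' = to_Hs C J (const_ar C J f)"
    show "\<exists>g\<in>Hom (Sh C J) X Y. ?r f' = to_Hs C J (const_ar C J g)"
      using eq by (rule bexI[OF _ f])
    show "g = f" if "g \<in> Hom (Sh C J) X Y" "?r f' = to_Hs C J (const_ar C J g)" for g
      by (rule faithful[OF that(1) trans[OF eq[symmetric] that(2)]])
  qed
qed

end
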